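(* Let $n,p\ge 1$ be integers, let $m_1,\dots,m_p$ be non-negative integers and let $a_1,\dots,a_{2n+2}$, $c_1,\dots,c_p$, $z_1,\dots,z_n$ be complex parameters such that, with $A=a_1a_2\cdots a_{2n+2}$ and $|m|=m_1+\dots+m_p$, one has $|q^{1-|m|}/A|<1$ and none of the denominators in the identity below vanishes. Then $$\sum_{y_1,\dots,y_n=-\infty}^\infty\frac{W(zq^y)}{W(z)} \prod_{\substack{1\leq k\leq n\\1\leq j\leq p}} \frac{(q^{m_j}c_jz_k,\,qz_k/c_j)_{y_k}}{(c_jz_k,\,q^{1-m_j}z_k/c_j)_{y_k}} \prod_{\substack {1\leq k\leq n\\1\leq j\leq 2n+2}} \frac{(a_jz_k)_{y_k}}{(qz_k/a_j)_{y_k}}\left(\frac{q^{1-|m|}}A\right)^{|y|}$$ $$=\frac{\prod_{1\leq j\leq k\leq n}(qz_jz_k,\,q/z_jz_k)_\infty \prod_{j,k=1}^n(qz_k/z_j)_\infty} {\prod_{1\leq k\leq n,\,1\leq j\leq 2n+2}(qz_k/a_j,\,q/a_jz_k)_\infty }\cdot\frac{\prod_{1\leq j<k\leq 2n+2}(q/a_ja_k)_\infty}{(q/A)_\infty}$$ $$\times\frac{\prod_{1\leq k\leq 2n+2,\,1\leq j\leq p} (c_ja_k)_{m_j}} {\prod_{1\leq k\leq n,\,1\leq j\leq p} (c_jz_k,\,c_j/z_k)_{m_j}}\cdot \frac{\prod_{1\leq j<k\leq p}(c_jc_k)_{m_j+m_k}} {\prod_{j,k=1}^p(c_jc_k)_{m_j}}\cdot\frac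 1{(A)_{|m|}}$$ $$\times\sum_{x_1,\dots,x_p=0}^{m_1,\dots,m_p} \frac{W(q^{-1/2}cq^x)}{W(q^{-1/2}c)} \prod_{\substack {1\leq k\leq 2n+2\\1\leq j\leq p}}\frac{(c_j/a_k)_{x_j}} {(c_ja_k)_{x_j}}\prod_{j,k=1}^p\frac{(q^{-1}c_jc_k,\,q^{-m_k}c_j/c_k)_{x_j}} {(qc_j/c_k,\,q^{m_k}c_jc_k)_{x_j}}\left(Aq^{|m|}\right)^{|x|}.$$
   Context: Throughout, $q$ is a fixed complex number with $0<|q|<1$. For an integer $k$, $(a)_k=(1-a)(1-aq)\cdots(1-aq^{k-1})$ if $k\ge 0$ (so $(a)_0=1$), and $(a)_k=\dfrac{1}{(1-aq^{-1})(1-aq^{-2})\cdots(1-aq^{k})}$ if $k<0$; $(a)_\infty=\prod_{j=0}^\infty(1-aq^j)$. Also $(a_1,\dots,a_r)_k=(a_1)_k\cdots(a_r)_k$, and likewise with $k=\infty$. An expression such as $q/z_jz_k$ means $q/(z_jz_k)$. For a tuple $y$ (or $x$, $m$), $|y|$ denotes the sum of its coordinates. A tuple $zq^y$ means $(z_1q^{y_1},\dots,z_nq^{y_n})$, and $q^{-1/2}cq^x=(q^{-1/2}c_1q^{x_1},\dots,q^{-1/2}c_pq^{x_p})$. For an $N$-tuple $u=(u_1,\dots,u_N)$, $W(u)=\prod_{1\le j\le k\le N}(1-u_ju_k)\prod_{1\le j<k\le N}(u_j-u_k)$. Hence $$\frac{W(zq^y)}{W(z)}=\prod_{1\le j\le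 k\le n}\frac{1-z_jz_kq^{y_j+y_k}}{1-z_jz_k}\prod_{1\le j<k\le n}\frac{q^{y_j}z_j-q^{y_k}z_k}{z_j-z_k},$$ $$\frac{W(q^{-1/2}cq^x)}{W(q^{-1/2}c)}=\prod_{1\le j\le k\le p}\frac{1-q^{-1}c_jc_kq^{x_j+x_k}}{1-q^{-1}c_jc_k}\prod_{1\le j<k\le p}\frac{q^{x_j}c_j-q^{x_k}c_k}{c_j-c_k},$$ the latter not depending on the choice of $q^{1/2}$. The assumption that no denominators vanish includes that parameters by which one divides are non-zero and that the shifted factorials $(a)_k$ with $k<0$ which occur are well defined. The condition $|q^{1-|m|}/A|<1$ ensures that the multiple series over $\mathbb Z^n$ is absolutely convergent. The sum $\sum_{x_1,\dots,x_p=0}^{m_1,\dots,m_p}$ is over all integers $0\le x_i\le m_i$. *)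

theory Defs
  imports "HOL-Analysis.Analysis"
begin

text \<open>
  The shifted factorial $(a)_k$ to the base \<open>q\<close>, for an arbitrary integer \<open>k\<close>.
  Because \<open>1 / 0 = 0\<close>, for \<open>k < 0\<close> the condition \<open>qpoch q a k \<noteq> 0\<close> says exactly that
  $(a)_k$ is well defined (it is then the reciprocal of a finite product, hence non-zero).
\<close>

definition qpoch :: "complex \<Rightarrow> complex \<Rightarrow> int \<Rightarrow> complex" where
  "qpoch q a k =
     (if 0 \<le> k then (\<Prod>i<nat k. 1 - a * q ^ i)
      else 1 / (\<Prod>i=1..nat (- k). 1 - a * q powi (- int i)))"

definition qpoch_inf :: "complex \<Rightarrow> complex \<Rightarrow> complex" where
  "qpoch_inf q a = (\<Prod>j. 1 - a * q ^ j)"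

text \<open>Tuples of length \<open>N\<close> are functions on \<open>nat\<close>, of which only the values on \<open>{1..N}\<close> matter.\<close>

definition W :: "nat \<Rightarrow> (nat \<Rightarrow> complex) \<Rightarrow> complex" where
  "W N u = (\<Prod>k=1..N. \<Prod>j=1..k. 1 - u j * u k) * (\<Prod>k=1..N. \<Prod>j=1..<k. u j - u k)"

end

theory Submission
  imports Defs "Jordan_Normal_Form.Determinant"
begin

text \<open>
  With \<open>u = z q\<^sup>y\<close>, the weight \<open>omega\<close> of the very well-poised series in one variable
  and \<open>h\<close> a polynomial, put \<open>L\<^sub>z(h) = \<Sum>\<^sub>y omega(z,y) (1/u - u) h(u + 1/u)\<close>. The factors involving
  \<open>c\<^sub>j, m\<^sub>j\<close> amount to inserting \<open>(t + 1/t) - (u + 1/u)\<close> for \<open>t = c\<^sub>j q\<^sup>i\<close>, \<open>0 \<le> i < m\<^sub>j\<close>, so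
  together with \<open>W(zq\<^sup>y)\<close> they form a quotient of Vandermonde determinants in the variables
  \<open>u\<^sub>k + 1/u\<^sub>k\<close> and \<open>t + 1/t\<close>, and the multiple sum becomes a determinant of one-variable sums.
  In each degree \<open>\<ge> n\<close> there is a polynomial \<open>h\<close> whose sum \<open>L\<^sub>z(h)\<close> telescopes to zero. In the basis
  of these polynomials and the monomials of degree less than \<open>n\<close> the determinant is block
  triangular: it is the product of the sum without insertions (Gustafson's \<open>C\<^sub>n\<close> extension of
  Bailey's 6-psi-6 sum) and a finite determinant indexed by the points \<open>t\<close>.

  Gustafson's sum is evaluated by the contiguous relation that the insertion of a single
  \<open>t = b\<^sub>1\<close> provides: iterating \<open>b\<^sub>j \<rightarrow> q b\<^sub>j\<close> sends the parameters to \<open>0\<close>, and the remaining constant is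
  found at parameters for which only the term \<open>y = 0\<close> survives. The finite determinant expands
  multilinearly; all but one of the points \<open>c\<^sub>j q\<^sup>i\<close>, \<open>0 \<le> i \<le> m\<^sub>j\<close>, occur in each
  surviving term, and the omitted exponents \<open>x\<^sub>j\<close> index the sum on the right-hand side.

  Throughout, \<open>b\<^sub>j\<close> stands for \<open>1/a\<^sub>j\<close>.
\<close>

text \<open>The weight is a Gaussian factor times infinite products in \<open>b\<close>, since up to
  normalisation (a*z)_y / (q*z/a)_y * a^(-y) takes this form, symmetric under u -> 1/u and still
  defined for \<open>b j = 0\<close>. The value 0 is needed as the limit of the rescaling and in the
  special parameters. The polynomials with vanishing sums come from g(y) = omega * u^(-n-1) * prod
  (1 - b_j*u) * (u/s + s/u)^i, s^2 = q: the recurrence of \<open>omega\<close> makes g(y+1) - g(y)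
  equal to omega * (1/u - u) times a polynomial in u + 1/u. Its top coefficient is (B - q^i)/s^i
  with B the product of the b_j, whence (A)_|m|. The half step s also causes the finite sum: at a
  point t the polynomial combines powers of eps(t*s) and eps(t/s), so c*q^i and c*q^(i+1) share a
  node. Two obstacles shape the statements. Many factors may vanish, so recurrences stay multiplied
  out and common factors replace quotients. And the comparison with the special parameters breaks
  down when z_j = q^r * z_k or z_j * z_k = q^r with j, k distinct and r nonzero; there two rows of
  the determinant are proportional.\<close>

lemma summable_norm_powers:
  fixes q x :: complex
  assumes "norm q < 1"
  shows "summable (\<lambda>i. norm (x * q ^ i))"
proof -
  have "summable (\<lambda>i. norm x * norm q ^ i)"
    using assms by (intro summable_mult summable_geometric) auto
  thus ?thesis by (simp add: norm_mult norm_power)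
qed

lemma convergent_prod_qpoch:
  fixes q x :: complex
  assumes "norm q < 1"
  shows "convergent_prod (\<lambda>i. 1 - x * q ^ i)"
proof (rule abs_convergent_prod_imp_convergent_prod, rule summable_imp_abs_convergent_prod)
  show "summable (\<lambda>i. norm (1 - x * q ^ i - 1))"
    using summable_norm_powers[OF assms, of x] by simp
qed

lemma qpoch_inf_LIMSEQ:
  assumes "norm q < 1"
  shows "(\<lambda>N. \<Prod>i<N. 1 - x * q ^ i) \<longlonglongrightarrow> qpoch_inf q x"
  unfolding qpoch_inf_def
  using has_prod_imp_tendsto'[OF convergent_prod_has_prod[OF convergent_prod_qpoch[OF assms]]] .

lemma qpoch_inf_split:
  assumes "norm q < 1"
  shows "qpoch_inf q x = (\<Prod>i<N. 1 - x * q ^ i) * qpoch_inf q (x * q ^ N)"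
proof -
  have "qpoch_inf q x = (\<Prod>i<N. 1 - x * q ^ i) * (\<Prod>k. 1 - x * q ^ (k + N))"
    unfolding qpoch_inf_def
    using has_prod_ignore_initial_segment'[OF convergent_prod_qpoch[OF assms]]
    by (simp add: has_prod_iff)
  thus ?thesis unfolding qpoch_inf_def by (simp add: power_add mult_ac)
qed

lemma qpoch_inf_rec:
  assumes "norm q < 1"
  shows "qpoch_inf q x = (1 - x) * qpoch_inf q (q * x)"
  using qpoch_inf_split[OF assms, of x 1] by (simp add: mult.commute)

lemma qpoch_inf_eq_0_iff:
  assumes "norm q < 1"
  shows "qpoch_inf q x = 0 \<longleftrightarrow> (\<exists>i. x * q ^ i = 1)"
proof -
  have "(\<lambda>i. 1 - x * q ^ i) has_prod qpoch_inf q x"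
    unfolding qpoch_inf_def using convergent_prod_has_prod[OF convergent_prod_qpoch[OF assms]] .
  from has_prod_eq_0_iff[OF this] have "qpoch_inf q x = 0 \<longleftrightarrow> (\<exists>i. 0 = 1 - x * q ^ i)"
    by (simp add: image_iff)
  moreover have "0 = 1 - w \<longleftrightarrow> w = 1" for w :: complex by auto
  ultimately show ?thesis by simp
qed

text \<open>Factor by factor, 1 - x q^i has norm at most 1 + |t| |q|^i. The bound is written as an
  infinite product with base |q| and argument -|t|, so that a majorant of \<open>omega\<close> is
  again an \<open>omega\<close>.\<close>

lemma norm_qpoch_inf_le:
  fixes q x :: complex
  assumes q: "norm q < 1" and x: "norm x \<le> norm t"
  shows "norm (qpoch_inf q x) \<le> norm (qpoch_inf (of_real (norm q)) (- of_real (norm t)))"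
proof (rule LIMSEQ_le)
  show "(\<lambda>N. norm (\<Prod>i<N. 1 - x * q ^ i)) \<longlonglongrightarrow> norm (qpoch_inf q x)"
    by (intro tendsto_norm qpoch_inf_LIMSEQ q)
  show "(\<lambda>N. norm (\<Prod>i<N. 1 - (- of_real (norm t)) * of_real (norm q) ^ i :: complex))
           \<longlonglongrightarrow> norm (qpoch_inf (of_real (norm q)) (- of_real (norm t)))"
    by (intro tendsto_norm qpoch_inf_LIMSEQ) (use q in auto)
  have "norm (\<Prod>i<N. 1 - x * q ^ i) \<le> norm (\<Prod>i<N. 1 - (- of_real (norm t)) * of_real (norm q) ^ i :: complex)" for N
    unfolding prod_norm[symmetric]
  proof (intro prod_mono conjI)
    fix i
    have "norm (1 - x * q ^ i) \<le> 1 + norm x * norm q ^ i"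
      using norm_triangle_ineq4[of 1 "x * q ^ i"] by (simp add: norm_mult norm_power)
    also have "\<dots> \<le> 1 + norm t * norm q ^ i"
      using x by (intro add_mono mult_right_mono) auto
    also have "\<dots> = norm (of_real (1 + norm t * norm q ^ i) :: complex)"
      by (simp only: norm_of_real) simp
    also have "\<dots> = norm (1 - (- of_real (norm t)) * of_real (norm q) ^ i :: complex)"
      by simp
    finally show "norm (1 - x * q ^ i) \<le> norm (1 - (- of_real (norm t)) * of_real (norm q) ^ i :: complex)" .
  qed simp
  thus "\<exists>N. \<forall>n\<ge>N. norm (\<Prod>i<n. 1 - x * q ^ i)
      \<le> norm (\<Prod>i<n. 1 - (- of_real (norm t)) * of_real (norm q) ^ i :: complex)" by blast
qed

lemma norm_qpoch_inf_minus_1_le: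
  fixes q x :: complex
  assumes q: "norm q < 1"
  shows "norm (qpoch_inf q x - 1) \<le> exp (norm x / (1 - norm q)) - 1"
proof (rule LIMSEQ_le_const2)
  show "(\<lambda>N. norm ((\<Prod>i<N. 1 - x * q ^ i) - 1)) \<longlonglongrightarrow> norm (qpoch_inf q x - 1)"
    by (intro tendsto_intros qpoch_inf_LIMSEQ q)
  have "norm ((\<Prod>i<N. 1 - x * q ^ i) - 1) \<le> exp (norm x / (1 - norm q)) - 1" for N
  proof -
    have "norm ((\<Prod>i<N. 1 - x * q ^ i) - 1) = norm ((\<Prod>i<N. 1 + (- x * q ^ i)) - 1)" by simp
    also have "\<dots> \<le> (\<Prod>i<N. 1 + norm (- x * q ^ i)) - 1"
      by (rule norm_prod_minus1_le_prod_minus1)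
    also have "(\<Prod>i<N. 1 + norm (- x * q ^ i)) \<le> exp (\<Sum>i<N. norm (- x * q ^ i))"
      by (rule prod_le_exp_sum) auto
    also have "(\<Sum>i<N. norm (- x * q ^ i)) \<le> (\<Sum>i. norm (- x * q ^ i))"
      using summable_norm_powers[OF q, of "-x"] by (intro sum_le_suminf) auto
    also have "\<dots> = norm x / (1 - norm q)"
      using q by (simp add: norm_mult norm_power suminf_mult suminf_geometric)
    finally show ?thesis by simp
  qed
  thus "\<exists>N. \<forall>n\<ge>N. norm ((\<Prod>i<n. 1 - x * q ^ i) - 1) \<le> exp (norm x / (1 - norm q)) - 1" by blast
qed

lemma tendsto_qpoch_inf_1:
  fixes q :: complex
  assumes q: "norm q < 1" and f: "(f \<longlongrightarrow> 0) F"
  shows "((\<lambda>x. qpoch_inf q (f x)) \<longlongrightarrow> 1) F"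
proof -
  have "((\<lambda>x. exp (norm (f x) / (1 - norm q)) - 1) \<longlongrightarrow> exp (norm (0::complex) / (1 - norm q)) - 1) F"
    by (intro tendsto_intros f) (use q in auto)
  hence "((\<lambda>x. exp (norm (f x) / (1 - norm q)) - 1) \<longlongrightarrow> 0) F" by simp
  hence "((\<lambda>x. qpoch_inf q (f x) - 1) \<longlongrightarrow> 0) F"
    by (rule Lim_null_comparison[rotated])
      (intro always_eventually allI norm_qpoch_inf_minus_1_le q)
  thus ?thesis by (simp add: LIM_zero_iff)
qed

section \<open>Bilateral sums over the integers\<close>

lemma infsum_int_split:
  fixes f :: "int \<Rightarrow> 'a :: banach"
  assumes "(\<lambda>x. norm (f x)) summable_on UNIV"
  shows "infsum f UNIV = (\<Sum>k. f (int k)) + (\<Sum>k. f (- int (Suc k)))"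
    and "summable (\<lambda>k. norm (f (int k)))" "summable (\<lambda>k. norm (f (- int (Suc k))))"
proof -
  let ?A = "range int" and ?B = "range (\<lambda>k. - int (Suc k))"
  have U: "UNIV = ?A \<union> ?B"
  proof (rule UNIV_eq_I, rule UnCI)
    fix x :: int assume x: "x \<notin> ?B"
    have "x \<ge> 0"
    proof (rule ccontr)
      assume "\<not> x \<ge> 0"
      hence "x = - int (Suc (nat (- x - 1)))" by simp
      hence "x \<in> ?B" by (rule range_eqI)
      with x show False by simp
    qed
    hence "x = int (nat x)" by simp
    thus "x \<in> ?A" by (rule range_eqI)
  qed
  have D: "?A \<inter> ?B = {}" by auto
  have iA: "inj int" by (simp add: inj_on_def)
  have iB: "inj (\<lambda>k. - int (Suc k))" by (auto simp: inj_on_def)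
  have sA: "(\<lambda>x. norm (f x)) summable_on ?A" and sB: "(\<lambda>x. norm (f x)) summable_on ?B"
    by (rule summable_on_subset_banach[OF assms], simp)+
  have sA': "(\<lambda>k. norm (f (int k))) summable_on UNIV"
    using sA summable_on_reindex[OF iA, of "\<lambda>x. norm (f x)"] by (simp add: o_def)
  have sB': "(\<lambda>k. norm (f (- int (Suc k)))) summable_on UNIV"
    using sB summable_on_reindex[OF iB, of "\<lambda>x. norm (f x)"] by (simp add: o_def)
  show 1: "summable (\<lambda>k. norm (f (int k)))"
    using sA' by (rule summable_on_imp_summable)
  show 2: "summable (\<lambda>k. norm (f (- int (Suc k))))"
    using sB' by (rule summable_on_imp_summable)
  have "infsum f UNIV = infsum f (?A \<union> ?B)" by (rule arg_cong[OF U])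
  also have "\<dots> = infsum f ?A + infsum f ?B"
    by (rule infsum_Un_disjoint[OF abs_summable_summable[OF sA] abs_summable_summable[OF sB] D])
  also have "infsum f ?A = infsum (\<lambda>k. f (int k)) UNIV"
    using infsum_reindex[OF iA, of f] by (simp add: o_def)
  also have "\<dots> = (\<Sum>k. f (int k))"
    using has_sum_imp_sums[OF has_sum_infsum[OF abs_summable_summable[OF sA']]] by (simp add: sums_iff)
  also have "infsum f ?B = infsum (\<lambda>k. f (- int (Suc k))) UNIV"
    using infsum_reindex[OF iB, of f] by (simp add: o_def)
  also have "\<dots> = (\<Sum>k. f (- int (Suc k)))"
    using has_sum_imp_sums[OF has_sum_infsum[OF abs_summable_summable[OF sB']]] by (simp add: sums_iff)
  finally show "infsum f UNIV = (\<Sum>k. f (int k)) + (\<Sum>k. f (- int (Suc k)))" .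
qed

lemma abs_summable_on_intI:
  fixes f :: "int \<Rightarrow> 'a :: banach"
  assumes "summable (\<lambda>k. norm (f (int k)))" "summable (\<lambda>k. norm (f (- int k)))"
  shows "(\<lambda>x. norm (f x)) summable_on UNIV"
proof -
  have A: "(\<lambda>k. norm (f (int k))) summable_on UNIV"
    using assms(1) by (simp add: norm_summable_imp_summable_on)
  have B: "(\<lambda>k. norm (f (- int k))) summable_on UNIV"
    using assms(2) by (simp add: norm_summable_imp_summable_on)
  have "(\<lambda>x. norm (f x)) summable_on range int"
    using A summable_on_reindex[of int UNIV "\<lambda>x. norm (f x)"] by (simp add: o_def)
  moreover have "inj (\<lambda>k. - int k)" by (auto simp: inj_on_def)
  hence "(\<lambda>x. norm (f x)) summable_on range (\<lambda>k. - int k)"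
    using B summable_on_reindex[of "\<lambda>k. - int k" UNIV "\<lambda>x. norm (f x)"] by (simp add: o_def)
  ultimately have "(\<lambda>x. norm (f x)) summable_on (range int \<union> range (\<lambda>k. - int k))"
    by (rule summable_on_union)
  moreover have "range int \<union> range (\<lambda>k. - int k) = UNIV"
  proof -
    have "x \<in> range int \<union> range (\<lambda>k. - int k)" for x :: int
      by (cases x rule: int_cases2) auto
    thus ?thesis by blast
  qed
  ultimately show ?thesis by simp
qed

text \<open>The half over y >= 0 telescopes to - g 0 and the half over y < 0 to g 0, so the two
  boundary values cancel.\<close>

lemma infsum_int_telescope:
  fixes f g :: "int \<Rightarrow> 'a :: banach"
  assumes f: "(\<lambda>x. norm (f x)) summable_on UNIV" and g: "\<And>y. g (y + 1) - g y = f y"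
    and lim: "(\<lambda>k. g (int k)) \<longlonglongrightarrow> 0" "(\<lambda>k. g (- int k)) \<longlonglongrightarrow> 0"
  shows "infsum f UNIV = 0"
proof -
  have "(\<lambda>k. g (int (Suc k)) - g (int k)) sums (0 - g (int 0))"
    by (rule telescope_sums[OF lim(1)])
  hence 1: "(\<Sum>k. f (int k)) = - g 0"
    using g[symmetric] by (simp add: sums_iff add.commute)
  have "(\<lambda>k. g (- int k) - g (- int (Suc k))) sums (g (- int 0) - 0)"
    by (rule telescope_sums'[OF lim(2)])
  moreover have "g (- int k) - g (- int (Suc k)) = f (- int (Suc k))" for k
    using g[of "- int (Suc k)"] by simp
  ultimately have "(\<Sum>k. f (- int (Suc k))) = g 0"
    by (simp only: sums_iff) simp
  with 1 infsum_int_split(1)[OF f] show ?thesis by simp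
qed

section \<open>One-variable bilateral sums\<close>

text \<open>With b_j = 1/a_j and u = z q^y, the product over j of (a_j z)_y / (q z/a_j)_y * a_j^(-y)
  is, up to a factor free of y, z^((2n+2)y) q^((n+1)y(y-1)) times these infinite products. The
  missing q^((n+1)y) consists of the q^y in the argument of the series and the q^(ny) in the power
  u^n split off \<open>W\<close>. It completes the exponent to y*y, which makes the weight symmetric
  under u -> 1/u.\<close>

definition omega :: "complex \<Rightarrow> nat \<Rightarrow> (nat \<Rightarrow> complex) \<Rightarrow> complex \<Rightarrow> int \<Rightarrow> complex" where
  "omega q n b z y = (z powi (2 * y) * q powi (y * y)) ^ (n + 1)
     * (\<Prod>j=1..2*n+2. qpoch_inf q (q * b j * (z * q powi y)) * qpoch_inf q (q * b j / (z * q powi y)))"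

lemma omega_reflect:
  assumes "q \<noteq> 0" "z \<noteq> 0"
  shows "omega q n b (1 / z) (- y) = omega q n b z y"
proof -
  have 1: "1 / z * q powi (- y) = 1 / (z * q powi y)"
    by (simp add: power_int_minus field_simps)
  have 2: "(1 / z) powi (2 * - y) = z powi (2 * y)"
    by (simp add: power_int_minus power_int_divide_distrib)
  show ?thesis unfolding omega_def 1 2 by (simp add: mult.commute)
qed

text \<open>Replacing z by q z moves u by one step, and the infinite products depend on u alone;
  only the Gaussian factor leaves a quotient.\<close>

lemma omega_shift:
  assumes "q \<noteq> 0" "z \<noteq> 0"
  shows "omega q n b (q * z) y = omega q n b z (y + 1) / (z\<^sup>2 * q) ^ (n + 1)"
proof -
  have 1: "q * z * q powi y = z * q powi (y + 1)"
    using assms by (simp add: power_int_add)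
  have "z powi (2 * (y + 1)) * q powi ((y + 1) * (y + 1)) = z powi (2 * y) * z\<^sup>2 * (q powi (y * y) * q powi (2 * y) * q)"
    using assms by (simp add: power_int_add algebra_simps power2_eq_square)
  hence 2: "(q * z) powi (2 * y) * q powi (y * y) = z powi (2 * (y + 1)) * q powi ((y + 1) * (y + 1)) / (z\<^sup>2 * q)"
    using assms by (simp add: power_int_mult_distrib)
  show ?thesis unfolding omega_def 1 2 by (simp add: power_divide)
qed

text \<open>A Pearson-type recurrence: passing from u to q u strips the factor 1 - q b_j u from one
  infinite product and adds 1 - b_j/u to the other. It is kept multiplied out because 1 - q b_j u
  may vanish.\<close>

lemma omega_step:
  assumes q: "q \<noteq> 0" "norm q < 1" and z: "z \<noteq> 0"
  defines "u \<equiv> (\<lambda>y. z * q powi y)"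
  shows "omega q n b z (y + 1) * (\<Prod>j=1..2*n+2. 1 - q * b j * u y)
       = omega q n b z y * (q ^ (n + 1) * (\<Prod>j=1..2*n+2. u y - b j))"
proof -
  have u0: "u y \<noteq> 0" using q z by (simp add: u_def)
  have uS: "u (y + 1) = q * u y" using q by (simp add: u_def power_int_add)
  have 1: "qpoch_inf q (q * b j * u (y + 1)) * qpoch_inf q (q * b j / u (y + 1)) * (1 - q * b j * u y)
     = qpoch_inf q (q * b j * u y) * qpoch_inf q (q * b j / u y) * (1 - b j / u y)" for j
  proof -
    have "qpoch_inf q (q * b j * u y) = (1 - q * b j * u y) * qpoch_inf q (q * b j * u (y + 1))"
      by (subst qpoch_inf_rec[OF q(2)]) (simp add: uS mult_ac)
    moreover have "qpoch_inf q (b j / u y) = (1 - b j / u y) * qpoch_inf q (q * b j / u y)"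
      by (subst qpoch_inf_rec[OF q(2)]) simp
    moreover have "q * b j / u (y + 1) = b j / u y" using q by (simp add: uS)
    ultimately show ?thesis by simp
  qed
  have G: "z powi (2 * (y + 1)) * q powi ((y + 1) * (y + 1)) = z powi (2 * y) * q powi (y * y) * ((u y)\<^sup>2 * q)"
  proof -
    have "2 * (y + 1) = 2 * y + 2" "(y + 1) * (y + 1) = y * y + (y + y) + 1"
      by (simp_all add: algebra_simps)
    moreover have "q powi (2 * y) = q powi y * q powi y"
      using power_int_add[OF disjI1[OF q(1)], of y y] by (simp only: mult_2)
    ultimately show ?thesis using q z by (simp add: power_int_add u_def power2_eq_square)
  qed
  have "omega q n b z (y + 1) * (\<Prod>j=1..2*n+2. 1 - q * b j * u y)
     = (z powi (2 * y) * q powi (y * y)) ^ (n + 1) * ((u y)\<^sup>2 * q) ^ (n + 1)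
       * (\<Prod>j=1..2*n+2. qpoch_inf q (q * b j * u (y + 1)) * qpoch_inf q (q * b j / u (y + 1)) * (1 - q * b j * u y))"
    unfolding omega_def G by (simp only: power_mult_distrib prod.distrib mult_ac u_def)
  also have "\<dots> = (z powi (2 * y) * q powi (y * y)) ^ (n + 1) * ((u y)\<^sup>2 * q) ^ (n + 1)
       * ((\<Prod>j=1..2*n+2. qpoch_inf q (q * b j * u y) * qpoch_inf q (q * b j / u y)) * (\<Prod>j=1..2*n+2. (1 - b j / u y)))"
    unfolding 1 prod.distrib ..
  also have "\<dots> = omega q n b z y * (((u y)\<^sup>2 * q) ^ (n + 1) * (\<Prod>j=1..2*n+2. (1 - b j / u y)))"
    unfolding omega_def u_def by (simp only: mult_ac)
  also have "((u y)\<^sup>2 * q) ^ (n + 1) = q ^ (n + 1) * (\<Prod>j=1..2*n+2. u y)"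
    by (simp add: power_mult_distrib flip: power_mult) (simp add: power2_eq_square)
  also have "q ^ (n + 1) * (\<Prod>j=1..2*n+2. u y) * (\<Prod>j=1..2*n+2. (1 - b j / u y))
     = q ^ (n + 1) * (\<Prod>j=1..2*n+2. u y * (1 - b j / u y))"
    unfolding prod.distrib by (simp only: mult.assoc)
  also have "(\<Prod>j=1..2*n+2. u y * (1 - b j / u y)) = (\<Prod>j=1..2*n+2. u y - b j)"
    using u0 by (intro prod.cong refl) (simp add: field_simps)
  finally show ?thesis .
qed

text \<open>Ratio test with \<open>omega_step\<close>: as u tends to 0 the quotient of consecutive
  weights tends to q^(n+1) times the product of the b_j, and dividing by |u|^d contributes |q|^(-d).
  Hypothesis \<open>B\<close> says that this limit is below 1 in norm.\<close>

lemma summable_omega_nat: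
  fixes q z :: complex
  assumes q: "q \<noteq> 0" "norm q < 1" and z: "z \<noteq> 0"
    and B: "norm (\<Prod>j=1..2*n+2. b j) * norm q ^ (n + 1) < norm q ^ d"
  shows "summable (\<lambda>k. norm (omega q n b z (int k)) / norm (z * q ^ k) ^ d)"
proof -
  define u where "u k = z * q ^ k" for k
  define f where "f k = norm (omega q n b z (int k)) / norm (u k) ^ d" for k
  define P where "P k = (\<Prod>j=1..2*n+2. 1 - q * b j * u k)" for k
  define R where "R k = norm (q ^ (n + 1) * (\<Prod>j=1..2*n+2. u k - b j)) / norm (P k) / norm q ^ d" for k
  have u0: "u \<longlonglongrightarrow> 0"
  proof -
    have "u \<longlonglongrightarrow> z * 0" unfolding u_def
      by (intro tendsto_intros LIMSEQ_power_zero q)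
    thus ?thesis by simp
  qed
  have P1: "P \<longlonglongrightarrow> (\<Prod>j=1..2*n+2. 1 - q * b j * 0)"
    unfolding P_def by (intro tendsto_intros u0)
  have Pnz: "eventually (\<lambda>k. P k \<noteq> 0) sequentially"
    using P1 by (intro tendsto_imp_eventually_ne[of _ "1"]) auto
  have "R \<longlonglongrightarrow> norm (q ^ (n + 1) * (\<Prod>j=1..2*n+2. 0 - b j)) / norm (\<Prod>j=1..2*n+2. 1 - q * b j * 0) / norm q ^ d"
    unfolding R_def by (intro tendsto_intros u0 P1) (use q in auto)
  also have "norm (q ^ (n + 1) * (\<Prod>j=1..2*n+2. 0 - b j)) / norm (\<Prod>j=1..2*n+2. 1 - q * b j * 0) / norm q ^ d
     = norm (\<Prod>j=1..2*n+2. b j) * norm q ^ (n + 1) / norm q ^ d"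
    by (simp add: norm_mult norm_power prod_norm[symmetric] del: prod.cl_ivl_Suc power_Suc)
  finally have R: "R \<longlonglongrightarrow> norm (\<Prod>j=1..2*n+2. b j) * norm q ^ (n + 1) / norm q ^ d" (is "_ \<longlonglongrightarrow> ?r") .
  have r: "?r < 1" using B q by (simp add: divide_simps)
  then obtain c where c: "?r < c" "c < 1" using dense by blast
  have ev: "eventually (\<lambda>k. R k < c \<and> P k \<noteq> 0) sequentially"
    using order_tendstoD(2)[OF R c(1)] Pnz by eventually_elim auto
  then obtain N where N: "\<And>k. k \<ge> N \<Longrightarrow> R k < c \<and> P k \<noteq> 0"
    unfolding eventually_sequentially by blast
  have "summable f"
  proof (rule summable_ratio_test[OF c(2)])
    fix k assume "N \<le> k"
    with N have Rk: "R k < c" and Pk: "P k \<noteq> 0" by auto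
    have "omega q n b z (int k + 1) * P k = omega q n b z (int k) * (q ^ (n + 1) * (\<Prod>j=1..2*n+2. u k - b j))"
      using omega_step[OF q z, of n b "int k"] by (simp only: u_def P_def power_int_of_nat)
    hence "omega q n b z (int (Suc k)) = omega q n b z (int k) * (q ^ (n + 1) * (\<Prod>j=1..2*n+2. u k - b j)) / P k"
      using Pk by (simp add: eq_divide_eq add.commute del: prod.cl_ivl_Suc power_Suc)
    hence "f (Suc k) = f k * R k"
      using q by (simp only: f_def R_def u_def norm_divide norm_mult norm_power power_Suc)
         (simp add: power_mult_distrib del: prod.cl_ivl_Suc)
    also have "\<dots> \<le> f k * c" using Rk by (intro mult_left_mono) (auto simp: f_def)
    finally show "norm (f (Suc k)) \<le> c * norm (f k)" by (simp add: f_def mult.commute)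
  qed
  thus ?thesis unfolding f_def u_def .
qed

lemma abs_summable_omega_powi:
  fixes q z :: complex
  assumes q: "q \<noteq> 0" "norm q < 1" and z: "z \<noteq> 0"
    and B: "norm (\<Prod>j=1..2*n+2. b j) * norm q ^ (n + 1) < norm q ^ d"
    and e: "- int d \<le> e" "e \<le> int d"
  shows "(\<lambda>y. norm (omega q n b z y * (z * q powi y) powi e)) summable_on UNIV"
proof -
  have *: "summable (\<lambda>k. norm (omega q n b w (int k) * (w * q ^ k) powi e'))"
    if w: "w \<noteq> 0" and e': "- int d \<le> e'" for w e'
  proof (rule summable_comparison_test[OF _ summable_mult[OF summable_omega_nat[OF q w B], of "norm w ^ nat (e' + int d)"]],
      intro exI[of _ 0] allI impI)
    fix k :: nat
    define N where "N = nat (e' + int d)"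
    have N: "e' = int N - int d" using e' by (simp add: N_def)
    have nz: "norm (w * q ^ k) > 0" using w q by simp
    have "norm ((w * q ^ k) powi e') = norm (w * q ^ k) powi (int N - int d)"
      unfolding N by (simp add: norm_power_int)
    also have "\<dots> = norm (w * q ^ k) ^ N / norm (w * q ^ k) ^ d"
      using nz by (subst power_int_diff) auto
    also have "\<dots> \<le> norm w ^ N / norm (w * q ^ k) ^ d"
      using q nz by (intro divide_right_mono power_mono)
        (auto simp: norm_mult norm_power intro!: mult_left_le power_le_one)
    finally have "norm ((w * q ^ k) powi e') \<le> norm w ^ N / norm (w * q ^ k) ^ d" .
    hence "norm (omega q n b w (int k)) * norm ((w * q ^ k) powi e') \<le>
           norm (omega q n b w (int k)) * (norm w ^ N / norm (w * q ^ k) ^ d)"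
      by (rule mult_left_mono) simp
    thus "norm (norm (omega q n b w (int k) * (w * q ^ k) powi e'))
        \<le> norm w ^ nat (e' + int d) * (norm (omega q n b w (int k)) / norm (w * q ^ k) ^ d)"
      by (simp add: norm_mult mult_ac N_def)
  qed
  show ?thesis
  proof (rule abs_summable_on_intI)
    show "summable (\<lambda>k. norm (omega q n b z (int k) * (z * q powi int k) powi e))"
      using *[OF z e(1)] by simp
    \<comment> \<open>The half y < 0 is the half y > 0 at 1/z with exponent -e, hence the two-sided
      bound on \<open>e\<close>.\<close>
    have "omega q n b z (- int k) * (z * q powi - int k) powi e
        = omega q n b (1 / z) (int k) * (1 / z * q ^ k) powi (- e)" for k
    proof -
      have "omega q n b z (- int k) = omega q n b (1 / z) (int k)"
        using omega_reflect[OF q(1), of "1 / z" n b "int k"] z by simp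
      moreover have "z * q powi - int k = inverse (1 / z * q ^ k)"
        using q z by (simp add: power_int_minus field_simps)
      ultimately show ?thesis by (simp only: power_int_inverse power_int_minus)
    qed
    thus "summable (\<lambda>k. norm (omega q n b z (- int k) * (z * q powi - int k) powi e))"
      using *[of "1 / z" "- e"] z e by simp
  qed
qed

text \<open>Each factor u + 1/u splits an exponent e into e + 1 and e - 1, so \<open>l\<close>
  factors use up \<open>l\<close> of the admissible range.\<close>

lemma summable_omega:
  fixes q z :: complex
  assumes q: "q \<noteq> 0" "norm q < 1" and z: "z \<noteq> 0"
    and B: "norm (\<Prod>j=1..2*n+2. b j) * norm q ^ (n + 1) < norm q ^ d"
    and e: "\<bar>e\<bar> + int l \<le> int d"
  shows "(\<lambda>y. omega q n b z y * (z * q powi y) powi e * (z * q powi y + 1 / (z * q powi y)) ^ l) summable_on UNIV"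
  using e
proof (induction l arbitrary: e)
  case 0
  show ?case
    using abs_summable_omega_powi[OF q z B, of e] 0
    by (simp add: summable_on_iff_abs_summable_on_complex)
next
  case (Suc l)
  have "(\<lambda>y. omega q n b z y * (z * q powi y) powi (e + 1) * (z * q powi y + 1 / (z * q powi y)) ^ l
      + omega q n b z y * (z * q powi y) powi (e - 1) * (z * q powi y + 1 / (z * q powi y)) ^ l) summable_on UNIV"
    by (intro summable_on_add Suc.IH) (use Suc.prems in auto)
  moreover have "w powi (e + 1) * x ^ l + w powi (e - 1) * x ^ l = w powi e * ((w + 1 / w) * x ^ l)"
    if "w \<noteq> 0" for w x :: complex
    using that by (simp add: power_int_add power_int_diff field_simps)
  ultimately show ?case using q z by (simp add: mult.assoc flip: distrib_left)
qed

lemma summable_on_sum: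
  fixes f :: "'i \<Rightarrow> 'a \<Rightarrow> 'b :: real_normed_vector"
  assumes "\<And>i. i \<in> I \<Longrightarrow> f i summable_on A"
  shows "(\<lambda>x. \<Sum>i\<in>I. f i x) summable_on A"
  using assms by (induction I rule: infinite_finite_induct) (simp_all add: summable_on_add)

text \<open>The factor 1/u - u costs one more power of u, whence the strict bound on the
  degree.\<close>

lemma summable_omega_poly:
  fixes q z :: complex
  assumes q: "q \<noteq> 0" "norm q < 1" and z: "z \<noteq> 0"
    and B: "norm (\<Prod>j=1..2*n+2. b j) * norm q ^ (n + 1) < norm q ^ d"
    and h: "degree h < d"
  shows "(\<lambda>y. omega q n b z y * (1 / (z * q powi y) - z * q powi y)
           * poly h (z * q powi y + 1 / (z * q powi y))) summable_on UNIV"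
proof -
  have "(\<lambda>y. \<Sum>l\<le>degree h. coeff h l *
      (omega q n b z y * (z * q powi y) powi (- 1) * (z * q powi y + 1 / (z * q powi y)) ^ l
     + - (omega q n b z y * (z * q powi y) powi 1 * (z * q powi y + 1 / (z * q powi y)) ^ l))) summable_on UNIV"
    by (intro summable_on_sum summable_on_cmult_right summable_on_add
        summable_on_uminus[THEN iffD2] summable_omega[OF q z B]) (use h in auto)
  moreover have "(\<Sum>l\<le>degree h. coeff h l *
      (omega q n b z y * w powi (- 1) * x ^ l + - (omega q n b z y * w powi 1 * x ^ l)))
     = omega q n b z y * (1 / w - w) * poly h x" for y w x
    unfolding poly_altdef sum_distrib_left
    by (intro sum.cong refl) (simp add: power_int_minus field_simps)
  ultimately show ?thesis by (simp only:)
qed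

definition wsum :: "complex \<Rightarrow> nat \<Rightarrow> (nat \<Rightarrow> complex) \<Rightarrow> complex \<Rightarrow> complex poly \<Rightarrow> complex" where
  "wsum q n b z h = (\<Sum>\<^sub>\<infinity>y. omega q n b z y * (1 / (z * q powi y) - z * q powi y)
           * poly h (z * q powi y + 1 / (z * q powi y)))"

text \<open>The weight and u + 1/u are symmetric under u -> 1/u, while 1/u - u changes sign.\<close>

lemma wsum_reflect:
  assumes "q \<noteq> 0" "z \<noteq> 0"
  shows "wsum q n b (1 / z) h = - wsum q n b z h"
proof -
  have bij: "bij_betw uminus (UNIV :: int set) UNIV" by (rule bij_uminus)
  have "1 / z * q powi - y = 1 / (z * q powi y)" for y
    by (simp add: power_int_minus field_simps)
  hence "wsum q n b (1 / z) h = (\<Sum>\<^sub>\<infinity>y. - (omega q n b z y * (1 / (z * q powi y) - z * q powi y)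
           * poly h (z * q powi y + 1 / (z * q powi y))))"
    unfolding wsum_def using assms
    by (subst infsum_reindex_bij_betw[OF bij, symmetric])
       (simp add: omega_reflect add.commute algebra_simps del: times_divide_eq_left)
  thus ?thesis by (simp add: wsum_def infsum_uminus)
qed

lemma wsum_shift:
  assumes "q \<noteq> 0" "z \<noteq> 0"
  shows "wsum q n b (q * z) h = wsum q n b z h / (z\<^sup>2 * q) ^ (n + 1)"
proof -
  have bij: "bij_betw (\<lambda>y. y + 1) (UNIV :: int set) UNIV"
    by (rule bij_betwI[of _ _ _ "\<lambda>y. y - 1"]) auto
  have *: "q * z * q powi y = z * q powi (y + 1)" for y
    using assms by (simp add: power_int_add)
  have "wsum q n b (q * z) h = (\<Sum>\<^sub>\<infinity>y. (omega q n b z (y + 1) * (1 / (z * q powi (y + 1)) - z * q powi (y + 1))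
           * poly h (z * q powi (y + 1) + 1 / (z * q powi (y + 1)))) * (1 / (z\<^sup>2 * q) ^ (n + 1)))"
    unfolding wsum_def * by (simp add: omega_shift[OF assms])
  also have "\<dots> = (\<Sum>\<^sub>\<infinity>y. (omega q n b z (y + 1) * (1 / (z * q powi (y + 1)) - z * q powi (y + 1))
           * poly h (z * q powi (y + 1) + 1 / (z * q powi (y + 1))))) * (1 / (z\<^sup>2 * q) ^ (n + 1))"
    by (rule infsum_cmult_left')
  also have "(\<Sum>\<^sub>\<infinity>y. (omega q n b z (y + 1) * (1 / (z * q powi (y + 1)) - z * q powi (y + 1))
           * poly h (z * q powi (y + 1) + 1 / (z * q powi (y + 1))))) = wsum q n b z h"
    unfolding wsum_def by (rule infsum_reindex_bij_betw[OF bij])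
  finally show ?thesis by simp
qed

text \<open>The order of the quantifiers is the point: \<open>c\<close> does not depend on
  \<open>h\<close>, so rows of values of \<open>wsum\<close> at z and at q^r z are
  proportional.\<close>

lemma wsum_shift_power:
  assumes "q \<noteq> 0" "z \<noteq> 0"
  shows "\<exists>c. \<forall>h. wsum q n b (q ^ r * z) h = c * wsum q n b z h"
proof (induction r)
  case 0
  show ?case by (rule exI[of _ 1]) simp
next
  case (Suc r)
  then obtain c where c: "\<And>h. wsum q n b (q ^ r * z) h = c * wsum q n b z h" by blast
  show ?case
    using assms c wsum_shift[of q "q ^ r * z" n b]
    by (intro exI[of _ "c / ((q ^ r * z)\<^sup>2 * q) ^ (n + 1)"]) (simp add: mult.assoc)
qed

section \<open>Antisymmetric Laurent polynomials and polynomials in u + 1/u\<close>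

text \<open>Chebyshev polynomials of the second kind, U_(k-1)(x/2), with the index shifted so that
  \<open>cheb k\<close> is the quotient of u^k - u^(-k) by u - 1/u at x = u + 1/u.\<close>

fun cheb :: "nat \<Rightarrow> complex poly" where
  "cheb 0 = 0"
| "cheb (Suc 0) = 1"
| "cheb (Suc (Suc k)) = [:0, 1:] * cheb (Suc k) - cheb k"

lemma poly_cheb:
  assumes "u \<noteq> 0"
  shows "poly (cheb k) (u + 1 / u) * (u - 1 / u) = u ^ k - 1 / u ^ k"
proof (induction k rule: cheb.induct)
  case (3 k)
  have "poly (cheb (Suc (Suc k))) (u + 1 / u) * (u - 1 / u)
     = (u + 1 / u) * (u ^ Suc k - 1 / u ^ Suc k) - (u ^ k - 1 / u ^ k)"
  proof -
    have "poly (cheb (Suc (Suc k))) x * v = x * (poly (cheb (Suc k)) x * v) - poly (cheb k) x * v" for x v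
      by (simp add: left_diff_distrib)
    thus ?thesis by (simp only: 3)
  qed
  also have "\<dots> = u ^ Suc (Suc k) - 1 / u ^ Suc (Suc k)"
    using assms by (simp add: field_simps)
  finally show ?case .
qed auto

lemma degree_cheb: "degree (cheb (Suc k)) \<le> k" "degree (cheb k) \<le> k - 1"
proof -
  have *: "degree (cheb k) \<le> k - 1" for k
  proof (induction k rule: cheb.induct)
    case (3 k)
    have "degree ([:0, 1:] * cheb (Suc k)) \<le> 1 + degree (cheb (Suc k))"
      by (rule order_trans[OF degree_mult_le]) simp
    with 3 have "degree ([:0, 1:] * cheb (Suc k)) \<le> Suc k" by simp
    moreover have "degree (cheb k) \<le> Suc k" using 3 by linarith
    ultimately show ?case by (simp add: degree_diff_le del: mult_pCons_left)
  qed auto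
  show "degree (cheb (Suc k)) \<le> k" "degree (cheb k) \<le> k - 1"
    using *[of "Suc k"] *[of k] by auto
qed

lemma coeff_cheb: "coeff (cheb (Suc k)) k = 1"
proof (induction k rule: less_induct)
  case (less k)
  show ?case
  proof (cases k)
    case (Suc k')
    have "coeff (cheb k') (Suc k') = 0"
      using degree_cheb(2)[of k'] by (intro coeff_eq_0) linarith
    thus ?thesis using less[of k'] by (simp add: Suc)
  qed simp
qed

lemma poly_sum_atMost:
  fixes p :: "'a :: comm_semiring_1 poly"
  assumes "degree p \<le> m"
  shows "poly p x = (\<Sum>i\<le>m. coeff p i * x ^ i)"
  by (subst poly_as_sum_of_monoms'[OF assms, symmetric]) (simp add: poly_sum poly_monom)

text \<open>The monomial u^i contributes u^(i-d-1) - u^(d+1-i), which is 1/u - u times plus or minus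
  a Chebyshev polynomial \<open>t i\<close>. Only the extreme indices i = 0 and i = 2(d+1) reach
  degree \<open>d\<close>, which gives the coefficient formula.\<close>

lemma antisymmetric_quotient:
  fixes e :: "complex poly"
  assumes e: "degree e \<le> 2 * Suc d"
  obtains h where "degree h \<le> d" "coeff h d = coeff e 0 - coeff e (2 * Suc d)"
    "\<And>u. u \<noteq> 0 \<Longrightarrow> poly h (u + 1 / u) * (1 / u - u) = poly e u / u ^ Suc d - u ^ Suc d * poly e (1 / u)"
proof -
  let ?D = "Suc d"
  define t where "t i = (if i \<ge> ?D then - cheb (i - ?D) else cheb (?D - i))" for i
  define h where "h = (\<Sum>i\<le>2 * ?D. Polynomial.smult (coeff e i) (t i))"
  have dt: "degree (t i) \<le> d" if "i \<le> 2 * ?D" for i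
  proof (cases "i \<ge> ?D")
    case True
    thus ?thesis using degree_cheb(2)[of "i - ?D"] that by (simp add: t_def)
  next
    case False
    thus ?thesis using degree_cheb(2)[of "?D - i"] that by (simp add: t_def)
  qed
  have ct: "coeff (t i) d = (if i = 0 then 1 else if i = 2 * ?D then - 1 else 0)" if i: "i \<le> 2 * ?D" for i
  proof -
    have *: "coeff (cheb k) d = 0" if "k < ?D" for k
      using degree_cheb(2)[of k] that by (cases k) (auto intro!: coeff_eq_0)
    consider "i = 0" | "i = 2 * ?D" | "0 < i" "i < ?D" | "?D \<le> i" "i < 2 * ?D" using i by linarith
    thus ?thesis
    proof cases
      case 2
      hence "i - ?D = ?D" "i \<ge> ?D" by auto
      with 2 show ?thesis by (simp add: t_def coeff_cheb del: cheb.simps)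
    qed (auto simp: t_def coeff_cheb * simp del: cheb.simps)
  qed
  have "degree h \<le> d"
    unfolding h_def by (rule degree_sum_le) (auto intro: order_trans[OF degree_smult_le] dt)
  moreover have "coeff h d = coeff e 0 - coeff e (2 * ?D)"
  proof -
    have "coeff h d = (\<Sum>i\<le>2 * ?D. coeff e i * (if i = 0 then 1 else if i = 2 * ?D then - 1 else 0))"
      unfolding h_def by (simp add: coeff_sum ct)
    also have "\<dots> = (\<Sum>i\<le>2 * ?D. (if i = 0 then coeff e i else 0) - (if i = 2 * ?D then coeff e i else 0))"
      by (intro sum.cong) auto
    also have "\<dots> = coeff e 0 - coeff e (2 * ?D)"
      unfolding sum_subtractf by (subst (1 2) sum.delta) auto
    finally show ?thesis .
  qed
  moreover have "poly h (u + 1 / u) * (1 / u - u) = poly e u / u ^ ?D - u ^ ?D * poly e (1 / u)"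
    if u: "u \<noteq> 0" for u
  proof -
    have pt: "poly (t i) (u + 1 / u) * (1 / u - u) = u ^ i / u ^ ?D - u ^ ?D * (1 / u) ^ i" if "i \<le> 2 * ?D" for i
    proof (cases "i \<ge> ?D")
      case True
      have "poly (t i) (u + 1 / u) * (1 / u - u) = poly (cheb (i - ?D)) (u + 1 / u) * (u - 1 / u)"
        using True by (simp add: t_def algebra_simps)
      also have "\<dots> = u ^ (i - ?D) - 1 / u ^ (i - ?D)" by (rule poly_cheb[OF u])
      also have "\<dots> = u ^ i / u ^ ?D - u ^ ?D / u ^ i"
        using u True by (simp add: power_diff del: power_Suc)
      finally show ?thesis by (simp add: power_one_over field_simps)
    next
      case False
      have "poly (t i) (u + 1 / u) * (1 / u - u) = - (poly (cheb (?D - i)) (u + 1 / u) * (u - 1 / u))"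
        using False by (simp add: t_def algebra_simps)
      also have "\<dots> = - (u ^ (?D - i) - 1 / u ^ (?D - i))" by (simp only: poly_cheb[OF u])
      also have "\<dots> = u ^ i / u ^ ?D - u ^ ?D / u ^ i"
        using u False by (simp add: power_diff del: power_Suc)
      finally show ?thesis by (simp add: power_one_over field_simps)
    qed
    have "poly h (u + 1 / u) * (1 / u - u) = (\<Sum>i\<le>2 * ?D. coeff e i * (poly (t i) (u + 1 / u) * (1 / u - u)))"
      unfolding h_def by (simp add: poly_sum sum_distrib_right mult.assoc del: sum.atMost_Suc)
    also have "\<dots> = (\<Sum>i\<le>2 * ?D. coeff e i * u ^ i / u ^ ?D - u ^ ?D * (coeff e i * (1 / u) ^ i))"
      by (intro sum.cong refl) (subst pt, auto simp: algebra_simps)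
    also have "\<dots> = poly e u / u ^ ?D - u ^ ?D * poly e (1 / u)"
      unfolding sum_subtractf sum_distrib_left[symmetric] sum_divide_distrib[symmetric]
      unfolding poly_sum_atMost[OF e] ..
    finally show ?thesis .
  qed
  ultimately show ?thesis using that by blast
qed

section \<open>Telescoping polynomials\<close>

text \<open>\<open>antisymmetric_quotient\<close> is applied to e(u) = s^(-i) * prod (u - b_j) * (1
  + q u^2)^i. Dividing e by u^(n+1+i) yields the first product on the right, and u -> 1/u yields the
  second. The lowest coefficient of e is (prod b_j)/s^i and the highest is q^i/s^i.\<close>

lemma lowering_poly:
  fixes q s :: complex
  assumes s: "s \<noteq> 0" "s\<^sup>2 = q"
  shows "\<exists>h. degree h \<le> n + i \<and> coeff h (n + i) = ((\<Prod>j=1..2*n+2. b j) - q ^ i) / s ^ i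
    \<and> (\<forall>u. u \<noteq> 0 \<longrightarrow> poly h (u + 1 / u) * (1 / u - u)
        = u ^ (n + 1) * (\<Prod>j=1..2*n+2. 1 - b j / u) * (u * s + 1 / (u * s)) ^ i
        - 1 / u ^ (n + 1) * (\<Prod>j=1..2*n+2. 1 - b j * u) * (u / s + s / u) ^ i)"
proof -
  define e where "e = Polynomial.smult (1 / s ^ i) ((\<Prod>j=1..2*n+2. [:- b j, 1:]) * [:1, 0, q:] ^ i)"
  have q0: "q \<noteq> 0" using s by auto
  have dq: "degree [:1, 0, q:] = 2" using q0 by simp
  have dP: "degree (\<Prod>j=1..2*n+2. [:- b j, 1:]) = 2 * n + 2"
    by (subst degree_prod_eq_sum_degree) (auto simp del: prod.cl_ivl_Suc)
  have lP: "lead_coeff (\<Prod>j=1..2*n+2. [:- b j, 1:]) = 1"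
    unfolding lead_coeff_prod by simp
  have Pnz: "(\<Prod>j=1..2*n+2. [:- b j, 1:]) \<noteq> 0" using lP by auto
  have dQ: "degree ([:1, 0, q:] ^ i) = 2 * i"
    by (simp add: degree_power_eq dq q0)
  have deg: "degree e = 2 * Suc (n + i)"
    unfolding e_def using Pnz q0 s dP dQ by (subst degree_smult_eq, subst degree_mult_eq) (auto simp del: prod.cl_ivl_Suc)
  have "lead_coeff e = q ^ i / s ^ i"
    unfolding e_def lead_coeff_smult lead_coeff_mult lP lead_coeff_power using q0 by simp
  hence ctop: "coeff e (2 * Suc (n + i)) = q ^ i / s ^ i" using deg by simp
  have pe: "poly e x = (\<Prod>j=1..2*n+2. x - b j) * (1 + q * x\<^sup>2) ^ i / s ^ i" for x
    unfolding e_def by (simp add: poly_prod poly_power power2_eq_square mult_ac del: prod.cl_ivl_Suc)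
  have cbot: "coeff e 0 = (\<Prod>j=1..2*n+2. b j) / s ^ i"
  proof -
    have "(\<Prod>j=1..2*n+2. 0 - b j) = (\<Prod>j=1..2*n+2. - 1 * b j)" by simp
    also have "\<dots> = (\<Prod>j=1..2*n+2. b j)"
      unfolding prod.distrib by (simp del: prod.cl_ivl_Suc)
    finally show ?thesis by (simp only: pe[of 0] poly_0_coeff_0[symmetric]) simp
  qed
  obtain h where h: "degree h \<le> n + i" "coeff h (n + i) = coeff e 0 - coeff e (2 * Suc (n + i))"
    "\<And>u. u \<noteq> 0 \<Longrightarrow> poly h (u + 1 / u) * (1 / u - u) =
       poly e u / u ^ Suc (n + i) - u ^ Suc (n + i) * poly e (1 / u)"
    using antisymmetric_quotient[of e "n + i"] deg by auto
  have c: "coeff h (n + i) = ((\<Prod>j=1..2*n+2. b j) - q ^ i) / s ^ i"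
    unfolding h(2) ctop cbot by (simp add: diff_divide_distrib)
  have "poly h (u + 1 / u) * (1 / u - u)
        = u ^ (n + 1) * (\<Prod>j=1..2*n+2. 1 - b j / u) * (u * s + 1 / (u * s)) ^ i
        - 1 / u ^ (n + 1) * (\<Prod>j=1..2*n+2. 1 - b j * u) * (u / s + s / u) ^ i" if u: "u \<noteq> 0" for u
  proof -
    have pw: "x ^ Suc (n + i) = x ^ (n + 1) * x ^ i" for x :: complex by (simp add: power_add)
    have "poly e u / u ^ Suc (n + i) = u ^ (n + 1) * (\<Prod>j=1..2*n+2. 1 - b j / u) * (u * s + 1 / (u * s)) ^ i"
    proof -
      have "(\<Prod>j=1..2*n+2. u - b j) = (\<Prod>j=1..2*n+2. u * (1 - b j / u))"
        using u by (intro prod.cong refl) (simp add: field_simps)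
      also have "\<dots> = u ^ (n + 1) * u ^ (n + 1) * (\<Prod>j=1..2*n+2. 1 - b j / u)"
        unfolding prod.distrib by (simp flip: power_add add: mult_2 del: prod.cl_ivl_Suc)
      finally have 1: "(\<Prod>j=1..2*n+2. u - b j) = u ^ (n + 1) * u ^ (n + 1) * (\<Prod>j=1..2*n+2. 1 - b j / u)" .
      have "1 + q * u\<^sup>2 = (u * s + 1 / (u * s)) * (s * u)"
        using u s(1) by (simp add: s(2)[symmetric] field_simps power2_eq_square)
      hence 2: "(1 + q * u\<^sup>2) ^ i = (u * s + 1 / (u * s)) ^ i * (s ^ i * u ^ i)"
        by (simp only: power_mult_distrib)
      show ?thesis unfolding pe 1 2 pw using u s(1) by (simp del: prod.cl_ivl_Suc power_Suc)
    qed
    moreover have "u ^ Suc (n + i) * poly e (1 / u)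
       = 1 / u ^ (n + 1) * (\<Prod>j=1..2*n+2. 1 - b j * u) * (u / s + s / u) ^ i"
    proof -
      have "(\<Prod>j=1..2*n+2. 1 / u - b j) = (\<Prod>j=1..2*n+2. (1 / u) * (1 - b j * u))"
        using u by (intro prod.cong refl) (simp add: field_simps)
      also have "\<dots> = 1 / (u ^ (n + 1) * u ^ (n + 1)) * (\<Prod>j=1..2*n+2. 1 - b j * u)"
        unfolding prod.distrib by (simp flip: power_add add: mult_2 power_one_over del: prod.cl_ivl_Suc)
      finally have 1: "(\<Prod>j=1..2*n+2. 1 / u - b j) = 1 / (u ^ (n + 1) * u ^ (n + 1)) * (\<Prod>j=1..2*n+2. 1 - b j * u)" .
      have "1 + q * (1 / u)\<^sup>2 = (u / s + s / u) * (s / u)"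
        using u s(1) by (simp add: s(2)[symmetric] field_simps power2_eq_square)
      hence 2: "(1 + q * (1 / u)\<^sup>2) ^ i = (u / s + s / u) ^ i * (s ^ i / u ^ i)"
        by (simp only: power_mult_distrib power_divide)
      show ?thesis unfolding pe 1 2 pw using u s(1) by (simp del: prod.cl_ivl_Suc power_Suc)
    qed
    ultimately show ?thesis unfolding h(3)[OF u] by (simp only:)
  qed
  with h(1) c show ?thesis by blast
qed

text \<open>The summand is g(y+1) - g(y), where g(y) is the weight times the second product in
  \<open>h\<close>; by \<open>omega_step\<close>, g(y+1) is the weight at y times the first
  product.\<close>

lemma wsum_lowering_eq_0:
  fixes q s z :: complex
  assumes q: "q \<noteq> 0" "norm q < 1" and s: "s \<noteq> 0" "s\<^sup>2 = q" and z: "z \<noteq> 0"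
    and B: "norm (\<Prod>j=1..2*n+2. b j) < norm q ^ i" and deg: "degree h \<le> n + i"
    and h: "\<And>u. u \<noteq> 0 \<Longrightarrow> poly h (u + 1 / u) * (1 / u - u)
        = u ^ (n + 1) * (\<Prod>j=1..2*n+2. 1 - b j / u) * (u * s + 1 / (u * s)) ^ i
        - 1 / u ^ (n + 1) * (\<Prod>j=1..2*n+2. 1 - b j * u) * (u / s + s / u) ^ i"
  shows "wsum q n b z h = 0"
proof -
  \<comment> \<open>One more than the degree bound of \<open>h\<close>, as summability requires, and
    also the order of growth of g / omega in u and 1/u.\<close>
  define d where "d = n + 1 + i"
  have B': "norm (\<Prod>j=1..2*n+2. b j) * norm q ^ (n + 1) < norm q ^ d"
    unfolding d_def power_add[of _ "n + 1" i] using B q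
    by (subst mult.commute[of "norm q ^ (n + 1)"]) (intro mult_strict_right_mono, auto)
  define u where "u y = z * q powi y" for y :: int
  have u0: "u y \<noteq> 0" for y using q z by (simp add: u_def)
  have uS: "u (y + 1) = q * u y" for y using q by (simp add: u_def power_int_add)
  define w where "w y = omega q n b z y" for y
  define f where "f y = w y * (1 / u y - u y) * poly h (u y + 1 / u y)" for y
  define g where "g y = w y * (1 / u y ^ (n + 1) * (\<Prod>j=1..2*n+2. 1 - b j * u y) * (u y / s + s / u y) ^ i)" for y
  have g1: "g (y + 1) = w y * (u y ^ (n + 1) * (\<Prod>j=1..2*n+2. 1 - b j / u y) * (u y * s + 1 / (u y * s)) ^ i)" for y
  proof -
    have A: "w (y + 1) * (\<Prod>j=1..2*n+2. 1 - b j * u (y + 1)) = w y * (q ^ (n + 1) * (\<Prod>j=1..2*n+2. u y - b j))"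
      using omega_step[OF q z, of n b y] unfolding w_def uS unfolding u_def by (simp only: mult_ac)
    have "(\<Prod>j=1..2*n+2. u y - b j) = (\<Prod>j=1..2*n+2. u y * (1 - b j / u y))"
      using u0 by (intro prod.cong refl) (simp add: field_simps)
    also have "\<dots> = u y ^ (n + 1) * u y ^ (n + 1) * (\<Prod>j=1..2*n+2. 1 - b j / u y)"
      unfolding prod.distrib by (simp flip: power_add add: mult_2 del: prod.cl_ivl_Suc)
    finally have C: "(\<Prod>j=1..2*n+2. u y - b j) = u y ^ (n + 1) * u y ^ (n + 1) * (\<Prod>j=1..2*n+2. 1 - b j / u y)" .
    have D: "u (y + 1) / s + s / u (y + 1) = u y * s + 1 / (u y * s)"
      using s u0[of y] unfolding uS s(2)[symmetric] by (simp add: field_simps power2_eq_square)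
    have "g (y + 1) = w (y + 1) * (\<Prod>j=1..2*n+2. 1 - b j * u (y + 1)) * (1 / u (y + 1) ^ (n + 1) * (u y * s + 1 / (u y * s)) ^ i)"
      unfolding g_def D by (simp only: mult_ac)
    also have "\<dots> = w y * (q ^ (n + 1) * (u y ^ (n + 1) * u y ^ (n + 1) * (\<Prod>j=1..2*n+2. 1 - b j / u y)))
        * (1 / (q ^ (n + 1) * u y ^ (n + 1)) * (u y * s + 1 / (u y * s)) ^ i)"
      unfolding A C by (simp only: uS power_mult_distrib)
    also have "\<dots> = w y * (u y ^ (n + 1) * (\<Prod>j=1..2*n+2. 1 - b j / u y) * (u y * s + 1 / (u y * s)) ^ i)"
      using u0[of y] q(1) by (simp add: field_simps del: prod.cl_ivl_Suc power_Suc)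
    finally show ?thesis .
  qed
  have gf: "g (y + 1) - g y = f y" for y
  proof -
    have "f y = w y * (poly h (u y + 1 / u y) * (1 / u y - u y))"
      by (simp only: f_def mult_ac)
    also note h[OF u0]
    finally show ?thesis unfolding g1 by (simp only: g_def right_diff_distrib)
  qed
  have sf: "f summable_on UNIV"
    unfolding f_def w_def u_def by (rule summable_omega_poly[OF q z B']) (use deg in \<open>simp add: d_def\<close>)
  have lim0: "(\<lambda>k. u (int k)) \<longlonglongrightarrow> 0"
  proof -
    have "(\<lambda>k. z * q ^ k) \<longlonglongrightarrow> z * 0" by (intro tendsto_intros LIMSEQ_power_zero q)
    thus ?thesis by (simp add: u_def)
  qed
  have lim0': "(\<lambda>k. 1 / u (- int k)) \<longlonglongrightarrow> 0"
  proof -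
    have "(\<lambda>k. 1 / z * q ^ k) \<longlonglongrightarrow> 1 / z * 0" by (intro tendsto_intros LIMSEQ_power_zero q)
    thus ?thesis by (simp add: u_def power_int_minus field_simps)
  qed
  have powi_d: "u y powi (- int d) = 1 / u y ^ (n + 1) * (1 / u y) ^ i"
      "u y powi int d = u y ^ (n + 1) * u y ^ i" for y
    unfolding power_int_minus power_int_of_nat d_def power_add[of _ "n + 1" i]
    by (simp_all add: power_one_over inverse_eq_divide del: power_Suc)
  \<comment> \<open>As u tends to 0, g is the null sequence omega * u^(-d) times a factor that
    converges.\<close>
  have l1: "(\<lambda>k. g (int k)) \<longlonglongrightarrow> 0"
  proof -
    have "(\<lambda>k. omega q n b z (int k) * (z * q powi int k) powi (- int d)) \<longlonglongrightarrow> 0"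
      by (rule summable_LIMSEQ_zero[OF summable_norm_cancel],
        rule infsum_int_split(2)[OF abs_summable_omega_powi[OF q z B', of "- int d"]]) auto
    hence "(\<lambda>k. w (int k) * u (int k) powi (- int d) * ((\<Prod>j=1..2*n+2. 1 - b j * u (int k)) * (u (int k) * u (int k) / s + s) ^ i))
       \<longlonglongrightarrow> 0 * ((\<Prod>j=1..2*n+2. 1 - b j * 0) * (0 * 0 / s + s) ^ i)"
      unfolding w_def u_def[symmetric] by (intro tendsto_intros lim0) (use s in auto)
    moreover have "w y * u y powi (- int d) * ((\<Prod>j=1..2*n+2. 1 - b j * u y) * (u y * u y / s + s) ^ i) = g y" for y
    proof -
      have "u y / s + s / u y = (1 / u y) * (u y * u y / s + s)"
        using u0[of y] s(1) by (simp add: field_simps)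
      hence *: "(u y / s + s / u y) ^ i = (1 / u y) ^ i * (u y * u y / s + s) ^ i"
        by (simp only: power_mult_distrib)
      show ?thesis unfolding g_def powi_d * by (simp only: mult_ac)
    qed
    ultimately show ?thesis by simp
  qed
  \<comment> \<open>Here 1/u tends to 0, and the expression \<open>g1\<close> for g(y+1) is the
    convenient one: omega * u^d times a convergent factor in 1/u. Hence y = - \<open>Suc k\<close>,
    so that y + 1 = - \<open>k\<close>.\<close>
  have l2: "(\<lambda>k. g (- int k)) \<longlonglongrightarrow> 0"
  proof -
    have "(\<lambda>k. omega q n b z (- int (Suc k)) * (z * q powi - int (Suc k)) powi int d) \<longlonglongrightarrow> 0"
      by (rule summable_LIMSEQ_zero[OF summable_norm_cancel],
        rule infsum_int_split(3)[OF abs_summable_omega_powi[OF q z B', of "int d"]]) auto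
    hence "(\<lambda>k. w (- int (Suc k)) * u (- int (Suc k)) powi int d
          * ((\<Prod>j=1..2*n+2. 1 - b j * (1 / u (- int (Suc k)))) * (s + (1 / u (- int (Suc k))) * (1 / u (- int (Suc k))) / s) ^ i))
       \<longlonglongrightarrow> 0 * ((\<Prod>j=1..2*n+2. 1 - b j * 0) * (s + 0 * 0 / s) ^ i)"
      unfolding w_def u_def[symmetric] by (intro tendsto_intros LIMSEQ_Suc[OF lim0']) (use s in auto)
    moreover have "w y * u y powi int d * ((\<Prod>j=1..2*n+2. 1 - b j * (1 / u y)) * (s + (1 / u y) * (1 / u y) / s) ^ i)
        = g (y + 1)" for y
    proof -
      have "u y * s + 1 / (u y * s) = u y * (s + (1 / u y) * (1 / u y) / s)"
        using u0[of y] s(1) by (simp add: field_simps)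
      hence *: "(u y * s + 1 / (u y * s)) ^ i = u y ^ i * (s + (1 / u y) * (1 / u y) / s) ^ i"
        by (simp only: power_mult_distrib)
      have "b j * (1 / u y) = b j / u y" for j by simp
      thus ?thesis unfolding g1 powi_d * by (simp only: mult_ac)
    qed
    moreover have "- int (Suc k) + 1 = - int k" for k by simp
    ultimately show ?thesis by simp
  qed
  have "infsum f UNIV = 0"
    using sf by (intro infsum_int_telescope[OF _ gf l1 l2])
      (simp add: summable_on_iff_abs_summable_on_complex)
  thus ?thesis unfolding wsum_def f_def w_def u_def .
qed

section \<open>Determinants of rows\<close>

text \<open>Rows are functions on all of \<open>nat\<close> and the length of the list fixes the
  size. Appending rows thus enlarges the matrix without changing the rows already present.\<close>

definition rdet :: "(nat \<Rightarrow> complex) list \<Rightarrow> complex" where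
  "rdet fs = Determinant.det (Matrix.mat (length fs) (length fs) (\<lambda>(r, i). (fs ! r) i))"

definition vdm :: "complex list \<Rightarrow> complex" where
  "vdm xs = (\<Prod>r<length xs. \<Prod>i<r. xs ! r - xs ! i)"

lemma rdet_Leibniz:
  "rdet fs = (\<Sum>p | p permutes {0..<length fs}. signof p * (\<Prod>i=0..<length fs. (fs ! i) (p i)))"
proof -
  have "(\<Prod>i=0..<length fs. Matrix.mat (length fs) (length fs) (\<lambda>(r, i). (fs ! r) i) $$ (i, p i))
      = (\<Prod>i=0..<length fs. (fs ! i) (p i))" if "p permutes {0..<length fs}" for p
    using permutes_in_image[OF that] by (intro prod.cong refl) auto
  thus ?thesis unfolding rdet_def by (subst det_def'[of _ "length fs"]) auto
qed

lemma rdet_cong: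
  assumes "length fs = length gs" "\<And>r i. r < length fs \<Longrightarrow> i < length fs \<Longrightarrow> (fs ! r) i = (gs ! r) i"
  shows "rdet fs = rdet gs"
  unfolding rdet_def using assms by (intro arg_cong[of _ _ Determinant.det] eq_matI) auto

lemma rdet_row_linear:
  "rdet (acc @ (\<lambda>i. \<alpha> * f i + \<beta> * g i) # rest) = \<alpha> * rdet (acc @ f # rest) + \<beta> * rdet (acc @ g # rest)"
proof -
  let ?k = "length acc" and ?N = "length acc + Suc (length rest)"
  have *: "(\<Prod>i=0..<?N. ((acc @ h # rest) ! i) (p i))
     = h (p ?k) * (\<Prod>i\<in>{0..<?N} - {?k}. ((acc @ f # rest) ! i) (p i))" for h p
  proof -
    have "(\<Prod>i=0..<?N. ((acc @ h # rest) ! i) (p i))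
       = ((acc @ h # rest) ! ?k) (p ?k) * (\<Prod>i\<in>{0..<?N} - {?k}. ((acc @ h # rest) ! i) (p i))"
      by (rule prod.remove) auto
    also have "(\<Prod>i\<in>{0..<?N} - {?k}. ((acc @ h # rest) ! i) (p i))
       = (\<Prod>i\<in>{0..<?N} - {?k}. ((acc @ f # rest) ! i) (p i))"
      by (intro prod.cong refl) (auto simp: nth_append nth_Cons')
    finally show ?thesis by simp
  qed
  show ?thesis
    unfolding rdet_Leibniz length_append list.size add_Suc_right add_0_right
    unfolding add_Suc_right[symmetric] *
    by (simp add: sum_distrib_left sum.distrib[symmetric] algebra_simps)
qed

lemma rdet_row_smult_all:
  "rdet (acc @ map (\<lambda>k i. c k * f k i) ks @ rest) = (\<Prod>k\<leftarrow>ks. c k) * rdet (acc @ map f ks @ rest)"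
proof (induction ks arbitrary: acc)
  case (Cons k ks)
  have "rdet (acc @ map (\<lambda>k i. c k * f k i) (k # ks) @ rest)
      = c k * rdet ((acc @ [f k]) @ map (\<lambda>k i. c k * f k i) ks @ rest)"
    using rdet_row_linear[of acc "c k" "f k" 0 "f k"] by simp
  thus ?case unfolding Cons.IH by simp
qed simp

lemma rdet_eq_0:
  assumes "i < length fs" "j < length fs" "i \<noteq> j" "\<And>l. (fs ! i) l = (fs ! j) l"
  shows "rdet fs = 0"
  unfolding rdet_def
  by (rule det_identical_rows[of _ "length fs" i j]) (use assms in \<open>auto intro!: eq_vecI\<close>)

lemma rdet_proportional_rows:
  assumes ij: "i < length fs" "j < length fs" "i \<noteq> j" "\<And>l. (fs ! i) l = c * (fs ! j) l"
  shows "rdet fs = 0"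
proof -
  let ?gs = "fs[i := fs ! j]"
  have f: "fs = take i fs @ (\<lambda>l. c * (fs ! j) l + 0 * (fs ! j) l) # drop (Suc i) fs"
    using ij(1) ij(4)[symmetric] by (simp add: id_take_nth_drop[symmetric])
  have "rdet fs = c * rdet ?gs + 0 * rdet ?gs"
    unfolding upd_conv_take_nth_drop[OF ij(1)]
    by (subst f) (rule rdet_row_linear)
  moreover have "rdet ?gs = 0"
    by (rule rdet_eq_0[of i _ j]) (use ij in auto)
  ultimately show ?thesis by simp
qed

lemma vdm_snoc: "vdm (xs @ [x]) = vdm xs * (\<Prod>i<length xs. x - xs ! i)"
proof -
  have "(\<Prod>r<length xs. \<Prod>i<r. (xs @ [x]) ! r - (xs @ [x]) ! i) = vdm xs"
    unfolding vdm_def by (intro prod.cong refl) (auto simp: nth_append)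
  moreover have "(\<Prod>i<length xs. (xs @ [x]) ! length xs - (xs @ [x]) ! i) = (\<Prod>i<length xs. x - xs ! i)"
    by (intro prod.cong refl) (auto simp: nth_append)
  ultimately show ?thesis by (simp add: vdm_def)
qed

lemma prod_lessThan_prod_list: "(\<Prod>i<length xs. f (xs ! i)) = (\<Prod>x\<leftarrow>xs. f x)"
  by (simp add: prod.list_conv_set_nth atLeast0LessThan)

lemma vdm_append: "vdm (xs @ ys) = vdm xs * vdm ys * (\<Prod>y\<leftarrow>ys. \<Prod>x\<leftarrow>xs. y - x)"
proof (induction ys rule: rev_induct)
  case (snoc y ys)
  have "vdm (xs @ ys @ [y]) = vdm ((xs @ ys) @ [y])" by simp
  thus ?case unfolding vdm_snoc snoc prod_lessThan_prod_list[of "\<lambda>x. y - x"] by simp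
qed (simp add: vdm_def)

text \<open>The matrix is the Vandermonde matrix times the matrix of coefficients, which is upper
  triangular by the degree bound.\<close>

lemma rdet_poly_triangular:
  assumes H: "\<And>i. i < length xs \<Longrightarrow> degree (H i) \<le> i"
  shows "rdet (map (\<lambda>x i. poly (H i) x) xs)
       = rdet (map (\<lambda>x i. x ^ i) xs) * (\<Prod>i<length xs. coeff (H i) i)"
proof -
  let ?N = "length xs"
  let ?V = "Matrix.mat ?N ?N (\<lambda>(r, i). xs ! r ^ i)"
  let ?C = "Matrix.mat ?N ?N (\<lambda>(l, i). coeff (H i) l)"
  have "Matrix.mat ?N ?N (\<lambda>(r, i). poly (H i) (xs ! r)) = ?V * ?C"
  proof (rule eq_matI)
    fix r i assume "r < dim_row (?V * ?C)" "i < dim_col (?V * ?C)"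
    hence ri: "r < ?N" "i < ?N" by auto
    have "poly (H i) (xs ! r) = (\<Sum>l\<le>i. coeff (H i) l * xs ! r ^ l)"
      by (rule poly_sum_atMost[OF H[OF ri(2)]])
    also have "\<dots> = (\<Sum>l=0..<?N. coeff (H i) l * xs ! r ^ l)"
      using ri H[OF ri(2)] by (intro sum.mono_neutral_left) (auto intro!: coeff_eq_0)
    finally show "Matrix.mat ?N ?N (\<lambda>(r, i). poly (H i) (xs ! r)) $$ (r, i) = (?V * ?C) $$ (r, i)"
      using ri by (simp add: scalar_prod_def mult.commute)
  qed auto
  hence "Determinant.det (Matrix.mat ?N ?N (\<lambda>(r, i). poly (H i) (xs ! r))) = Determinant.det ?V * Determinant.det ?C"
    by (simp add: det_mult[of _ ?N])
  moreover have "Determinant.det ?C = (\<Prod>i<?N. coeff (H i) i)"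
  proof -
    have "upper_triangular ?C"
      using H by (auto intro!: coeff_eq_0 simp: upper_triangular_def) (meson le_less_trans less_trans)
    hence "Determinant.det ?C = prod_list (diag_mat ?C)"
      by (rule det_upper_triangular) auto
    also have "\<dots> = (\<Prod>i<?N. coeff (H i) i)"
      by (simp add: prod_list_diag_prod atLeast0LessThan)
    finally show ?thesis .
  qed
  moreover have "rdet (map (\<lambda>x i. poly (H i) x) xs) = Determinant.det (Matrix.mat ?N ?N (\<lambda>(r, i). poly (H i) (xs ! r)))"
    unfolding rdet_def by (intro arg_cong[of _ _ Determinant.det] eq_matI) auto
  moreover have "rdet (map (\<lambda>x i. x ^ i) xs) = Determinant.det ?V"
    unfolding rdet_def by (intro arg_cong[of _ _ Determinant.det] eq_matI) auto
  ultimately show ?thesis by simp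
qed

lemma rdet_upper_right_zero:
  assumes z: "\<And>f i. f \<in> set fs \<Longrightarrow> length fs \<le> i \<Longrightarrow> f i = 0"
  shows "rdet (fs @ gs) = rdet fs * rdet (map (\<lambda>g i. g (length fs + i)) gs)"
proof -
  let ?n = "length fs" and ?m = "length gs"
  let ?A = "Matrix.mat ?n ?n (\<lambda>(r, i). (fs ! r) i)"
  let ?C = "Matrix.mat ?m ?n (\<lambda>(r, i). (gs ! r) i)"
  let ?D = "Matrix.mat ?m ?m (\<lambda>(r, i). (gs ! r) (?n + i))"
  have "Matrix.mat (?n + ?m) (?n + ?m) (\<lambda>(r, i). ((fs @ gs) ! r) i) = four_block_mat ?A (0\<^sub>m ?n ?m) ?C ?D"
    using z by (intro eq_matI) (auto simp: nth_append)
  hence "rdet (fs @ gs) = Determinant.det (four_block_mat ?A (0\<^sub>m ?n ?m) ?C ?D)"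
    by (simp add: rdet_def)
  also have "\<dots> = Determinant.det ?A * Determinant.det ?D"
    by (rule det_four_block_mat_upper_right_zero) auto
  also have "Determinant.det ?D = rdet (map (\<lambda>g i. g (?n + i)) gs)"
    unfolding rdet_def by (intro arg_cong[of _ _ Determinant.det] eq_matI) auto
  finally show ?thesis by (simp add: rdet_def)
qed

text \<open>In the last column the top monomial is replaced by the monic polynomial vanishing at all
  earlier points. By \<open>rdet_poly_triangular\<close> this does not change the determinant, and
  it clears the column except for its last entry.\<close>

lemma rdet_Vandermonde: "rdet (map (\<lambda>x i. x ^ i) xs) = vdm xs"
proof (induction xs rule: rev_induct)
  case Nil
  show ?case by (simp add: rdet_def vdm_def)
next
  case (snoc x xs)
  let ?n = "length xs"
  define P where "P = (\<Prod>r<?n. [:- (xs ! r), 1:])"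
  define H :: "nat \<Rightarrow> complex poly" where "H i = (if i = ?n then P else Polynomial.monom 1 i)" for i
  have dP: "degree P = ?n" unfolding P_def by (subst degree_prod_eq_sum_degree) auto
  have lP: "coeff P ?n = 1"
    using lead_coeff_prod[of "\<lambda>r. [:- (xs ! r), 1:]" "{..<?n}"] unfolding P_def[symmetric] dP by simp
  have "rdet (map (\<lambda>x i. poly (H i) x) (xs @ [x]))
     = rdet (map (\<lambda>x i. x ^ i) (xs @ [x])) * (\<Prod>i<length (xs @ [x]). coeff (H i) i)"
    by (rule rdet_poly_triangular) (auto simp: H_def dP degree_monom_eq)
  also have "(\<Prod>i<length (xs @ [x]). coeff (H i) i) = 1"
    by (rule prod.neutral) (auto simp: H_def lP)
  finally have 1: "rdet (map (\<lambda>x i. x ^ i) (xs @ [x])) = rdet (map (\<lambda>x i. poly (H i) x) (xs @ [x]))" by simp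
  have Hz: "poly (H ?n) (xs ! r) = 0" if "r < ?n" for r
    using that by (auto simp: H_def P_def poly_prod intro!: prod_zero)
  have "rdet (map (\<lambda>x i. poly (H i) x) (xs @ [x]))
      = rdet (map (\<lambda>x i. if i < ?n then x ^ i else 0) xs @ [\<lambda>i. poly (H i) x])"
  proof (rule rdet_cong)
    fix r i assume "r < length (map (\<lambda>x i. poly (H i) x) (xs @ [x]))" "i < length (map (\<lambda>x i. poly (H i) x) (xs @ [x]))"
    hence ri: "r < Suc ?n" "i < Suc ?n" by auto
    show "(map (\<lambda>x i. poly (H i) x) (xs @ [x]) ! r) i
        = ((map (\<lambda>x i. if i < ?n then x ^ i else 0) xs @ [\<lambda>i. poly (H i) x]) ! r) i"
    proof (cases "r < ?n")
      case True
      thus ?thesis using ri Hz[OF True] by (cases "i = ?n") (auto simp: nth_append H_def poly_monom)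
    next
      case False
      with ri have "r = ?n" by simp
      thus ?thesis by (simp add: nth_append)
    qed
  qed simp
  also have "\<dots> = rdet (map (\<lambda>x i. if i < ?n then x ^ i else 0) xs) * rdet [\<lambda>i. poly (H (?n + i)) x]"
    by (subst rdet_upper_right_zero) auto
  also have "rdet (map (\<lambda>x i. if i < ?n then x ^ i else 0) xs) = rdet (map (\<lambda>x i. x ^ i) xs)"
    by (rule rdet_cong) auto
  also have "rdet [\<lambda>i. poly (H (?n + i)) x] = poly P x"
    unfolding rdet_def by (subst det_single) (auto simp: H_def)
  also have "poly P x = (\<Prod>i<?n. x - xs ! i)"
    by (simp add: P_def poly_prod)
  finally show ?case unfolding 1 snoc vdm_snoc .
qed

section \<open>Multiple series as determinants of one-variable series\<close>

lemma has_sum_finite_sum: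
  fixes f :: "'i \<Rightarrow> 'a \<Rightarrow> 'b :: real_normed_vector"
  assumes "\<And>i. i \<in> I \<Longrightarrow> (f i has_sum s i) A"
  shows "((\<lambda>x. \<Sum>i\<in>I. f i x) has_sum (\<Sum>i\<in>I. s i)) A"
  using assms by (induction I rule: infinite_finite_induct) (simp_all add: has_sum_add)

text \<open>Any finite set of tuples lies in the box spanned by its coordinate projections, and over
  a box the sum of norms factors; this bounds all partial sums of norms.\<close>

lemma has_sum_prod_PiE:
  fixes f :: "'i \<Rightarrow> 'b \<Rightarrow> complex"
  assumes A: "finite A" and f: "\<And>k. k \<in> A \<Longrightarrow> f k summable_on UNIV"
  shows "((\<lambda>y. \<Prod>k\<in>A. f k (y k)) has_sum (\<Prod>k\<in>A. infsum (f k) UNIV)) (A \<rightarrow>\<^sub>E UNIV)"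
proof -
  have nf: "(\<lambda>v. norm (f k v)) summable_on UNIV" if "k \<in> A" for k
    using f[OF that] by (simp add: summable_on_iff_abs_summable_on_complex)
  have "(\<lambda>y. norm (\<Prod>k\<in>A. f k (y k))) summable_on (A \<rightarrow>\<^sub>E UNIV)"
  proof (rule iffD2[OF abs_summable_iff_bdd_above], rule bdd_aboveI[of _ "\<Prod>k\<in>A. infsum (\<lambda>v. norm (f k v)) UNIV"])
    fix s assume "s \<in> sum (\<lambda>y. norm (\<Prod>k\<in>A. f k (y k))) ` {F. F \<subseteq> A \<rightarrow>\<^sub>E UNIV \<and> finite F}"
    then obtain F where F: "F \<subseteq> A \<rightarrow>\<^sub>E UNIV" "finite F" and s: "s = (\<Sum>y\<in>F. norm (\<Prod>k\<in>A. f k (y k)))"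
      by blast
    let ?P = "\<lambda>k. (\<lambda>y. y k) ` F"
    have "s = (\<Sum>y\<in>F. \<Prod>k\<in>A. norm (f k (y k)))" unfolding s by (simp add: prod_norm)
    also have "\<dots> \<le> (\<Sum>y\<in>PiE A ?P. \<Prod>k\<in>A. norm (f k (y k)))"
      using F A by (intro sum_mono2 finite_PiE prod_nonneg) (auto simp: PiE_iff extensional_def)
    also have "\<dots> = (\<Prod>k\<in>A. \<Sum>v\<in>?P k. norm (f k v))"
      using F A by (intro prod_sum_PiE[symmetric]) auto
    also have "\<dots> \<le> (\<Prod>k\<in>A. infsum (\<lambda>v. norm (f k v)) UNIV)"
      using F nf by (intro prod_mono conjI sum_nonneg finite_sum_le_infsum) auto
    finally show "s \<le> (\<Prod>k\<in>A. infsum (\<lambda>v. norm (f k v)) UNIV)" .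
  qed
  hence "(\<lambda>y. \<Prod>k\<in>A. f k (y k)) summable_on (A \<rightarrow>\<^sub>E UNIV)"
    by (rule abs_summable_summable)
  moreover have "infsum (\<lambda>y. \<Prod>k\<in>A. f k (y k)) (A \<rightarrow>\<^sub>E UNIV) = (\<Prod>k\<in>A. infsum (f k) UNIV)"
    by (rule infsum_prod_PiE_abs[OF A nf])
  ultimately show ?thesis by (metis has_sum_infsum)
qed

text \<open>In the Leibniz expansion each of the first \<open>n\<close> rows contributes one factor
  depending on one summation variable, and the rows \<open>gs\<close> are constant. Variable
  \<open>k\<close> belongs to the row with list index k - 1.\<close>

lemma has_sum_rdet:
  fixes f :: "nat \<Rightarrow> int \<Rightarrow> nat \<Rightarrow> complex"
  assumes f: "\<And>k i. k \<in> {1..n} \<Longrightarrow> i < n + length gs \<Longrightarrow> (\<lambda>y. f k y i) summable_on UNIV"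
  shows "((\<lambda>y. rdet (map (\<lambda>k. f k (y k)) [1..<Suc n] @ gs)) has_sum
      rdet (map (\<lambda>k i. infsum (\<lambda>y. f k y i) UNIV) [1..<Suc n] @ gs)) ({1..n} \<rightarrow>\<^sub>E UNIV)"
proof -
  let ?N = "n + length gs"
  have split: "(\<Prod>i=0..<?N. ((map F [1..<Suc n] @ gs) ! i) (p i))
     = (\<Prod>k=1..n. F k (p (k - 1))) * (\<Prod>i=0..<length gs. (gs ! i) (p (n + i)))" for F :: "nat \<Rightarrow> nat \<Rightarrow> complex" and p
  proof -
    have "(\<Prod>i=0..<?N. ((map F [1..<Suc n] @ gs) ! i) (p i))
       = (\<Prod>i=0..<n. ((map F [1..<Suc n] @ gs) ! i) (p i)) * (\<Prod>i=n..<?N. ((map F [1..<Suc n] @ gs) ! i) (p i))"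
      by (rule prod.atLeastLessThan_concat[symmetric]) auto
    also have "(\<Prod>i=0..<n. ((map F [1..<Suc n] @ gs) ! i) (p i)) = (\<Prod>i=0..<n. F (Suc i) (p i))"
      by (intro prod.cong refl) (auto simp: nth_append simp del: upt_Suc)
    also have "\<dots> = (\<Prod>k=1..n. F k (p (k - 1)))"
      by (rule prod.reindex_bij_witness[of _ "\<lambda>k. k - 1" Suc]) auto
    also have "(\<Prod>i=n..<?N. ((map F [1..<Suc n] @ gs) ! i) (p i)) = (\<Prod>i=0..<length gs. (gs ! i) (p (n + i)))"
      by (rule prod.reindex_bij_witness[of _ "\<lambda>i. n + i" "\<lambda>i. i - n"]) (auto simp: nth_append simp del: upt_Suc)
    finally show ?thesis .
  qed
  have len: "length (map F [1..<Suc n] @ gs) = ?N" for F :: "nat \<Rightarrow> nat \<Rightarrow> complex" by simp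
  show ?thesis
    unfolding rdet_Leibniz len split
  proof (intro has_sum_finite_sum has_sum_cmult_right has_sum_cmult_left has_sum_prod_PiE)
    fix p k assume p: "p \<in> {p. p permutes {0..<?N}}" and k: "k \<in> {1..n}"
    have "p (k - 1) < ?N" using permutes_in_image[of p "{0..<?N}" "k - 1"] p k by auto
    thus "(\<lambda>y. f k y (p (k - 1))) summable_on UNIV" using f k by blast
  qed auto
qed

text \<open>Gustafson's multiple series, as \<open>has_sum_gsum\<close> shows. The determinant form
  gives limits in \<open>b\<close> from those of single entries, and vanishing when two rows are
  proportional.\<close>

definition gsum :: "complex \<Rightarrow> nat \<Rightarrow> (nat \<Rightarrow> complex) \<Rightarrow> (nat \<Rightarrow> complex) \<Rightarrow> complex" where
  "gsum q n b z = rdet (map (\<lambda>k i. wsum q n b (z k) (Polynomial.monom 1 i)) [1..<Suc n])"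

text \<open>Expanding in the basis consisting of the monomials of degree less than \<open>n\<close> and the lowered
  polynomials makes the determinant of sums block triangular, because the latter have vanishing sums.\<close>

lemma has_sum_omega_vdm:
  fixes q s :: complex and Ts :: "complex list"
  assumes q: "q \<noteq> 0" "norm q < 1" and s: "s \<noteq> 0" "s\<^sup>2 = q" and z: "\<And>k. k \<in> {1..n} \<Longrightarrow> z k \<noteq> 0"
    and conv: "norm (\<Prod>j=1..2*n+2. b j) * norm q < norm q ^ length Ts"
    and deg: "\<And>i. i < length Ts \<Longrightarrow> degree (h i) \<le> n + i"
    and h: "\<And>i u. i < length Ts \<Longrightarrow> u \<noteq> 0 \<Longrightarrow> poly (h i) (u + 1 / u) * (1 / u - u)
        = u ^ (n + 1) * (\<Prod>j=1..2*n+2. 1 - b j / u) * (u * s + 1 / (u * s)) ^ i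
        - 1 / u ^ (n + 1) * (\<Prod>j=1..2*n+2. 1 - b j * u) * (u / s + s / u) ^ i"
  shows "((\<lambda>y. (\<Prod>k=1..n. omega q n b (z k) (y k) * (1 / (z k * q powi y k) - z k * q powi y k))
        * vdm (map (\<lambda>k. z k * q powi y k + 1 / (z k * q powi y k)) [1..<Suc n] @ Ts)
        * (\<Prod>i<length Ts. coeff (h i) (n + i)))
      has_sum (gsum q n b z * rdet (map (\<lambda>x i. poly (h i) x) Ts))) ({1..n} \<rightarrow>\<^sub>E UNIV)"
proof -
  let ?M = "length Ts"
  \<comment> \<open>A triangular basis with \<open>degree (H i) \<le> i\<close>: it changes the
    Vandermonde determinant only by the product of the top coefficients, and those of the monomials
    are 1.\<close>
  define H :: "nat \<Rightarrow> complex poly" where "H i = (if i < n then Polynomial.monom 1 i else h (i - n))" for i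
  have dH: "degree (H i) \<le> i" if "i < n + ?M" for i
    using deg[of "i - n"] that by (auto simp: H_def degree_monom_eq)
  define X where "X k y = z k * q powi y + 1 / (z k * q powi y)" for k y
  define wt where "wt k y = omega q n b (z k) y * (1 / (z k * q powi y) - z k * q powi y)" for k y
  have cH: "(\<Prod>i<n + ?M. coeff (H i) i) = (\<Prod>i<?M. coeff (h i) (n + i))"
  proof -
    have "(\<Prod>i<n + ?M. coeff (H i) i) = (\<Prod>i=0..<n. coeff (H i) i) * (\<Prod>i=n..<n + ?M. coeff (H i) i)"
      unfolding lessThan_atLeast0 by (rule prod.atLeastLessThan_concat[symmetric]) auto
    also have "(\<Prod>i=0..<n. coeff (H i) i) = 1" by (rule prod.neutral) (simp add: H_def)
    also have "(\<Prod>i=n..<n + ?M. coeff (H i) i) = (\<Prod>i<?M. coeff (h i) (n + i))"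
      by (rule prod.reindex_bij_witness[of _ "\<lambda>i. n + i" "\<lambda>i. i - n"]) (auto simp: H_def)
    finally show ?thesis by simp
  qed
  have det_eq: "rdet (map (\<lambda>k i. wt k (y k) * poly (H i) (X k (y k))) [1..<Suc n] @ map (\<lambda>x i. poly (H i) x) Ts)
     = (\<Prod>k=1..n. wt k (y k)) * vdm (map (\<lambda>k. X k (y k)) [1..<Suc n] @ Ts) * (\<Prod>i<?M. coeff (h i) (n + i))"
    for y
  proof -
    have "rdet (map (\<lambda>k i. wt k (y k) * poly (H i) (X k (y k))) [1..<Suc n] @ map (\<lambda>x i. poly (H i) x) Ts)
       = (\<Prod>k\<leftarrow>[1..<Suc n]. wt k (y k)) * rdet (map (\<lambda>x i. poly (H i) x) (map (\<lambda>k. X k (y k)) [1..<Suc n] @ Ts))"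
      using rdet_row_smult_all[of "[]" "\<lambda>k. wt k (y k)" "\<lambda>k i. poly (H i) (X k (y k))" "[1..<Suc n]"
          "map (\<lambda>x i. poly (H i) x) Ts"]
      by (simp add: o_def del: upt_Suc)
    also have "(\<Prod>k\<leftarrow>[1..<Suc n]. wt k (y k)) = (\<Prod>k=1..n. wt k (y k))"
      by (subst prod.distinct_set_conv_list[symmetric]) (auto simp: atLeastLessThanSuc_atLeastAtMost simp del: upt_Suc)
    also have "rdet (map (\<lambda>x i. poly (H i) x) (map (\<lambda>k. X k (y k)) [1..<Suc n] @ Ts))
       = vdm (map (\<lambda>k. X k (y k)) [1..<Suc n] @ Ts) * (\<Prod>i<n + ?M. coeff (H i) i)"
      using rdet_poly_triangular[of "map (\<lambda>k. X k (y k)) [1..<Suc n] @ Ts" H] dH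
      unfolding rdet_Vandermonde by (simp del: upt_Suc)
    finally show ?thesis unfolding cH by (simp only: mult.assoc)
  qed
  \<comment> \<open>The basis polynomials reach degree n + M - 1, so the weight must control n + M
    powers of u; this is the convergence hypothesis times |q|^n.\<close>
  have B: "norm (\<Prod>j=1..2*n+2. b j) * norm q ^ (n + 1) < norm q ^ (n + ?M)"
  proof -
    have "norm (\<Prod>j=1..2*n+2. b j) * norm q ^ (n + 1) = norm q ^ n * (norm (\<Prod>j=1..2*n+2. b j) * norm q)"
      by (simp only: power_add power_one_right mult_ac)
    also have "\<dots> < norm q ^ n * norm q ^ ?M"
      using conv q by (intro mult_strict_left_mono) auto
    finally show ?thesis by (simp only: power_add)
  qed
  have B': "norm (\<Prod>j=1..2*n+2. b j) < norm q ^ i" if "i < ?M" for i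
  proof -
    have "norm (\<Prod>j=1..2*n+2. b j) * norm q < norm q ^ i * norm q"
    proof (rule less_le_trans[OF conv])
      have "norm q ^ ?M \<le> norm q ^ Suc i" using that q by (intro power_decreasing) auto
      thus "norm q ^ ?M \<le> norm q ^ i * norm q" by (simp only: power_Suc2)
    qed
    thus ?thesis using q by simp
  qed
  have "((\<lambda>y. rdet (map (\<lambda>k i. wt k (y k) * poly (H i) (X k (y k))) [1..<Suc n] @ map (\<lambda>x i. poly (H i) x) Ts))
     has_sum rdet (map (\<lambda>k i. infsum (\<lambda>y. wt k y * poly (H i) (X k y)) UNIV) [1..<Suc n] @ map (\<lambda>x i. poly (H i) x) Ts))
     ({1..n} \<rightarrow>\<^sub>E UNIV)"
  proof (rule has_sum_rdet)
    fix k i assume ki: "k \<in> {1..n}" "i < n + length (map (\<lambda>x i. poly (H i) x) Ts)"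
    show "(\<lambda>y. wt k y * poly (H i) (X k y)) summable_on UNIV"
      unfolding wt_def X_def using ki dH[of i]
      by (intro summable_omega_poly[OF q z B]) auto
  qed
  also have "rdet (map (\<lambda>k i. infsum (\<lambda>y. wt k y * poly (H i) (X k y)) UNIV) [1..<Suc n] @ map (\<lambda>x i. poly (H i) x) Ts)
     = rdet (map (\<lambda>k i. if i < n then wsum q n b (z k) (Polynomial.monom 1 i) else 0) [1..<Suc n] @ map (\<lambda>x i. poly (H i) x) Ts)"
  proof (rule rdet_cong)
    fix r i
    assume "r < length (map (\<lambda>k i. infsum (\<lambda>y. wt k y * poly (H i) (X k y)) UNIV) [1..<Suc n] @ map (\<lambda>x i. poly (H i) x) Ts)"
      and "i < length (map (\<lambda>k i. infsum (\<lambda>y. wt k y * poly (H i) (X k y)) UNIV) [1..<Suc n] @ map (\<lambda>x i. poly (H i) x) Ts)"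
    hence i: "i < n + ?M" by (simp del: upt_Suc)
    have "infsum (\<lambda>y. wt k y * poly (H i) (X k y)) UNIV
        = (if i < n then wsum q n b (z k) (Polynomial.monom 1 i) else 0)" if k: "k \<in> {1..n}" for k
    proof -
      have "infsum (\<lambda>y. wt k y * poly (H i) (X k y)) UNIV = wsum q n b (z k) (H i)"
        unfolding wsum_def wt_def X_def ..
      moreover have "wsum q n b (z k) (h (i - n)) = 0" if "\<not> i < n"
        using i that by (intro wsum_lowering_eq_0[OF q s z[OF k] B' deg h]) auto
      ultimately show ?thesis by (simp add: H_def)
    qed
    thus "((map (\<lambda>k i. infsum (\<lambda>y. wt k y * poly (H i) (X k y)) UNIV) [1..<Suc n] @ map (\<lambda>x i. poly (H i) x) Ts) ! r) i =
         ((map (\<lambda>k i. if i < n then wsum q n b (z k) (Polynomial.monom 1 i) else 0) [1..<Suc n] @ map (\<lambda>x i. poly (H i) x) Ts) ! r) i"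
      by (auto simp: nth_append simp del: upt_Suc)
  qed simp
  also have "\<dots> = rdet (map (\<lambda>k i. if i < n then wsum q n b (z k) (Polynomial.monom 1 i) else 0) [1..<Suc n])
      * rdet (map (\<lambda>g i. g (n + i)) (map (\<lambda>x i. poly (H i) x) Ts))"
    by (subst rdet_upper_right_zero) (auto simp del: upt_Suc)
  also have "rdet (map (\<lambda>k i. if i < n then wsum q n b (z k) (Polynomial.monom 1 i) else 0) [1..<Suc n]) = gsum q n b z"
    unfolding gsum_def by (rule rdet_cong) (auto simp del: upt_Suc)
  also have "map (\<lambda>g i. g (n + i)) (map (\<lambda>x i. poly (H i) x) Ts) = map (\<lambda>x i. poly (h i) x) Ts"
    by (simp add: H_def)
  finally show ?thesis unfolding det_eq unfolding wt_def X_def .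
qed

lemma prod_pairs_single:
  fixes c :: "nat \<Rightarrow> complex"
  assumes j0: "j0 \<in> {1..N}"
  shows "(\<Prod>k=1..N. \<Prod>j=1..<k. if j = j0 then c k else if k = j0 then c j else 1) = (\<Prod>j\<in>{1..N} - {j0}. c j)"
proof -
  let ?g = "\<lambda>k. \<Prod>j=1..<k. if j = j0 then c k else if k = j0 then c j else 1"
  have 1: "?g k = (if j0 < k then c k else 1)" if "k \<noteq> j0" for k
  proof -
    have "?g k = (\<Prod>j=1..<k. if j = j0 then c k else 1)" using that by (intro prod.cong) auto
    also have "\<dots> = (if j0 \<in> {1..<k} then c k else 1)" by (rule prod.delta) simp
    finally show ?thesis using j0 by auto
  qed
  have 2: "?g j0 = (\<Prod>j=1..<j0. c j)" by (intro prod.cong) auto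
  have "(\<Prod>k=1..N. ?g k) = ?g j0 * (\<Prod>k\<in>{1..N} - {j0}. ?g k)"
    using j0 by (intro prod.remove) auto
  also have "(\<Prod>k\<in>{1..N} - {j0}. ?g k) = (\<Prod>k\<in>{1..N} - {j0}. if j0 < k then c k else 1)"
    by (intro prod.cong refl 1) auto
  also have "\<dots> = (\<Prod>k\<in>{j0<..N}. c k)"
    by (rule prod.mono_neutral_cong_right) (use j0 in auto)
  also have "?g j0 * (\<Prod>k\<in>{j0<..N}. c k) = (\<Prod>j\<in>{1..<j0} \<union> {j0<..N}. c j)"
    unfolding 2 by (rule prod.union_disjoint[symmetric]) auto
  also have "{1..<j0} \<union> {j0<..N} = {1..N} - {j0}" using j0 by auto
  finally show ?thesis .
qed

section \<open>Evaluation of the sum without insertions\<close>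

definition pairs_inf :: "complex \<Rightarrow> nat \<Rightarrow> (nat \<Rightarrow> complex) \<Rightarrow> complex" where
  "pairs_inf q N b = (\<Prod>k=1..N. \<Prod>j=1..<k. qpoch_inf q (q * b j * b k))"

lemma pairs_inf_step:
  assumes q: "norm q < 1" and j0: "j0 \<in> {1..N}"
  shows "pairs_inf q N b = pairs_inf q N (b(j0 := q * b j0)) * (\<Prod>j\<in>{1..N} - {j0}. 1 - q * b j0 * b j)"
proof -
  have "qpoch_inf q (q * b j * b k)
      = qpoch_inf q (q * (b(j0 := q * b j0)) j * (b(j0 := q * b j0)) k)
        * (if j = j0 then 1 - q * b j0 * b k else if k = j0 then 1 - q * b j0 * b j else 1)" if "j < k" for j k
    using that qpoch_inf_rec[OF q, of "q * b j * b k"] by (auto simp: mult_ac)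
  hence "pairs_inf q N b = (\<Prod>k=1..N. \<Prod>j=1..<k. qpoch_inf q (q * (b(j0 := q * b j0)) j * (b(j0 := q * b j0)) k)
        * (if j = j0 then 1 - q * b j0 * b k else if k = j0 then 1 - q * b j0 * b j else 1))"
    unfolding pairs_inf_def by (intro prod.cong refl) auto
  thus ?thesis
    unfolding prod.distrib prod_pairs_single[OF j0, of "\<lambda>j. 1 - q * b j0 * b j"] pairs_inf_def .
qed

text \<open>At u = t = b_j0 the first product has the factor 1 - b_j0/t = 0, and in the second 1 -
  t^2 = t (1/t - t) cancels against 1/t - t. If t^2 = 1 that cancellation is 0/0, and the value is
  obtained as a limit u -> t.\<close>

lemma lowered_constant_at_parameter:
  fixes t :: complex
  assumes t: "t \<noteq> 0" and j0: "j0 \<in> {1..2*n+2}" and bj: "b j0 = t"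
    and h: "\<And>u. u \<noteq> 0 \<Longrightarrow> poly h (u + 1 / u) * (1 / u - u)
        = u ^ (n + 1) * (\<Prod>j=1..2*n+2. 1 - b j / u) - 1 / u ^ (n + 1) * (\<Prod>j=1..2*n+2. 1 - b j * u)"
  shows "poly h (t + 1 / t) = - (1 / t ^ n) * (\<Prod>j\<in>{1..2*n+2} - {j0}. 1 - b j * t)"
proof -
  define P where "P u = (\<Prod>j\<in>{1..2*n+2} - {j0}. 1 - b j * u)" for u
  have rem: "(\<Prod>j=1..2*n+2. 1 - b j * u) = (1 - t * u) * P u" for u
    unfolding P_def bj[symmetric] using j0 by (intro prod.remove) auto
  have h': "poly h (u + 1 / u) * (1 / u - u)
     = u ^ (n + 1) * ((1 - t * (1 / u)) * P (1 / u)) - 1 / u ^ (n + 1) * ((1 - t * u) * P u)" if "u \<noteq> 0" for u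
    using h[OF that] rem[of u] rem[of "1 / u"] by simp
  show ?thesis
  proof (cases "t\<^sup>2 = 1")
    case False
    have "poly h (t + 1 / t) * (1 / t - t) = - (1 / t ^ n) * P t * (1 / t - t)"
      using h'[OF t] t by (simp add: field_simps power2_eq_square)
    moreover have "1 / t - t \<noteq> 0" using False t by (simp add: field_simps power2_eq_square)
    ultimately have "poly h (t + 1 / t) = - (1 / t ^ n) * P t" by (metis mult_right_cancel)
    thus ?thesis by (simp add: P_def)
  next
    case True
    hence tt: "t * t = 1" by (simp add: power2_eq_square)
    \<comment> \<open>\<open>F\<close> and \<open>G\<close> are the two sides after cancelling u -
      t, which for t^2 = 1 divides 1/u - u, 1 - t u and 1 - t/u. Both are continuous at t.\<close>
    define F where "F u = poly h (u + 1 / u) * (- (u + t) / u)" for u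
    define G where "G u = u ^ n * P (1 / u) + t / u ^ (n + 1) * P u" for u
    have eq: "F u = G u" if u: "u \<noteq> 0" "u \<noteq> t" for u
    proof -
      have a: "1 - t * u = - t * (u - t)" using tt by (simp add: algebra_simps)
      have b: "1 - t * (1 / u) = (u - t) / u" using u by (simp add: field_simps)
      have "(u - t) * (u + t) = u * u - 1" using tt by (simp add: algebra_simps)
      hence c: "1 / u - u = (u - t) * (- (u + t) / u)" using u by (simp add: field_simps)
      have "(u - t) * F u = poly h (u + 1 / u) * (1 / u - u)"
        unfolding F_def c by (simp only: mult_ac)
      also have "\<dots> = (u - t) * G u"
        unfolding h'[OF u(1)] a b G_def using u(1) by (simp add: field_simps)
      finally show ?thesis using u(2) by simp
    qed
    have "(F \<longlongrightarrow> F t) (at t)" unfolding F_def using t by (intro tendsto_intros) auto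
    moreover have "(G \<longlongrightarrow> G t) (at t)" unfolding G_def P_def using t by (intro tendsto_intros) auto
    moreover have "eventually (\<lambda>u. F u = G u) (at t)"
    proof -
      have "eventually (\<lambda>u. u \<noteq> 0) (at t)"
        using t by (intro tendsto_imp_eventually_ne[OF tendsto_ident_at])
      moreover have "eventually (\<lambda>u. u \<noteq> t) (at t)" by (rule eventually_neq_at_within)
      ultimately show ?thesis by eventually_elim (rule eq)
    qed
    ultimately have "F t = G t"
      using tendsto_unique[of "at t" F "F t" "G t"] tendsto_cong[of F G "at t" "G t"] by auto
    moreover have ti: "1 / t = t" using tt t by (simp add: field_simps)
    have "1 / t ^ n = t ^ n" unfolding power_one_over[symmetric] ti ..
    hence "G t = 2 * (1 / t ^ n * P t)" unfolding G_def ti using t by simp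
    moreover have "F t = - 2 * poly h (t + 1 / t)" unfolding F_def using t by simp
    ultimately have "(- 1 / 2) * (- 2 * poly h (t + 1 / t)) = (- 1 / 2) * (2 * (1 / t ^ n * P t))"
      using \<open>F t = G t\<close> by (simp only:)
    hence "poly h (t + 1 / t) = - (1 / t ^ n * P t)" by simp
    thus ?thesis by (simp add: P_def)
  qed
qed

lemma has_sum_gsum:
  fixes q :: complex
  assumes q: "q \<noteq> 0" "norm q < 1" and z: "\<And>k. k \<in> {1..n} \<Longrightarrow> z k \<noteq> 0"
    and conv: "norm (q * (\<Prod>j=1..2*n+2. b j)) < 1"
  shows "((\<lambda>y. (\<Prod>k=1..n. omega q n b (z k) (y k) * (1 / (z k * q powi y k) - z k * q powi y k))
        * vdm (map (\<lambda>k. z k * q powi y k + 1 / (z k * q powi y k)) [1..<Suc n]))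
      has_sum gsum q n b z) ({1..n} \<rightarrow>\<^sub>E UNIV)"
proof -
  have s: "csqrt q \<noteq> 0" "(csqrt q)\<^sup>2 = q" using q by auto
  have [simp]: "rdet [] = 1" by (simp add: rdet_def)
  show ?thesis
    using has_sum_omega_vdm[OF q s z, where b = b and Ts = "[]"] conv
    by (simp add: norm_mult mult.commute del: upt_Suc prod.cl_ivl_Suc)
qed

text \<open>With t = q b_j0 the extra factor is t ((t + 1/t) - (u + 1/u)): rescaling one parameter
  amounts to inserting one node.\<close>

lemma omega_rescale_parameter:
  fixes q z :: complex and y :: int
  assumes q: "norm q < 1" and j0: "j0 \<in> {1..2*n+2}"
  defines "u \<equiv> z * q powi y"
  shows "omega q n b z y = omega q n (b(j0 := q * b j0)) z y * ((1 - q * b j0 * u) * (1 - q * b j0 / u))"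
proof -
  let ?b = "b(j0 := q * b j0)"
  have "qpoch_inf q (q * b j * u) * qpoch_inf q (q * b j / u)
    = (qpoch_inf q (q * ?b j * u) * qpoch_inf q (q * ?b j / u))
      * (if j = j0 then (1 - q * b j0 * u) * (1 - q * b j0 / u) else 1)" for j
    using qpoch_inf_rec[OF q, of "q * b j * u"] qpoch_inf_rec[OF q, of "q * b j / u"] by (simp add: mult_ac)
  hence "(\<Prod>j=1..2*n+2. qpoch_inf q (q * b j * u) * qpoch_inf q (q * b j / u))
    = (\<Prod>j=1..2*n+2. (qpoch_inf q (q * ?b j * u) * qpoch_inf q (q * ?b j / u))
      * (if j = j0 then (1 - q * b j0 * u) * (1 - q * b j0 / u) else 1))"
    by (intro prod.cong refl)
  also have "\<dots> = (\<Prod>j=1..2*n+2. qpoch_inf q (q * ?b j * u) * qpoch_inf q (q * ?b j / u))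
      * (\<Prod>j=1..2*n+2. if j = j0 then (1 - q * b j0 * u) * (1 - q * b j0 / u) else 1)"
    by (rule prod.distrib)
  also have "(\<Prod>j=1..2*n+2. if j = j0 then (1 - q * b j0 * u) * (1 - q * b j0 / u) else 1)
      = (1 - q * b j0 * u) * (1 - q * b j0 / u)"
    using j0 by (subst prod.delta) (auto simp del: prod.cl_ivl_Suc)
  finally show ?thesis unfolding omega_def u_def[symmetric] by (simp only: mult.assoc)
qed

lemma prod_rescale_parameter:
  fixes q :: complex
  assumes "j0 \<in> A" "finite A"
  shows "prod (b(j0 := q * b j0)) A = q * prod b A"
  using assms by (subst (1 2) prod.remove[of A j0]) (auto intro!: prod.cong)

text \<open>The series for \<open>b\<close> is, up to t^n, the series for the rescaled parameters
  \<open>c\<close> with the node T = t + 1/t inserted, t = q b_j0. \<open>has_sum_omega_vdm\<close>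
  evaluates the latter through a single polynomial \<open>h\<close> of index 0: its top coefficient
  is (product of the c_j) - 1, and its value at T is explicit because t is one of the c_j. The
  convergence condition for one insertion at \<open>c\<close> is exactly
  \<open>conv\<close>.\<close>

lemma gsum_step:
  fixes q :: complex
  assumes q: "q \<noteq> 0" "norm q < 1" and z: "\<And>k. k \<in> {1..n} \<Longrightarrow> z k \<noteq> 0"
    and j0: "j0 \<in> {1..2*n+2}"
    and conv: "norm (q * (\<Prod>j=1..2*n+2. b j)) < 1"
  shows "gsum q n b z * (1 - q * (\<Prod>j=1..2*n+2. b j))
       = gsum q n (b(j0 := q * b j0)) z * (\<Prod>j\<in>{1..2*n+2} - {j0}. 1 - q * b j0 * b j)"
proof (cases "b j0 = 0")
  \<comment> \<open>A zero parameter is fixed by rescaling, and both correction factors are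
    1.\<close>
  case True
  hence "b(j0 := q * b j0) = b" by auto
  moreover have "(\<Prod>j=1..2*n+2. b j) = 0" using True j0 by (intro prod_zero) auto
  ultimately show ?thesis using True by simp
next
  case False
  define t where "t = q * b j0"
  define c where "c = b(j0 := t)"
  define T where "T = t + 1 / t"
  have t0: "t \<noteq> 0" using False q by (simp add: t_def)
  have pc: "(\<Prod>j=1..2*n+2. c j) = q * (\<Prod>j=1..2*n+2. b j)"
    unfolding c_def t_def by (rule prod_rescale_parameter[OF j0]) simp
  define s where "s = csqrt q"
  have s: "s \<noteq> 0" "s\<^sup>2 = q" using q by (auto simp: s_def)
  obtain h where h: "degree h \<le> n + 0" "coeff h (n + 0) = ((\<Prod>j=1..2*n+2. c j) - q ^ 0) / s ^ 0"
    "\<And>u. u \<noteq> 0 \<Longrightarrow> poly h (u + 1 / u) * (1 / u - u)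
        = u ^ (n + 1) * (\<Prod>j=1..2*n+2. 1 - c j / u) * (u * s + 1 / (u * s)) ^ 0
        - 1 / u ^ (n + 1) * (\<Prod>j=1..2*n+2. 1 - c j * u) * (u / s + s / u) ^ 0"
    using lowering_poly[OF s, of n 0 c] by blast
  define X where "X y k = z k * q powi y k + 1 / (z k * q powi y k)" for y k
  define wt where "wt b y k = omega q n b (z k) (y k) * (1 / (z k * q powi y k) - z k * q powi y k)" for b y k
  have 1: "((\<lambda>y. (\<Prod>k=1..n. wt c y k) * vdm (map (X y) [1..<Suc n] @ [T]) * ((\<Prod>j=1..2*n+2. c j) - 1))
      has_sum (gsum q n c z * poly h T)) ({1..n} \<rightarrow>\<^sub>E UNIV)"
  proof -
    have "rdet [\<lambda>i. poly h T] = poly h T"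
      unfolding rdet_def by (subst det_single) auto
    have cT: "norm (\<Prod>j=1..2*n+2. c j) * norm q < norm q ^ length [T]"
      unfolding pc using conv q by (simp del: prod.cl_ivl_Suc)
    have "((\<lambda>y. (\<Prod>k=1..n. omega q n c (z k) (y k) * (1 / (z k * q powi y k) - z k * q powi y k))
        * vdm (map (\<lambda>k. z k * q powi y k + 1 / (z k * q powi y k)) [1..<Suc n] @ [T])
        * (\<Prod>i<length [T]. coeff h (n + i)))
      has_sum (gsum q n c z * rdet (map (\<lambda>x i. poly h x) [T]))) ({1..n} \<rightarrow>\<^sub>E UNIV)"
    proof (rule has_sum_omega_vdm[OF q s _ cT])
      fix i u assume i: "i < length [T]" and u: "u \<noteq> (0 :: complex)"
      from i have "i = 0" by simp
      show "poly h (u + 1 / u) * (1 / u - u)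
        = u ^ (n + 1) * (\<Prod>j=1..2*n+2. 1 - c j / u) * (u * s + 1 / (u * s)) ^ i
        - 1 / u ^ (n + 1) * (\<Prod>j=1..2*n+2. 1 - c j * u) * (u / s + s / u) ^ i"
        unfolding \<open>i = 0\<close> by (rule h(3)[OF u])
    qed (use h(1) z in auto)
    moreover have "(\<Prod>i<length [T]. coeff h (n + i)) = (\<Prod>j=1..2*n+2. c j) - 1"
      using h(2) by simp
    ultimately show ?thesis unfolding wt_def X_def by (simp only: list.map \<open>rdet [\<lambda>i. poly h T] = poly h T\<close>)
  qed
  have wt: "(\<Prod>k=1..n. wt b y k) = (\<Prod>k=1..n. wt c y k) * (t ^ n * (\<Prod>k=1..n. T - X y k))" for y
  proof -
    have "wt b y k = wt c y k * (t * (T - X y k))" if "k \<in> {1..n}" for k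
    proof -
      let ?u = "z k * q powi y k"
      have u: "?u \<noteq> 0" using z[OF that] q by simp
      have "(1 - t * ?u) * (1 - t / ?u) = t * (T - X y k)"
        unfolding T_def X_def using u t0 by (simp add: field_simps)
      thus ?thesis using omega_rescale_parameter[OF q(2) j0, of b "z k" "y k"]
        unfolding wt_def c_def t_def by simp
    qed
    hence "(\<Prod>k=1..n. wt b y k) = (\<Prod>k=1..n. wt c y k * (t * (T - X y k)))" by (intro prod.cong refl)
    thus ?thesis by (simp add: prod.distrib)
  qed
  have vdm_T: "vdm (map (X y) [1..<Suc n] @ [T]) = vdm (map (X y) [1..<Suc n]) * (\<Prod>k=1..n. T - X y k)" for y
  proof -
    have "(\<Prod>i<length (map (X y) [1..<Suc n]). T - map (X y) [1..<Suc n] ! i) = (\<Prod>k=1..n. T - X y k)"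
      by (rule prod.reindex_bij_witness[of _ "\<lambda>k. k - 1" Suc]) (auto simp del: upt_Suc)
    thus ?thesis unfolding vdm_snoc by simp
  qed
  have 2: "((\<lambda>y. (\<Prod>k=1..n. wt b y k) * vdm (map (X y) [1..<Suc n])) has_sum gsum q n b z) ({1..n} \<rightarrow>\<^sub>E UNIV)"
    using has_sum_gsum[OF q z conv] unfolding wt_def X_def .
  have "((\<lambda>y. ((\<Prod>k=1..n. wt b y k) * vdm (map (X y) [1..<Suc n])) * (((\<Prod>j=1..2*n+2. c j) - 1) / t ^ n))
      has_sum (gsum q n b z * (((\<Prod>j=1..2*n+2. c j) - 1) / t ^ n))) ({1..n} \<rightarrow>\<^sub>E UNIV)"
    by (rule has_sum_cmult_left[OF 2])
  moreover have "((\<Prod>k=1..n. wt b y k) * vdm (map (X y) [1..<Suc n])) * (((\<Prod>j=1..2*n+2. c j) - 1) / t ^ n)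
     = (\<Prod>k=1..n. wt c y k) * vdm (map (X y) [1..<Suc n] @ [T]) * ((\<Prod>j=1..2*n+2. c j) - 1)" for y
    unfolding wt vdm_T using t0 by (simp add: field_simps del: upt_Suc prod.cl_ivl_Suc)
  ultimately have "gsum q n b z * (((\<Prod>j=1..2*n+2. c j) - 1) / t ^ n) = gsum q n c z * poly h T"
    using has_sum_unique[OF _ 1] by simp
  also have "poly h T = - (1 / t ^ n) * (\<Prod>j\<in>{1..2*n+2} - {j0}. 1 - c j * t)"
    unfolding T_def using h(3) j0 by (intro lowered_constant_at_parameter[OF t0 j0]) (simp_all add: c_def del: prod.cl_ivl_Suc)
  also have "(\<Prod>j\<in>{1..2*n+2} - {j0}. 1 - c j * t) = (\<Prod>j\<in>{1..2*n+2} - {j0}. 1 - q * b j0 * b j)"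
    by (intro prod.cong refl) (auto simp: c_def t_def)
  finally have E: "gsum q n b z * (((\<Prod>j=1..2*n+2. c j) - 1) / t ^ n)
    = gsum q n c z * (- (1 / t ^ n) * (\<Prod>j\<in>{1..2*n+2} - {j0}. 1 - q * b j0 * b j))" .
  have "x * (1 - C) = - w * (x * ((C - 1) / w))" if "w \<noteq> 0" for x C w :: complex
    using that by (simp add: field_simps)
  hence "gsum q n b z * (1 - (\<Prod>j=1..2*n+2. c j))
      = (- (t ^ n)) * (gsum q n b z * (((\<Prod>j=1..2*n+2. c j) - 1) / t ^ n))"
    using t0 by simp
  also have "\<dots> = gsum q n c z * (\<Prod>j\<in>{1..2*n+2} - {j0}. 1 - q * b j0 * b j)"
    unfolding E using t0 by simp
  finally show ?thesis unfolding pc unfolding c_def t_def .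
qed

text \<open>One factor \<open>G\<close> is carried for both quantities, instead of their quotient,
  because \<open>pairs_inf\<close> may vanish. Each \<open>gsum_step\<close> multiplies
  \<open>G\<close> by the same product as \<open>pairs_inf_step\<close>.\<close>

lemma gsum_rescale_upto:
  fixes q :: complex
  assumes q: "q \<noteq> 0" "norm q < 1" and z: "\<And>k. k \<in> {1..n} \<Longrightarrow> z k \<noteq> 0"
    and conv: "norm (q * (\<Prod>j=1..2*n+2. b j)) < 1" and l: "l \<le> 2 * n + 2"
  defines "B \<equiv> \<lambda>b. \<Prod>j=1..2*n+2. b j :: complex"
  defines "F \<equiv> \<lambda>b. gsum q n b z * qpoch_inf q (q * B b)"
  defines "b' \<equiv> \<lambda>j. if j \<in> {1..l} then q * b j else b j"
  shows "norm (q * B b') < 1 \<and> (\<exists>G. F b = G * F b' \<and> pairs_inf q (2*n+2) b = G * pairs_inf q (2*n+2) b')"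
  using l unfolding b'_def
proof (induction l)
  case 0
  show ?case using conv by (auto simp: B_def intro!: exI[of _ 1])
next
  case (Suc l)
  define c where "c = (\<lambda>j. if j \<in> {1..l} then q * b j else b j)"
  from Suc obtain G where G: "F b = G * F c" "pairs_inf q (2*n+2) b = G * pairs_inf q (2*n+2) c"
    and conv': "norm (q * B c) < 1" unfolding c_def by auto
  have l: "Suc l \<in> {1..2*n+2}" using Suc.prems by auto
  define d where "d = c(Suc l := q * c (Suc l))"
  have d: "d = (\<lambda>j. if j \<in> {1..Suc l} then q * b j else b j)"
    unfolding d_def c_def by (rule ext) auto
  let ?P = "\<Prod>j\<in>{1..2*n+2} - {Suc l}. 1 - q * c (Suc l) * c j"
  have Bd: "B d = q * B c" unfolding B_def d_def by (rule prod_rescale_parameter[OF l]) simp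
  have "F c = ?P * F d"
    using gsum_step[OF q z l conv'[unfolded B_def]] qpoch_inf_rec[OF q(2), of "q * B c"]
    unfolding F_def Bd unfolding d_def[symmetric] B_def by (simp add: mult_ac)
  moreover have "pairs_inf q (2*n+2) c = ?P * pairs_inf q (2*n+2) d"
    using pairs_inf_step[OF q(2) l, of c] unfolding d_def by (simp add: mult.commute)
  moreover have "norm (q * B d) < 1"
  proof -
    have "norm (q * B d) = norm q * norm (q * B c)" by (simp add: Bd norm_mult)
    also have "\<dots> \<le> 1 * norm (q * B c)" using q(2) by (intro mult_right_mono) auto
    finally show ?thesis using conv' by simp
  qed
  ultimately show ?case unfolding d[symmetric] using G by (auto intro!: exI[of _ "G * ?P"])
qed

lemma gsum_rescale:
  fixes q :: complex
  assumes q: "q \<noteq> 0" "norm q < 1" and z: "\<And>k. k \<in> {1..n} \<Longrightarrow> z k \<noteq> 0"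
    and conv: "norm (q * (\<Prod>j=1..2*n+2. b j)) < 1"
  defines "B \<equiv> \<lambda>b. \<Prod>j=1..2*n+2. b j :: complex"
  defines "F \<equiv> \<lambda>b. gsum q n b z * qpoch_inf q (q * B b)"
  shows "F b * pairs_inf q (2*n+2) (\<lambda>j. q ^ K * b j) = F (\<lambda>j. q ^ K * b j) * pairs_inf q (2*n+2) b"
proof -
  have cong: "F f = F g \<and> pairs_inf q (2*n+2) f = pairs_inf q (2*n+2) g \<and> B f = B g" if "\<And>j. j \<in> {1..2*n+2} \<Longrightarrow> f j = g j" for f g
  proof -
    have B: "B f = B g" unfolding B_def using that by (intro prod.cong) auto
    have "omega q n f w y = omega q n g w y" for w y
      unfolding omega_def using that by (intro arg_cong2[of _ _ _ _ "(*)"] refl prod.cong) auto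
    hence "gsum q n f z = gsum q n g z" unfolding gsum_def wsum_def by simp
    moreover have "pairs_inf q (2*n+2) f = pairs_inf q (2*n+2) g"
      unfolding pairs_inf_def
    proof (intro prod.cong refl)
      fix k j assume "k \<in> {1..2*n+2}" "j \<in> {1..<k}"
      thus "qpoch_inf q (q * f j * f k) = qpoch_inf q (q * g j * g k)"
        using that[of j] that[of k] by simp
    qed
    ultimately show ?thesis using B by (simp add: F_def)
  qed
  have "norm (q * B (\<lambda>j. q ^ K * b j)) < 1 \<and> (\<exists>G. F b = G * F (\<lambda>j. q ^ K * b j) \<and>
      pairs_inf q (2*n+2) b = G * pairs_inf q (2*n+2) (\<lambda>j. q ^ K * b j))"
  proof (induction K)
    case 0
    show ?case using conv by (auto simp: B_def intro!: exI[of _ 1])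
  next
    case (Suc K)
    let ?c = "\<lambda>j. q ^ K * b j" and ?d = "\<lambda>j. q ^ Suc K * b j"
    let ?e = "\<lambda>j. if j \<in> {1..2*n+2} then q * ?c j else ?c j"
    from Suc obtain G where G: "F b = G * F ?c" "pairs_inf q (2*n+2) b = G * pairs_inf q (2*n+2) ?c"
      and conv': "norm (q * B ?c) < 1" by blast
    have ed: "F ?d = F ?e \<and> pairs_inf q (2*n+2) ?d = pairs_inf q (2*n+2) ?e \<and> B ?d = B ?e"
      by (rule cong) simp
    have *: "norm (q * B ?e) < 1 \<and> (\<exists>G. F ?c = G * F ?e \<and> pairs_inf q (2*n+2) ?c = G * pairs_inf q (2*n+2) ?e)"
      unfolding F_def B_def by (rule gsum_rescale_upto[OF q _ conv'[unfolded B_def] order.refl]) (rule z)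
    then obtain G' where "F ?c = G' * F ?e" "pairs_inf q (2*n+2) ?c = G' * pairs_inf q (2*n+2) ?e" by blast
    with G ed * show ?case by (intro conjI exI[of _ "G * G'"]) (simp_all only: mult.assoc)
  qed
  then obtain G where "F b = G * F (\<lambda>j. q ^ K * b j)"
      "pairs_inf q (2*n+2) b = G * pairs_inf q (2*n+2) (\<lambda>j. q ^ K * b j)" by blast
  thus ?thesis by (simp only: mult_ac)
qed

text \<open>A majorant independent of \<open>K\<close>: base |q|, argument |z| and parameters -|b_j|
  turn every factor into 1 plus the norm of the subtracted term. It is itself an
  \<open>omega\<close>, so its summability is already known.\<close>

lemma norm_omega_le:
  fixes q z :: complex
  assumes q: "q \<noteq> 0" "norm q < 1"
  shows "norm (omega q n (\<lambda>j. q ^ K * b j) z y)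
    \<le> norm (omega (of_real (norm q)) n (\<lambda>j. - of_real (norm (b j))) (of_real (norm z)) y)"
proof -
  let ?q = "of_real (norm q) :: complex" and ?z = "of_real (norm z) :: complex"
  have qK: "norm q ^ K \<le> 1" using q by (intro power_le_one) auto
  have 1: "norm (qpoch_inf q (q * (q ^ K * b j) * (z * q powi y)))
      \<le> norm (qpoch_inf ?q (?q * (- of_real (norm (b j))) * (?z * ?q powi y)))" for j
  proof -
    have "norm (q * (q ^ K * b j) * (z * q powi y)) = norm q ^ K * norm (q * b j * (z * q powi y))"
      by (simp add: norm_mult norm_power)
    also have "\<dots> \<le> norm (q * b j * (z * q powi y))"
      using qK by (intro mult_left_le_one_le) auto
    finally have "norm (q * (q ^ K * b j) * (z * q powi y)) \<le> norm (q * b j * (z * q powi y))" .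
    from norm_qpoch_inf_le[OF q(2) this] show ?thesis
      by (simp add: norm_mult norm_power_int mult.assoc)
  qed
  have 2: "norm (qpoch_inf q (q * (q ^ K * b j) / (z * q powi y)))
      \<le> norm (qpoch_inf ?q (?q * (- of_real (norm (b j))) / (?z * ?q powi y)))" for j
  proof -
    have "norm (q * (q ^ K * b j) / (z * q powi y)) = norm q ^ K * norm (q * b j / (z * q powi y))"
      by (simp add: norm_mult norm_power norm_divide)
    also have "\<dots> \<le> norm (q * b j / (z * q powi y))"
      using qK by (intro mult_left_le_one_le) auto
    finally have "norm (q * (q ^ K * b j) / (z * q powi y)) \<le> norm (q * b j / (z * q powi y))" .
    from norm_qpoch_inf_le[OF q(2) this] show ?thesis
      by (simp add: norm_mult norm_divide norm_power_int)
  qed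
  show ?thesis
    unfolding omega_def norm_mult norm_power prod_norm[symmetric]
  proof (rule mult_mono)
    show "(norm (z powi (2 * y)) * norm (q powi (y * y))) ^ (n + 1)
      \<le> (norm (?z powi (2 * y)) * norm (?q powi (y * y))) ^ (n + 1)"
      by (simp add: norm_power_int)
    show "(\<Prod>j=1..2*n+2. norm (qpoch_inf q (q * (q ^ K * b j) * (z * q powi y))) * norm (qpoch_inf q (q * (q ^ K * b j) / (z * q powi y))))
      \<le> (\<Prod>j=1..2*n+2. norm (qpoch_inf ?q (?q * (- of_real (norm (b j))) * (?z * ?q powi y)))
          * norm (qpoch_inf ?q (?q * (- of_real (norm (b j))) / (?z * ?q powi y))))"
      by (intro prod_mono conjI mult_mono 1 2 mult_nonneg_nonneg norm_ge_zero)
    show "0 \<le> (norm (?z powi (2 * y)) * norm (?q powi (y * y))) ^ (n + 1)"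
      by (intro zero_le_power mult_nonneg_nonneg norm_ge_zero)
    show "0 \<le> (\<Prod>j=1..2*n+2. norm (qpoch_inf q (q * (q ^ K * b j) * (z * q powi y))) * norm (qpoch_inf q (q * (q ^ K * b j) / (z * q powi y))))"
      by (intro prod_nonneg mult_nonneg_nonneg norm_ge_zero)
  qed
qed

text \<open>Tannery's theorem on each of the two halves of the integers.\<close>

lemma infsum_int_dominated:
  fixes f :: "nat \<Rightarrow> int \<Rightarrow> complex"
  assumes lim: "\<And>y. (\<lambda>K. f K y) \<longlonglongrightarrow> g y"
    and bound: "\<And>K y. norm (f K y) \<le> D y" and D: "D summable_on UNIV"
  shows "(\<lambda>K. infsum (f K) UNIV) \<longlonglongrightarrow> infsum g UNIV"
proof -
  have D0: "norm (D y) = D y" for y using order_trans[OF norm_ge_zero bound[of 0 y]] by simp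
  have nD: "(\<lambda>y. norm (D y)) summable_on UNIV" unfolding D0 by (rule D)
  have nf: "(\<lambda>y. norm (f K y)) summable_on UNIV" for K
    by (rule summable_on_comparison_test[OF D bound]) simp
  have "norm (g y) \<le> D y" for y
    by (rule LIMSEQ_le_const2[OF tendsto_norm[OF lim]]) (use bound in blast)
  hence ng: "(\<lambda>y. norm (g y)) summable_on UNIV"
    by (intro summable_on_comparison_test[OF D]) simp_all
  have a: "(\<lambda>K. \<Sum>k. f K (int k)) \<longlonglongrightarrow> (\<Sum>k. g (int k))"
    by (rule tannerys_theorem[where M = "\<lambda>k. D (int k)", THEN conjunct2, THEN conjunct2])
      (use lim bound infsum_int_split(2)[OF nD] D0 in \<open>auto intro!: always_eventually\<close>)
  have b: "(\<lambda>K. \<Sum>k. f K (- int (Suc k))) \<longlonglongrightarrow> (\<Sum>k. g (- int (Suc k)))"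
    by (rule tannerys_theorem[where M = "\<lambda>k. D (- int (Suc k))", THEN conjunct2, THEN conjunct2])
      (use lim bound infsum_int_split(3)[OF nD] D0 in \<open>auto intro!: always_eventually simp del: of_nat_Suc\<close>)
  show ?thesis
    unfolding infsum_int_split(1)[OF nf] infsum_int_split(1)[OF ng] by (rule tendsto_add[OF a b])
qed

lemma wsum_rescale_tendsto:
  fixes q z :: complex
  assumes q: "q \<noteq> 0" "norm q < 1" and z: "z \<noteq> 0"
    and conv: "norm (q * (\<Prod>j=1..2*n+2. b j)) < 1" and i: "i < n"
  shows "(\<lambda>K. wsum q n (\<lambda>j. q ^ K * b j) z (Polynomial.monom 1 i)) \<longlonglongrightarrow> wsum q n (\<lambda>_. 0) z (Polynomial.monom 1 i)"
  unfolding wsum_def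
proof (rule infsum_int_dominated)
  let ?q = "of_real (norm q) :: complex" and ?z = "of_real (norm z) :: complex" and ?b = "\<lambda>j. - of_real (norm (b j)) :: complex"
  let ?u = "\<lambda>y. z * q powi y" and ?v = "\<lambda>y. ?z * ?q powi y"
  \<comment> \<open>With v = |u|, 1/u - u is bounded by 1/v + v and u + 1/u by v + 1/v. The two
    terms are kept apart because \<open>summable_omega\<close> handles one power of u at a
    time.\<close>
  define D where "D y = norm (omega ?q n ?b ?z y * ?v y powi (- 1) * (?v y + 1 / ?v y) ^ i)
     + norm (omega ?q n ?b ?z y * ?v y powi 1 * (?v y + 1 / ?v y) ^ i)" for y
  have B: "norm (\<Prod>j=1..2*n+2. ?b j) * norm ?q ^ (n + 1) < norm ?q ^ n"
  proof -
    have "norm (\<Prod>j=1..2*n+2. ?b j) * norm ?q ^ (n + 1) = norm q ^ n * norm (q * (\<Prod>j=1..2*n+2. b j))"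
      unfolding norm_mult prod_norm[symmetric] by (simp add: mult_ac del: prod.cl_ivl_Suc)
    also have "\<dots> < norm q ^ n * 1" using conv q by (intro mult_strict_left_mono) auto
    finally show ?thesis by simp
  qed
  show "D summable_on UNIV"
    unfolding D_def
    by (intro summable_on_add summable_on_iff_abs_summable_on_complex[THEN iffD1] summable_omega[OF _ _ _ B])
      (use q z i in auto)
  show "norm (omega q n (\<lambda>j. q ^ K * b j) z y * (1 / ?u y - ?u y) * poly (Polynomial.monom 1 i) (?u y + 1 / ?u y)) \<le> D y" for K y
  proof -
    have nu: "norm (?u y) = norm (?v y)" by (simp add: norm_mult norm_power_int)
    have v: "?v y = of_real (norm (?u y))" by (simp add: norm_mult norm_power_int)
    have nv: "norm (?v y + 1 / ?v y) = norm (?u y) + 1 / norm (?u y)"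
    proof -
      have "?v y + 1 / ?v y = of_real (norm (?u y) + 1 / norm (?u y))" unfolding v by simp
      thus ?thesis by (simp only: norm_of_real) simp
    qed
    have "norm (1 / ?u y - ?u y) \<le> norm (?v y powi (- 1)) + norm (?v y powi 1)"
    proof -
      have "norm (?v y powi (- 1)) = norm (1 / ?u y)"
        by (simp only: power_int_minus power_int_1_right norm_inverse nu[symmetric] norm_divide norm_one inverse_eq_divide)
      moreover have "norm (?v y powi 1) = norm (?u y)" by (simp only: power_int_1_right nu)
      ultimately show ?thesis using norm_triangle_ineq4[of "1 / ?u y" "?u y"] by (simp only:)
    qed
    moreover have "norm (?u y + 1 / ?u y) \<le> norm (?v y + 1 / ?v y)"
      unfolding nv using norm_triangle_ineq[of "?u y" "1 / ?u y"] by (simp add: norm_divide)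
    ultimately have "norm (omega q n (\<lambda>j. q ^ K * b j) z y) * norm (1 / ?u y - ?u y) * norm (?u y + 1 / ?u y) ^ i
      \<le> norm (omega ?q n ?b ?z y) * (norm (?v y powi (- 1)) + norm (?v y powi 1)) * norm (?v y + 1 / ?v y) ^ i"
      by (intro mult_mono power_mono norm_omega_le q) (auto intro!: mult_nonneg_nonneg add_nonneg_nonneg)
    also have "\<dots> = D y" by (simp only: D_def norm_mult norm_power ring_distribs)
    finally show ?thesis by (simp only: norm_mult norm_power poly_monom mult_1_left)
  qed
  show "(\<lambda>K. omega q n (\<lambda>j. q ^ K * b j) z y * (1 / ?u y - ?u y) * poly (Polynomial.monom 1 i) (?u y + 1 / ?u y))
    \<longlonglongrightarrow> omega q n (\<lambda>_. 0) z y * (1 / ?u y - ?u y) * poly (Polynomial.monom 1 i) (?u y + 1 / ?u y)" for y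
  proof -
    have qK: "(\<lambda>K. q * (q ^ K * b j) * x) \<longlonglongrightarrow> 0" for j x
    proof -
      have "(\<lambda>K. q * (q ^ K * b j) * x) \<longlonglongrightarrow> q * (0 * b j) * x"
        by (intro tendsto_intros LIMSEQ_power_zero q)
      thus ?thesis by simp
    qed
    have a: "(\<lambda>K. qpoch_inf q (q * (q ^ K * b j) * x)) \<longlonglongrightarrow> qpoch_inf q (q * 0 * x)" for j x
      using tendsto_qpoch_inf_1[OF q(2) qK[of j x]] by (simp add: qpoch_inf_def)
    have b: "(\<lambda>K. qpoch_inf q (q * (q ^ K * b j) / x)) \<longlonglongrightarrow> qpoch_inf q (q * 0 / x)" for j x
      using a[of j "inverse x"] by (simp only: divide_inverse)
    show ?thesis unfolding omega_def by (intro tendsto_mult tendsto_const tendsto_prod a b)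
  qed
qed

text \<open>In \<open>gsum_rescale\<close> let \<open>K\<close> tend to infinity:
  \<open>pairs_inf\<close> and the infinite product at the rescaled parameters both tend to 1, and
  \<open>gsum\<close> tends to its value at zero parameters, entry by entry in the
  determinant.\<close>

lemma gsum_eq_pairs_inf:
  fixes q :: complex
  assumes q: "q \<noteq> 0" "norm q < 1" and z: "\<And>k. k \<in> {1..n} \<Longrightarrow> z k \<noteq> 0"
    and conv: "norm (q * (\<Prod>j=1..2*n+2. b j)) < 1"
  shows "gsum q n b z * qpoch_inf q (q * (\<Prod>j=1..2*n+2. b j)) = pairs_inf q (2*n+2) b * gsum q n (\<lambda>_. 0) z"
proof -
  let ?c = "\<lambda>K j. q ^ K * b j"
  have q0: "(\<lambda>K. q ^ K) \<longlonglongrightarrow> 0" by (rule LIMSEQ_power_zero[OF q(2)])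
  have lim0: "(\<lambda>K. q * ?c K j * ?c K k) \<longlonglongrightarrow> 0" for j k
  proof -
    have "(\<lambda>K. q * ?c K j * ?c K k) \<longlonglongrightarrow> q * (0 * b j) * (0 * b k)"
      by (intro tendsto_intros q0)
    thus ?thesis by simp
  qed
  have "(\<lambda>K. pairs_inf q (2*n+2) (?c K)) \<longlonglongrightarrow> (\<Prod>k=1..2*n+2. \<Prod>j=1..<k. 1)"
    unfolding pairs_inf_def by (intro tendsto_prod tendsto_qpoch_inf_1 q lim0)
  hence l1: "(\<lambda>K. pairs_inf q (2*n+2) (?c K)) \<longlonglongrightarrow> 1" by simp
  have "(\<lambda>K. q * (\<Prod>j=1..2*n+2. ?c K j)) \<longlonglongrightarrow> q * (\<Prod>j=1..2*n+2. 0 * b j)"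
    by (intro tendsto_intros q0)
  hence "(\<lambda>K. q * (\<Prod>j=1..2*n+2. ?c K j)) \<longlonglongrightarrow> 0" by simp
  hence l2: "(\<lambda>K. qpoch_inf q (q * (\<Prod>j=1..2*n+2. ?c K j))) \<longlonglongrightarrow> 1" by (rule tendsto_qpoch_inf_1[OF q(2)])
  have l3: "(\<lambda>K. gsum q n (?c K) z) \<longlonglongrightarrow> gsum q n (\<lambda>_. 0) z"
    unfolding gsum_def rdet_Leibniz length_map
  proof (intro tendsto_sum tendsto_mult tendsto_const tendsto_prod)
    fix p i assume p: "p \<in> {p. p permutes {0..<length [1..<Suc n]}}" and i: "i \<in> {0..<length [1..<Suc n]}"
    have "p i < n" using permutes_in_image[of p "{0..<n}" i] p i by (simp del: upt_Suc)
    moreover have "map F [1..<Suc n] ! i = F (Suc i)" for F :: "nat \<Rightarrow> nat \<Rightarrow> complex"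
      using i by (simp del: upt_Suc)
    moreover have "z (Suc i) \<noteq> 0" using i z by (simp del: upt_Suc)
    ultimately show "(\<lambda>K. (map (\<lambda>k i. wsum q n (?c K) (z k) (Polynomial.monom 1 i)) [1..<Suc n] ! i) (p i))
        \<longlonglongrightarrow> (map (\<lambda>k i. wsum q n (\<lambda>_. 0) (z k) (Polynomial.monom 1 i)) [1..<Suc n] ! i) (p i)"
      using wsum_rescale_tendsto[OF q _ conv] by (simp only:)
  qed
  have "(\<lambda>K. gsum q n b z * qpoch_inf q (q * (\<Prod>j=1..2*n+2. b j)) * pairs_inf q (2*n+2) (?c K))
     \<longlonglongrightarrow> gsum q n b z * qpoch_inf q (q * (\<Prod>j=1..2*n+2. b j)) * 1"
    by (intro tendsto_intros l1)
  moreover have "(\<lambda>K. gsum q n b z * qpoch_inf q (q * (\<Prod>j=1..2*n+2. b j)) * pairs_inf q (2*n+2) (?c K))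
     \<longlonglongrightarrow> gsum q n (\<lambda>_. 0) z * 1 * pairs_inf q (2*n+2) b"
  proof -
    have "gsum q n b z * qpoch_inf q (q * (\<Prod>j=1..2*n+2. b j)) * pairs_inf q (2*n+2) (?c K)
       = gsum q n (?c K) z * qpoch_inf q (q * (\<Prod>j=1..2*n+2. ?c K j)) * pairs_inf q (2*n+2) b" for K
      by (rule gsum_rescale[OF q z conv])
    thus ?thesis by (simp only:) (intro tendsto_mult l2 l3 tendsto_const)
  qed
  ultimately show ?thesis using LIMSEQ_unique by (fastforce simp: mult.commute)
qed

section \<open>Parameters at which the series reduces to one term\<close>

lemma prod_split_2n2:
  fixes g :: "nat \<Rightarrow> complex"
  shows "(\<Prod>j=1..2*n+2. g j) = (\<Prod>j=1..n. g j) * (\<Prod>j=1..n. g (n + j)) * (g (2*n+1) * g (2*n+2))"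
proof -
  have "(\<Prod>j=1..2*n+2. g j) = (\<Prod>j=1..2*n. g j) * (g (2*n+1) * g (2*n+2))"
    by simp
  also have "(\<Prod>j=1..2*n. g j) = (\<Prod>j=1..n. g j) * (\<Prod>j=n+1..n+n. g j)"
    unfolding mult_2 by (rule prod.ub_add_nat) simp
  also have "(\<Prod>j=n+1..n+n. g j) = (\<Prod>j=1..n. g (n + j))"
    by (rule prod.reindex_bij_witness[of _ "\<lambda>j. n + j" "\<lambda>j. j - n"]) auto
  finally show ?thesis .
qed

lemma prod_square_symmetric:
  fixes g :: "nat \<Rightarrow> nat \<Rightarrow> complex"
  assumes sym: "\<And>j k. g j k = g k j"
  shows "(\<Prod>k=1..n. \<Prod>j=1..n. g j k) = (\<Prod>k=1..n. \<Prod>j=1..k. g j k) * (\<Prod>k=1..n. \<Prod>j=1..<k. g j k)"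
proof (induction n)
  case (Suc n)
  have "(\<Prod>k=1..Suc n. \<Prod>j=1..Suc n. g j k)
      = (\<Prod>k=1..n. (\<Prod>j=1..n. g j k) * g (Suc n) k) * (\<Prod>j=1..Suc n. g j (Suc n))"
    by simp
  also have "\<dots> = (\<Prod>k=1..n. \<Prod>j=1..n. g j k) * (\<Prod>k=1..n. g (Suc n) k) * (\<Prod>j=1..Suc n. g j (Suc n))"
    by (simp only: prod.distrib)
  also have "(\<Prod>k=1..n. g (Suc n) k) = (\<Prod>j=1..<Suc n. g j (Suc n))"
    by (intro prod.cong) (auto intro: sym)
  finally show ?case unfolding Suc by (simp add: mult_ac)
qed simp

text \<open>The entries 1/z_j kill the terms with some y_k < 0 and the entries z_j those with some
  y_k > 0. The two zeros make the product of the parameters 0, so convergence is automatic and the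
  infinite product in the evaluation equals 1.\<close>

definition special :: "nat \<Rightarrow> (nat \<Rightarrow> complex) \<Rightarrow> nat \<Rightarrow> complex" where
  "special n z j = (if j \<le> n then 1 / z j else if j \<le> 2 * n then z (j - n) else 0)"

lemma qpoch_inf_0: "qpoch_inf q 0 = 1"
  by (simp add: qpoch_inf_def)

lemma prod_special: "(\<Prod>j=1..2*n+2. special n z j) = 0"
  by (rule prod_zero) (auto intro!: bexI[of _ "2*n+2"] simp: special_def)

text \<open>Pairs inside the first block give q/(z_j z_k), pairs across the blocks q z_k/z_j (with j
  = k included), pairs inside the second q z_j z_k; pairs containing a zero parameter give
  1.\<close>

lemma pairs_inf_special:
  "pairs_inf q (2*n+2) (special n z)
     = (\<Prod>k=1..n. \<Prod>j=1..<k. qpoch_inf q (q / (z j * z k))) * (\<Prod>j=1..n. \<Prod>k=1..n. qpoch_inf q (q * z k / z j))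
       * (\<Prod>k=1..n. \<Prod>j=1..<k. qpoch_inf q (q * z j * z k))"
proof -
  let ?s = "special n z"
  let ?f = "\<lambda>k. \<Prod>j=1..<k. qpoch_inf q (q * ?s j * ?s k)"
  have 1: "(\<Prod>k=1..n. ?f k) = (\<Prod>k=1..n. \<Prod>j=1..<k. qpoch_inf q (q / (z j * z k)))"
    by (intro prod.cong refl) (auto simp: special_def)
  have 2: "?f (n + k) = (\<Prod>j=1..n. qpoch_inf q (q * z k / z j)) * (\<Prod>j=1..<k. qpoch_inf q (q * z j * z k))"
    if k: "k \<in> {1..n}" for k
  proof -
    have "?f (n + k) = (\<Prod>j\<in>{1..n} \<union> {n+1..<n+k}. qpoch_inf q (q * ?s j * ?s (n + k)))"
      using k by (intro prod.cong) auto
    also have "\<dots> = (\<Prod>j\<in>{1..n}. qpoch_inf q (q * ?s j * ?s (n + k))) * (\<Prod>j\<in>{n+1..<n+k}. qpoch_inf q (q * ?s j * ?s (n + k)))"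
      by (rule prod.union_disjoint) auto
    also have "(\<Prod>j\<in>{1..n}. qpoch_inf q (q * ?s j * ?s (n + k))) = (\<Prod>j=1..n. qpoch_inf q (q * z k / z j))"
      using k by (intro prod.cong refl) (auto simp: special_def)
    also have "(\<Prod>j\<in>{n+1..<n+k}. qpoch_inf q (q * ?s j * ?s (n + k))) = (\<Prod>j=1..<k. qpoch_inf q (q * z j * z k))"
      using k by (intro prod.reindex_bij_witness[of _ "\<lambda>j. n + j" "\<lambda>j. j - n"]) (auto simp: special_def)
    finally show ?thesis .
  qed
  have 3: "?f (2*n+1) = 1" "?f (2*n+2) = 1"
    by (intro prod.neutral; auto simp: special_def qpoch_inf_0)+
  have "pairs_inf q (2*n+2) ?s = (\<Prod>k=1..n. ?f k) * (\<Prod>k=1..n. ?f (n + k))"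
    unfolding pairs_inf_def prod_split_2n2[of ?f] 3 by simp
  also have "(\<Prod>k=1..n. ?f (n + k)) = (\<Prod>k=1..n. (\<Prod>j=1..n. qpoch_inf q (q * z k / z j)) * (\<Prod>j=1..<k. qpoch_inf q (q * z j * z k)))"
    by (intro prod.cong refl 2)
  also have "\<dots> = (\<Prod>j=1..n. \<Prod>k=1..n. qpoch_inf q (q * z k / z j)) * (\<Prod>k=1..n. \<Prod>j=1..<k. qpoch_inf q (q * z j * z k))"
    unfolding prod.distrib by (subst prod.swap) (rule refl)
  finally show ?thesis unfolding 1 by (simp only: mult.assoc)
qed

text \<open>The symmetric squares over (j,k) split into their parts j <= k and j < k. The parts j <
  k, with one of the two copies of the product of (q z_k/z_j)_inf, form \<open>pairs_inf\<close>,
  ready to be cancelled in \<open>gsum_eval\<close>.\<close>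

lemma omega_special_0:
  "(\<Prod>k=1..n. omega q n (special n z) (z k) 0)
    = pairs_inf q (2*n+2) (special n z)
      * ((\<Prod>k=1..n. \<Prod>j=1..k. qpoch_inf q (q * z j * z k) * qpoch_inf q (q / (z j * z k)))
         * (\<Prod>j=1..n. \<Prod>k=1..n. qpoch_inf q (q * z k / z j)))"
proof -
  have "omega q n (special n z) (z k) 0
     = (\<Prod>j=1..n. qpoch_inf q (q * z k / z j)) * (\<Prod>j=1..n. qpoch_inf q (q / (z j * z k)))
      * ((\<Prod>j=1..n. qpoch_inf q (q * z j * z k)) * (\<Prod>j=1..n. qpoch_inf q (q * z j / z k)))" for k
  proof -
    have "omega q n (special n z) (z k) 0
       = (\<Prod>j=1..2*n+2. qpoch_inf q (q * special n z j * z k) * qpoch_inf q (q * special n z j / z k))"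
      by (simp add: omega_def del: prod.cl_ivl_Suc)
    also have "\<dots> = (\<Prod>j=1..n. qpoch_inf q (q * special n z j * z k) * qpoch_inf q (q * special n z j / z k))
       * (\<Prod>j=1..n. qpoch_inf q (q * special n z (n + j) * z k) * qpoch_inf q (q * special n z (n + j) / z k))"
      unfolding prod_split_2n2 by (simp add: special_def qpoch_inf_0)
    also have "(\<Prod>j=1..n. qpoch_inf q (q * special n z j * z k) * qpoch_inf q (q * special n z j / z k))
       = (\<Prod>j=1..n. qpoch_inf q (q * z k / z j) * qpoch_inf q (q / (z j * z k)))"
      by (intro prod.cong refl) (auto simp: special_def)
    also have "(\<Prod>j=1..n. qpoch_inf q (q * special n z (n + j) * z k) * qpoch_inf q (q * special n z (n + j) / z k))
       = (\<Prod>j=1..n. qpoch_inf q (q * z j * z k) * qpoch_inf q (q * z j / z k))"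
      by (intro prod.cong refl) (auto simp: special_def)
    finally show ?thesis unfolding prod.distrib .
  qed
  hence "(\<Prod>k=1..n. omega q n (special n z) (z k) 0)
     = (\<Prod>k=1..n. \<Prod>j=1..n. qpoch_inf q (q * z k / z j)) * (\<Prod>k=1..n. \<Prod>j=1..n. qpoch_inf q (q / (z j * z k)))
      * ((\<Prod>k=1..n. \<Prod>j=1..n. qpoch_inf q (q * z j * z k)) * (\<Prod>k=1..n. \<Prod>j=1..n. qpoch_inf q (q * z j / z k)))"
    by (simp only: prod.distrib)
  also have "(\<Prod>k=1..n. \<Prod>j=1..n. qpoch_inf q (q * z k / z j)) = (\<Prod>j=1..n. \<Prod>k=1..n. qpoch_inf q (q * z k / z j))"
    by (rule prod.swap)
  also have "(\<Prod>k=1..n. \<Prod>j=1..n. qpoch_inf q (q / (z j * z k)))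
     = (\<Prod>k=1..n. \<Prod>j=1..k. qpoch_inf q (q / (z j * z k))) * (\<Prod>k=1..n. \<Prod>j=1..<k. qpoch_inf q (q / (z j * z k)))"
    by (rule prod_square_symmetric) (simp add: mult.commute)
  also have "(\<Prod>k=1..n. \<Prod>j=1..n. qpoch_inf q (q * z j * z k))
     = (\<Prod>k=1..n. \<Prod>j=1..k. qpoch_inf q (q * z j * z k)) * (\<Prod>k=1..n. \<Prod>j=1..<k. qpoch_inf q (q * z j * z k))"
    by (rule prod_square_symmetric) (simp add: mult_ac)
  finally show ?thesis unfolding pairs_inf_special prod.distrib by (simp only: mult_ac)
qed

text \<open>For y < 0 the argument q (1/z_k) u equals q^(1+y), for y > 0 the argument q z_k/u equals
  q^(1-y). Either exponent is at most 0, so one factor of the infinite product vanishes.\<close>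

lemma omega_special_eq_0:
  assumes q: "q \<noteq> 0" "norm q < 1" and k: "k \<in> {1..n}" "z k \<noteq> 0" and y: "y \<noteq> 0"
  shows "omega q n (special n z) (z k) y = 0"
proof -
  have "\<exists>j\<in>{1..2*n+2}. qpoch_inf q (q * special n z j * (z k * q powi y)) * qpoch_inf q (q * special n z j / (z k * q powi y)) = 0"
  proof (cases "y < 0")
    case True
    have "q * special n z k * (z k * q powi y) = q powi (1 + y)"
      using k q by (simp add: special_def power_int_add)
    moreover have "q powi (1 + y) * q ^ nat (- 1 - y) = q powi ((1 + y) + int (nat (- 1 - y)))"
      using power_int_add[OF disjI1[OF q(1)], of "1 + y" "int (nat (- 1 - y))"] by (simp only: power_int_of_nat)
    hence "q powi (1 + y) * q ^ nat (- 1 - y) = 1" using True by simp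
    ultimately have "qpoch_inf q (q * special n z k * (z k * q powi y)) = 0"
      unfolding qpoch_inf_eq_0_iff[OF q(2)] by metis
    thus ?thesis using k by (intro bexI[of _ k]) auto
  next
    case False
    hence y: "y > 0" using y by simp
    have "q * special n z (n + k) / (z k * q powi y) = q powi (1 - y)"
      using k q by (simp add: special_def power_int_diff)
    moreover have "q powi (1 - y) * q ^ nat (y - 1) = q powi ((1 - y) + int (nat (y - 1)))"
      using power_int_add[OF disjI1[OF q(1)], of "1 - y" "int (nat (y - 1))"] by (simp only: power_int_of_nat)
    hence "q powi (1 - y) * q ^ nat (y - 1) = 1" using y by simp
    ultimately have "qpoch_inf q (q * special n z (n + k) / (z k * q powi y)) = 0"
      unfolding qpoch_inf_eq_0_iff[OF q(2)] by metis
    thus ?thesis using k by (intro bexI[of _ "n + k"]) auto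
  qed
  hence "(\<Prod>j=1..2*n+2. qpoch_inf q (q * special n z j * (z k * q powi y)) * qpoch_inf q (q * special n z j / (z k * q powi y))) = 0"
    by (intro prod_zero) auto
  thus ?thesis unfolding omega_def by (simp only: mult_zero_right)
qed

lemma gsum_special:
  fixes q :: complex
  assumes q: "q \<noteq> 0" "norm q < 1" and z: "\<And>k. k \<in> {1..n} \<Longrightarrow> z k \<noteq> 0"
  shows "gsum q n (special n z) z = (\<Prod>k=1..n. omega q n (special n z) (z k) 0)
     * ((\<Prod>k=1..n. 1 / z k - z k) * vdm (map (\<lambda>k. z k + 1 / z k) [1..<Suc n]))"
proof -
  let ?T = "\<lambda>y. (\<Prod>k=1..n. omega q n (special n z) (z k) (y k) * (1 / (z k * q powi y k) - z k * q powi y k))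
        * vdm (map (\<lambda>k. z k * q powi y k + 1 / (z k * q powi y k)) [1..<Suc n])"
  define y0 :: "nat \<Rightarrow> int" where "y0 = restrict (\<lambda>_. 0) {1..n}"
  have y0: "y0 \<in> {1..n} \<rightarrow>\<^sub>E UNIV" "\<And>k. k \<in> {1..n} \<Longrightarrow> y0 k = 0" by (auto simp: y0_def)
  have zero: "?T y = 0" if y: "y \<in> {1..n} \<rightarrow>\<^sub>E UNIV" "y \<noteq> y0" for y
  proof -
    obtain k where k: "k \<in> {1..n}" "y k \<noteq> 0"
    proof (rule ccontr)
      assume "\<not> thesis"
      hence "\<And>k. k \<in> {1..n} \<Longrightarrow> y k = y0 k" using that y0(2) by auto
      hence "y = y0" using PiE_ext[OF y(1) y0(1)] by blast
      with y(2) show False by simp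
    qed
    have "(\<Prod>k=1..n. omega q n (special n z) (z k) (y k) * (1 / (z k * q powi y k) - z k * q powi y k)) = 0"
      using omega_special_eq_0[where z = z and k = k, OF q k(1) z[OF k(1)] k(2)] k(1) by (intro prod_zero) auto
    thus ?thesis by simp
  qed
  have "(?T has_sum gsum q n (special n z) z) ({1..n} \<rightarrow>\<^sub>E UNIV)"
    by (rule has_sum_gsum[OF q z]) (simp_all only: prod_special mult_zero_right norm_zero zero_less_one)
  moreover have "(?T has_sum ?T y0) ({1..n} \<rightarrow>\<^sub>E UNIV)"
    by (rule has_sum_finite_neutralI[of "{y0}"]) (use y0 zero in auto)
  ultimately have "gsum q n (special n z) z = ?T y0" by (rule has_sum_unique)
  also have "vdm (map (\<lambda>k. z k * q powi y0 k + 1 / (z k * q powi y0 k)) [1..<Suc n]) = vdm (map (\<lambda>k. z k + 1 / z k) [1..<Suc n])"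
    by (intro arg_cong[of _ _ vdm] map_cong refl) (auto simp: y0(2) simp del: upt_Suc)
  also have "(\<Prod>k=1..n. omega q n (special n z) (z k) (y0 k) * (1 / (z k * q powi y0 k) - z k * q powi y0 k))
     = (\<Prod>k=1..n. omega q n (special n z) (z k) 0 * (1 / z k - z k))"
    by (intro prod.cong refl) (simp add: y0(2))
  finally show ?thesis by (simp only: prod.distrib mult.assoc)
qed

text \<open>A vanishing factor of \<open>pairs_inf\<close> means z_j = q^r z_k or z_j z_k = q^r for
  distinct j, k. By \<open>wsum_shift_power\<close> and \<open>wsum_reflect\<close> the rows j and k
  of the determinant are then proportional.\<close>

lemma gsum_eq_0:
  fixes q :: complex
  assumes q: "q \<noteq> 0" "norm q < 1" and z: "\<And>k. k \<in> {1..n} \<Longrightarrow> z k \<noteq> 0"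
    and R0: "pairs_inf q (2*n+2) (special n z) = 0"
  shows "gsum q n b z = 0"
proof -
  have proportional: "gsum q n b z = 0" if jk: "j \<in> {1..n}" "k \<in> {1..n}" "j \<noteq> k"
    and c: "\<And>h. wsum q n b (z j) h = c * wsum q n b (z k) h" for j k c
    unfolding gsum_def
    by (rule rdet_proportional_rows[of "j - 1" _ "k - 1" c]) (use jk c in \<open>auto simp del: upt_Suc\<close>)
  have A: "gsum q n b z = 0" if jk: "j \<in> {1..n}" "k \<in> {1..n}" "j \<noteq> k" and e: "z j = q ^ r * z k" for j k r
  proof -
    obtain c where "\<And>h. wsum q n b (q ^ r * z k) h = c * wsum q n b (z k) h"
      using wsum_shift_power[OF q(1) z[OF jk(2)]] by blast
    thus ?thesis using proportional[OF jk] unfolding e by blast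
  qed
  have B: "gsum q n b z = 0" if jk: "j \<in> {1..n}" "k \<in> {1..n}" "j \<noteq> k" and e: "z j = q ^ r * (1 / z k)" for j k r
  proof -
    obtain c where "\<And>h. wsum q n b (q ^ r * (1 / z k)) h = c * wsum q n b (1 / z k) h"
      using wsum_shift_power[OF q(1), of "1 / z k" n b r] z[OF jk(2)] by auto
    hence "wsum q n b (z j) h = (- c) * wsum q n b (z k) h" for h
      unfolding e wsum_reflect[OF q(1) z[OF jk(2)]] by simp
    thus ?thesis using proportional[OF jk] by blast
  qed
  have C: "gsum q n b z = 0" if jk: "j \<in> {1..n}" "k \<in> {1..n}" "j \<noteq> k" and e: "z j * q ^ r = 1 / z k" for j k r
  proof -
    have "1 / z j = q ^ r * z k" using e z[OF jk(1)] z[OF jk(2)] by (simp add: field_simps)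
    then obtain c where c: "\<And>h. wsum q n b (1 / z j) h = c * wsum q n b (z k) h"
      using wsum_shift_power[OF q(1) z[OF jk(2)]] by metis
    have "wsum q n b (z j) h = (- c) * wsum q n b (z k) h" for h
      using c[of h] wsum_reflect[OF q(1) z[OF jk(1)], of n b h] by (metis minus_minus mult_minus_left)
    thus ?thesis using proportional[OF jk] by blast
  qed
  from R0 have "(\<exists>k\<in>{1..n}. \<exists>j\<in>{1..<k}. qpoch_inf q (q / (z j * z k)) = 0)
     \<or> (\<exists>j\<in>{1..n}. \<exists>k\<in>{1..n}. qpoch_inf q (q * z k / z j) = 0)
     \<or> (\<exists>k\<in>{1..n}. \<exists>j\<in>{1..<k}. qpoch_inf q (q * z j * z k) = 0)"
    unfolding pairs_inf_special by (simp only: mult_eq_0_iff prod_zero_iff finite_atLeastAtMost finite_atLeastLessThan disj_assoc)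
  then consider
      j k where "k \<in> {1..n}" "j \<in> {1..<k}" "qpoch_inf q (q / (z j * z k)) = 0"
    | j k where "j \<in> {1..n}" "k \<in> {1..n}" "qpoch_inf q (q * z k / z j) = 0"
    | j k where "k \<in> {1..n}" "j \<in> {1..<k}" "qpoch_inf q (q * z j * z k) = 0"
    by blast
  thus ?thesis
  proof cases
    case (1 j k)
    then obtain i where "q / (z j * z k) * q ^ i = 1" unfolding qpoch_inf_eq_0_iff[OF q(2)] by blast
    hence "z j = q ^ Suc i * (1 / z k)" using z[of j] z[of k] 1 by (simp add: field_simps)
    thus ?thesis using B[of j k "Suc i"] 1 by auto
  next
    case (2 j k)
    then obtain i where "q * z k / z j * q ^ i = 1" unfolding qpoch_inf_eq_0_iff[OF q(2)] by blast
    hence e: "z j = q ^ Suc i * z k" using z[of j] z[of k] 2 by (simp add: field_simps)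
    \<comment> \<open>The diagonal factors (q)_inf do not vanish, since no positive power of q
      equals 1.\<close>
    have "j \<noteq> k"
    proof
      assume "j = k"
      hence "q ^ Suc i = 1" using e z[OF 2(1)] by simp
      hence "norm q ^ Suc i = 1" by (metis norm_one norm_power)
      moreover have "norm q ^ Suc i < 1" using q by (intro power_Suc_less_one) auto
      ultimately show False by simp
    qed
    thus ?thesis using A[OF 2(1,2) _ e] by blast
  next
    case (3 j k)
    then obtain i where "q * z j * z k * q ^ i = 1" unfolding qpoch_inf_eq_0_iff[OF q(2)] by blast
    hence "z j * q ^ Suc i = 1 / z k" using z[of j] z[of k] 3 by (simp add: field_simps)
    thus ?thesis using C[of j k "Suc i"] 3 by auto
  qed
qed

text \<open>\<open>gsum_eq_pairs_inf\<close> reduces everything to zero parameters; applied once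
  more to the special ones, where \<open>gsum_special\<close> gives the sum, it determines that
  constant after division by \<open>?R\<close>. If \<open>?R = 0\<close>, both sides vanish.\<close>

lemma gsum_eval:
  fixes q :: complex
  assumes q: "q \<noteq> 0" "norm q < 1" and z: "\<And>k. k \<in> {1..n} \<Longrightarrow> z k \<noteq> 0"
    and conv: "norm (q * (\<Prod>j=1..2*n+2. b j)) < 1"
  shows "gsum q n b z * qpoch_inf q (q * (\<Prod>j=1..2*n+2. b j)) = pairs_inf q (2*n+2) b
     * ((\<Prod>k=1..n. 1 / z k - z k) * vdm (map (\<lambda>k. z k + 1 / z k) [1..<Suc n])
        * ((\<Prod>k=1..n. \<Prod>j=1..k. qpoch_inf q (q * z j * z k) * qpoch_inf q (q / (z j * z k)))
         * (\<Prod>j=1..n. \<Prod>k=1..n. qpoch_inf q (q * z k / z j))))"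
proof -
  let ?P = "(\<Prod>k=1..n. \<Prod>j=1..k. qpoch_inf q (q * z j * z k) * qpoch_inf q (q / (z j * z k)))
         * (\<Prod>j=1..n. \<Prod>k=1..n. qpoch_inf q (q * z k / z j))"
  let ?V = "(\<Prod>k=1..n. 1 / z k - z k) * vdm (map (\<lambda>k. z k + 1 / z k) [1..<Suc n])"
  let ?R = "pairs_inf q (2*n+2) (special n z)"
  have "gsum q n (\<lambda>_. 0) z = ?V * ?P"
  proof (cases "?R = 0")
    case True
    \<comment> \<open>Every factor of \<open>?R\<close> also occurs in \<open>?P\<close>, whose
      products over j <= k contain those over j < k.\<close>
    have "?P = 0"
    proof -
      have "(\<Prod>k=1..n. \<Prod>j=1..k. qpoch_inf q (q * z j * z k))
          = (\<Prod>k=1..n. \<Prod>j=1..<k. qpoch_inf q (q * z j * z k)) * (\<Prod>k=1..n. qpoch_inf q (q * z k * z k))"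
        unfolding prod.distrib[symmetric]
        by (intro prod.cong refl) (auto simp: atLeastLessThanSuc_atLeastAtMost[symmetric])
      moreover have "(\<Prod>k=1..n. \<Prod>j=1..k. qpoch_inf q (q / (z j * z k)))
          = (\<Prod>k=1..n. \<Prod>j=1..<k. qpoch_inf q (q / (z j * z k))) * (\<Prod>k=1..n. qpoch_inf q (q / (z k * z k)))"
        unfolding prod.distrib[symmetric]
        by (intro prod.cong refl) (auto simp: atLeastLessThanSuc_atLeastAtMost[symmetric])
      ultimately show ?thesis using True unfolding pairs_inf_special prod.distrib
        by (simp only: mult_eq_0_iff) blast
    qed
    thus ?thesis using gsum_eq_0[OF q z True] by simp
  next
    case False
    have "gsum q n (special n z) z * qpoch_inf q (q * (\<Prod>j=1..2*n+2. special n z j)) = ?R * gsum q n (\<lambda>_. 0) z"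
      by (rule gsum_eq_pairs_inf[OF q z]) (simp_all only: prod_special mult_zero_right norm_zero zero_less_one)
    hence "gsum q n (special n z) z = ?R * gsum q n (\<lambda>_. 0) z"
      by (simp only: prod_special mult_zero_right qpoch_inf_0 mult_1_right)
    moreover have "gsum q n (special n z) z = ?R * ?P * ?V"
      unfolding omega_special_0[symmetric] by (rule gsum_special[OF q z])
    ultimately have "?R * gsum q n (\<lambda>_. 0) z = ?R * (?V * ?P)" by (simp only: mult_ac)
    thus ?thesis using False by simp
  qed
  thus ?thesis using gsum_eq_pairs_inf[OF q z conv] by simp
qed

section \<open>Multilinear expansion of the finite determinant\<close>

text \<open>\<open>vdm\<close> with an arbitrary kernel (later entry first). The same splitting
  rules then serve node differences and the quotients relating two Vandermonde products.\<close>

definition ppair :: "('a \<Rightarrow> 'a \<Rightarrow> complex) \<Rightarrow> 'a list \<Rightarrow> complex" where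
  "ppair g xs = (\<Prod>r<length xs. \<Prod>i<r. g (xs ! r) (xs ! i))"

lemma vdm_eq_ppair: "vdm xs = ppair (-) xs"
  by (simp add: vdm_def ppair_def)

lemma ppair_Nil [simp]: "ppair g [] = 1"
  by (simp add: ppair_def)

lemma ppair_snoc: "ppair g (xs @ [x]) = ppair g xs * (\<Prod>y\<leftarrow>xs. g x y)"
proof -
  have "(\<Prod>r<length xs. \<Prod>i<r. g ((xs @ [x]) ! r) ((xs @ [x]) ! i)) = ppair g xs"
    unfolding ppair_def by (intro prod.cong refl) (auto simp: nth_append)
  moreover have "(\<Prod>i<length xs. g ((xs @ [x]) ! length xs) ((xs @ [x]) ! i)) = (\<Prod>i<length xs. g x (xs ! i))"
    by (intro prod.cong refl) (auto simp: nth_append)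
  moreover have "(\<Prod>i<length xs. g x (xs ! i)) = (\<Prod>y\<leftarrow>xs. g x y)"
    by (simp add: prod.list_conv_set_nth atLeast0LessThan)
  ultimately show ?thesis by (simp add: ppair_def)
qed

lemma ppair_append: "ppair g (xs @ ys) = ppair g xs * ppair g ys * (\<Prod>y\<leftarrow>ys. \<Prod>x\<leftarrow>xs. g y x)"
proof (induction ys rule: rev_induct)
  case (snoc y ys)
  have "ppair g (xs @ ys @ [y]) = ppair g ((xs @ ys) @ [y])" by simp
  thus ?case unfolding ppair_snoc snoc by simp
qed simp

lemma ppair_map: "ppair g (map f xs) = ppair (\<lambda>a b. g (f a) (f b)) xs"
  by (simp add: ppair_def)

lemma prod_list_concat_upt:
  "(\<Prod>x\<leftarrow>concat (map L [1..<Suc p]). f x) = (\<Prod>j=1..p. \<Prod>x\<leftarrow>L j. f x :: complex)"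
  by (induction p) simp_all

lemma prod_list_prod_swap:
  "(\<Prod>y\<leftarrow>ys. \<Prod>j\<in>S. f y j) = (\<Prod>j\<in>S. \<Prod>y\<leftarrow>ys. f y j :: complex)"
  by (induction ys) (simp_all add: prod.distrib)

lemma ppair_concat:
  "ppair g (concat (map L [1..<Suc p]))
     = (\<Prod>k=1..p. ppair g (L k)) * (\<Prod>k=1..p. \<Prod>j=1..<k. \<Prod>y\<leftarrow>L k. \<Prod>x\<leftarrow>L j. g y x)"
proof (induction p)
  case (Suc p)
  have "ppair g (concat (map L [1..<Suc (Suc p)]))
      = ppair g (concat (map L [1..<Suc p]) @ L (Suc p))" by simp
  also have "\<dots> = ppair g (concat (map L [1..<Suc p])) * ppair g (L (Suc p))
      * (\<Prod>j=1..p. \<Prod>y\<leftarrow>L (Suc p). \<Prod>x\<leftarrow>L j. g y x)"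
    unfolding ppair_append prod_list_concat_upt prod_list_prod_swap ..
  also have "(\<Prod>j=1..p. \<Prod>y\<leftarrow>L (Suc p). \<Prod>x\<leftarrow>L j. g y x) = (\<Prod>j=1..<Suc p. \<Prod>y\<leftarrow>L (Suc p). \<Prod>x\<leftarrow>L j. g y x)"
    by (simp only: atLeastLessThanSuc_atLeastAtMost)
  finally show ?case unfolding Suc by (simp add: mult_ac del: upt_Suc)
qed simp

definition missing :: "nat \<Rightarrow> nat \<Rightarrow> nat list" where
  "missing m r = [0..<r] @ [Suc r..<Suc m]"

lemma set_missing: "r \<le> m \<Longrightarrow> set (missing m r) = {..m} - {r}"
  by (auto simp: missing_def)

lemma distinct_missing: "distinct (missing m r)"
  by (auto simp: missing_def)

lemma prod_list_missing: "r \<le> m \<Longrightarrow> (\<Prod>i\<leftarrow>missing m r. f i) = (\<Prod>i\<in>{..m} - {r}. f i :: complex)"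
  using prod.distinct_set_conv_list[OF distinct_missing, of f m r] by (simp add: set_missing)

lemma missing_0: "missing m 0 = map Suc [0..<m]"
  by (simp add: missing_def map_Suc_upt del: upt_Suc)

lemma missing_Suc: "r \<le> m \<Longrightarrow> missing (Suc m) r = missing m r @ [Suc m]"
  by (simp add: missing_def)

lemma missing_top: "missing m m @ [m] = missing (Suc m) (Suc m)"
  by (simp add: missing_def)

lemma ppair_missing:
  assumes "r \<le> m"
  shows "ppair g [0..<Suc m] = ppair g (missing m r) * ((\<Prod>i<r. g r i) * (\<Prod>i\<in>{r<..m}. g i r))"
proof -
  have e: "[0..<Suc m] = ([0..<r] @ [r]) @ [Suc r..<Suc m]"
    using assms upt_add_eq_append[of 0 r "Suc m - r"] by (simp add: upt_conv_Cons del: upt_Suc)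
  have 1: "(\<Prod>i\<leftarrow>[0..<r]. g r i) = (\<Prod>i<r. g r i)"
    by (subst prod.distinct_set_conv_list[symmetric]) (auto simp: atLeast0LessThan)
  have 2: "(\<Prod>i\<leftarrow>[Suc r..<Suc m]. g i r) = (\<Prod>i\<in>{r<..m}. g i r)"
    by (subst prod.distinct_set_conv_list[symmetric]) (auto intro!: prod.cong)
  have 3: "(\<Prod>y\<leftarrow>ys. (\<Prod>x\<leftarrow>xs. g y x) * g y r) = (\<Prod>y\<leftarrow>ys. \<Prod>x\<leftarrow>xs. g y x) * (\<Prod>y\<leftarrow>ys. g y r)" for xs ys :: "nat list"
    by (induction ys) (simp_all add: mult_ac)
  have "ppair g (([0..<r] @ [r]) @ [Suc r..<Suc m])
      = ppair g [0..<r] * (\<Prod>i<r. g r i) * ppair g [Suc r..<Suc m]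
        * ((\<Prod>y\<leftarrow>[Suc r..<Suc m]. \<Prod>x\<leftarrow>[0..<r]. g y x) * (\<Prod>i\<in>{r<..m}. g i r))"
    unfolding ppair_append[of g "[0..<r] @ [r]"] ppair_snoc 1
    by (simp only: map_append prod_list.append list.map prod_list.Cons prod_list.Nil mult_1_right 3 2)
  thus ?thesis unfolding e missing_def ppair_append[of g "[0..<r]" "[Suc r..<Suc m]"] by (simp only: mult_ac)
qed

text \<open>Consecutive rows share a function, so in the multilinear expansion only those terms survive
  in which exactly one of the functions \<open>e 0, \<dots>, e m\<close> is left out.\<close>

lemma rdet_chain:
  "rdet (acc @ map (\<lambda>i l. \<alpha> i * e (Suc i) l - \<beta> i * e i l) [0..<m] @ rest)
     = (\<Sum>r\<le>m. ((\<Prod>i<r. - \<beta> i) * (\<Prod>i\<in>{r..<m}. \<alpha> i)) * rdet (acc @ map e (missing m r) @ rest))"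
proof (induction m arbitrary: rest)
  case 0
  show ?case by (simp add: missing_def)
next
  case (Suc m)
  let ?row = "\<lambda>l. \<alpha> m * e (Suc m) l - \<beta> m * e m l"
  let ?cf = "\<lambda>m r. (\<Prod>i<r. - \<beta> i) * (\<Prod>i\<in>{r..<m}. \<alpha> i)"
  have row: "rdet (acc @ map e (missing m r) @ ?row # rest)
     = \<alpha> m * rdet (acc @ map e (missing (Suc m) r) @ rest)
       + (if r = m then - \<beta> m * rdet (acc @ map e (missing (Suc m) (Suc m)) @ rest) else 0)" if r: "r \<le> m" for r
  proof -
    have "rdet (acc @ map e (missing m r) @ ?row # rest)
       = \<alpha> m * rdet ((acc @ map e (missing m r)) @ e (Suc m) # rest)
        + (- \<beta> m) * rdet ((acc @ map e (missing m r)) @ e m # rest)"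
      using rdet_row_linear[of "acc @ map e (missing m r)" "\<alpha> m" "e (Suc m)" "- \<beta> m" "e m" rest] by simp
    moreover have "(acc @ map e (missing m r)) @ e (Suc m) # rest = acc @ map e (missing (Suc m) r) @ rest"
      using missing_Suc[OF r] by simp
    \<comment> \<open>Unless r = m, the function \<open>e m\<close> already occurs among the rows;
      for r = m the new omitted index is m + 1.\<close>
    moreover have "rdet ((acc @ map e (missing m r)) @ e m # rest)
       = (if r = m then rdet (acc @ map e (missing (Suc m) (Suc m)) @ rest) else 0)"
    proof (cases "r = m")
      case True
      thus ?thesis unfolding missing_top[symmetric] by simp
    next
      case False
      with r have "m \<in> set (missing m r)" by (simp add: set_missing)
      then obtain i where i: "i < length (missing m r)" "missing m r ! i = m" by (auto simp: in_set_conv_nth)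
      have "rdet ((acc @ map e (missing m r)) @ e m # rest) = 0"
        by (rule rdet_eq_0[of "length acc + i" _ "length acc + length (missing m r)"])
          (use i in \<open>auto simp: nth_append\<close>)
      thus ?thesis using False by simp
    qed
    ultimately show ?thesis
      by (cases "r = m") (simp_all only: if_True if_False simp_thms mult_zero_right)
  qed
  have "rdet (acc @ map (\<lambda>i l. \<alpha> i * e (Suc i) l - \<beta> i * e i l) [0..<Suc m] @ rest)
     = rdet (acc @ map (\<lambda>i l. \<alpha> i * e (Suc i) l - \<beta> i * e i l) [0..<m] @ (?row # rest))" by simp
  also have "\<dots> = (\<Sum>r\<le>m. ?cf m r * rdet (acc @ map e (missing m r) @ ?row # rest))"
    by (rule Suc.IH)
  also have "\<dots> = (\<Sum>r\<le>m. ?cf (Suc m) r * rdet (acc @ map e (missing (Suc m) r) @ rest)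
      + (if r = m then ?cf m m * (- \<beta> m) * rdet (acc @ map e (missing (Suc m) (Suc m)) @ rest) else 0))"
    by (intro sum.cong refl) (subst row, auto simp: algebra_simps)
  also have "\<dots> = (\<Sum>r\<le>m. ?cf (Suc m) r * rdet (acc @ map e (missing (Suc m) r) @ rest))
      + ?cf m m * (- \<beta> m) * rdet (acc @ map e (missing (Suc m) (Suc m)) @ rest)"
    unfolding sum.distrib by (subst sum.delta) auto
  also have "?cf m m * (- \<beta> m) = ?cf (Suc m) (Suc m)" by simp
  finally show ?case by simp
qed

lemma sum_PiE_Suc:
  "(\<Sum>x\<in>(\<Pi>\<^sub>E j\<in>{1..Suc p}. T j). f x) = (\<Sum>x\<in>(\<Pi>\<^sub>E j\<in>{1..p}. T j). \<Sum>r\<in>T (Suc p). f (x(Suc p := r)) :: complex)"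
proof -
  have "{1..Suc p} = insert (Suc p) {1..p}" by auto
  hence e: "(\<Pi>\<^sub>E j\<in>{1..Suc p}. T j) = (\<lambda>(y, g). g(Suc p := y)) ` (T (Suc p) \<times> (\<Pi>\<^sub>E j\<in>{1..p}. T j))"
    by (simp only: PiE_insert_eq)
  have inj: "inj_on (\<lambda>(y, g). g(Suc p := y)) (T (Suc p) \<times> (\<Pi>\<^sub>E j\<in>{1..p}. T j))"
    by (rule inj_combinator) simp
  have "(\<Sum>x\<in>(\<Pi>\<^sub>E j\<in>{1..Suc p}. T j). f x) = (\<Sum>(y, g)\<in>T (Suc p) \<times> (\<Pi>\<^sub>E j\<in>{1..p}. T j). f (g(Suc p := y)))"
    unfolding e by (subst sum.reindex[OF inj]) (simp add: case_prod_unfold)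
  also have "\<dots> = (\<Sum>y\<in>T (Suc p). \<Sum>g\<in>(\<Pi>\<^sub>E j\<in>{1..p}. T j). f (g(Suc p := y)))"
    by (rule sum.cartesian_product[symmetric])
  also have "\<dots> = (\<Sum>g\<in>(\<Pi>\<^sub>E j\<in>{1..p}. T j). \<Sum>y\<in>T (Suc p). f (g(Suc p := y)))"
    by (rule sum.swap)
  finally show ?thesis .
qed

text \<open>The first p blocks are expanded by induction with the last block as part of
  \<open>rest\<close>; \<open>rdet_chain\<close> then expands the last one. The value
  \<open>x j\<close> is the index omitted in block \<open>j\<close>.\<close>

lemma rdet_blocks:
  "rdet (concat (map (\<lambda>j. map (\<lambda>i l. \<alpha> j i * e j (Suc i) l - \<beta> j i * e j i l) [0..<m j]) [1..<Suc p]) @ rest)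
   = (\<Sum>x\<in>(\<Pi>\<^sub>E j\<in>{1..p}. {0..m j}).
        (\<Prod>j=1..p. (\<Prod>i<x j. - \<beta> j i) * (\<Prod>i\<in>{x j..<m j}. \<alpha> j i))
        * rdet (concat (map (\<lambda>j. map (e j) (missing (m j) (x j))) [1..<Suc p]) @ rest))"
proof (induction p arbitrary: rest)
  case (Suc p)
  let ?blk = "\<lambda>j. map (\<lambda>i l. \<alpha> j i * e j (Suc i) l - \<beta> j i * e j i l) [0..<m j]"
  let ?cf = "\<lambda>j r. (\<Prod>i<r. - \<beta> j i) * (\<Prod>i\<in>{r..<m j}. \<alpha> j i)"
  let ?pts = "\<lambda>p x. concat (map (\<lambda>j. map (e j) (missing (m j) (x j))) [1..<Suc p])"
  have cat: "concat (map L [1..<Suc (Suc p)]) = concat (map L [1..<Suc p]) @ L (Suc p)" for L :: "nat \<Rightarrow> (nat \<Rightarrow> complex) list"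
    by simp
  have pts: "?pts p (x(Suc p := r)) = ?pts p x" for x r
    by (intro arg_cong[of _ _ concat] map_cong refl) (auto simp del: upt_Suc)
  have cf: "(\<Prod>j=1..p. ?cf j ((x(Suc p := r)) j)) = (\<Prod>j=1..p. ?cf j (x j))" for x r
    by (intro prod.cong refl) auto
  have cfS: "(\<Prod>j=1..Suc p. ?cf j ((x(Suc p := r)) j)) = (\<Prod>j=1..p. ?cf j (x j)) * ?cf (Suc p) r" for x r
    using cf[of x r] by simp
  have "rdet (concat (map ?blk [1..<Suc (Suc p)]) @ rest)
      = rdet (concat (map ?blk [1..<Suc p]) @ (?blk (Suc p) @ rest))"
    unfolding cat append_assoc ..
  also have "\<dots> = (\<Sum>x\<in>(\<Pi>\<^sub>E j\<in>{1..p}. {0..m j}). (\<Prod>j=1..p. ?cf j (x j)) * rdet (?pts p x @ ?blk (Suc p) @ rest))"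
    by (rule Suc.IH)
  also have "\<dots> = (\<Sum>x\<in>(\<Pi>\<^sub>E j\<in>{1..p}. {0..m j}). \<Sum>r\<in>{0..m (Suc p)}.
       (\<Prod>j=1..Suc p. ?cf j ((x(Suc p := r)) j)) * rdet (?pts (Suc p) (x(Suc p := r)) @ rest))"
    unfolding rdet_chain sum_distrib_left atMost_atLeast0 cat pts cfS
    by (intro sum.cong refl) (simp only: fun_upd_same append_assoc mult.assoc)
  also have "\<dots> = (\<Sum>x\<in>(\<Pi>\<^sub>E j\<in>{1..Suc p}. {0..m j}). (\<Prod>j=1..Suc p. ?cf j (x j)) * rdet (?pts (Suc p) x @ rest))"
    by (rule sum_PiE_Suc[symmetric])
  finally show ?case .
qed simp

section \<open>Ratios of Vandermonde products with omitted nodes\<close>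

definition qp :: "complex \<Rightarrow> complex \<Rightarrow> nat \<Rightarrow> complex" where
  "qp q a k = (\<Prod>i<k. 1 - a * q ^ i)"

lemma qp_Suc: "qp q a (Suc k) = qp q a k * (1 - a * q ^ k)"
  by (simp add: qp_def)

lemma qp_0 [simp]: "qp q a 0 = 1"
  by (simp add: qp_def)

lemma qp_eq_0_iff: "qp q a k = 0 \<longleftrightarrow> (\<exists>i<k. a * q ^ i = 1)"
  by (auto simp: qp_def)

lemma qpoch_of_nat: "qpoch q a (int k) = qp q a k"
  by (simp add: qpoch_def qp_def)

lemma qp_add: "qp q a (k + l) = qp q a k * qp q (a * q ^ k) l"
  by (induction l) (simp_all add: qp_Suc power_add mult_ac)

text \<open>Differences of values of \<open>eps\<close> are, up to monomials, the factors of \<open>W\<close>.\<close>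

definition eps :: "complex \<Rightarrow> complex" where
  "eps v = v + 1 / v"

lemma eps_diff: "v \<noteq> 0 \<Longrightarrow> w \<noteq> 0 \<Longrightarrow> eps v - eps w = (v - w) * (1 - 1 / (v * w))"
  by (simp add: eps_def field_simps)

lemma prod_shift_atMost:
  fixes f :: "nat \<Rightarrow> complex"
  shows "f 0 * (\<Prod>l\<le>m. f (Suc l)) = (\<Prod>l\<le>m. f l) * f (Suc m)"
  by (induction m) (simp_all add: mult_ac)

text \<open>Differences between one node of the block of c and the complete block of d, with
  \<open>s\<close> a square root of q. Omitting the node divides the Vandermonde product by this, up
  to sign.\<close>

definition rowprod :: "complex \<Rightarrow> complex \<Rightarrow> complex \<Rightarrow> nat \<Rightarrow> complex \<Rightarrow> nat \<Rightarrow> complex" where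
  "rowprod q s d m c x = (\<Prod>l\<le>m. eps (d * q ^ l / s) - eps (c * q ^ x / s))"

lemma eps_diff_half:
  assumes "s \<noteq> 0" "s\<^sup>2 = q" "c \<noteq> 0" "d \<noteq> 0"
  shows "eps (d * q ^ l / s) - eps (c * q ^ x / s)
      = (d * q ^ l - c * q ^ x) * (1 - q / (c * d * q ^ (l + x))) / s"
proof -
  have q: "q \<noteq> 0" using assms by auto
  have "d * q ^ l / s * (c * q ^ x / s) = c * d * q ^ (l + x) / q"
    unfolding assms(2)[symmetric] by (simp add: power_add power2_eq_square mult_ac)
  hence "eps (d * q ^ l / s) - eps (c * q ^ x / s)
      = (d * q ^ l / s - c * q ^ x / s) * (1 - 1 / (c * d * q ^ (l + x) / q))"
    using eps_diff[of "d * q ^ l / s" "c * q ^ x / s"] assms q by (simp del: times_divide_eq_left)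
  thus ?thesis by (simp add: diff_divide_distrib[symmetric])
qed

text \<open>Increasing x moves the window of exponents l + x by one, so only its first and last
  factors change. The relation is multiplied out because these may vanish.\<close>

lemma prod_one_minus_inverse_step:
  fixes q C :: complex and m :: nat
  assumes "q \<noteq> 0" "C \<noteq> 0"
  defines "V \<equiv> \<lambda>x. \<Prod>l\<le>m. 1 - q / (C * q ^ (l + x))"
  shows "V (Suc x) * (q ^ (m + 1) * (1 - C / q * q ^ x)) = V x * (1 - q ^ m * C * q ^ x)"
proof -
  define f where "f l = 1 - q / (C * q ^ (l + x))" for l
  have "f 0 * V (Suc x) = V x * f (Suc m)"
    using prod_shift_atMost[of f m] by (simp add: V_def f_def)
  moreover have "q ^ (m + 1) * (1 - C / q * q ^ x) = - (C * q ^ (m + x)) * f 0"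
    using assms by (simp add: f_def field_simps power_add)
  moreover have "1 - q ^ m * C * q ^ x = - (C * q ^ (m + x)) * f (Suc m)"
    using assms by (simp add: f_def field_simps power_add)
  moreover have "V (Suc x) * (- (C * q ^ (m + x)) * f 0) = - (C * q ^ (m + x)) * (f 0 * V (Suc x))"
    "V x * (- (C * q ^ (m + x)) * f (Suc m)) = - (C * q ^ (m + x)) * (V x * f (Suc m))"
    by (simp_all only: mult_ac)
  ultimately show ?thesis by (simp only:)
qed

lemma prod_one_minus_inverse:
  fixes q C :: complex
  assumes "q \<noteq> 0" "C \<noteq> 0"
  shows "(\<Prod>l\<le>m. 1 - q / (C * q ^ (l + x))) * (q ^ (x * (m + 1)) * qp q (C / q) x)
       = (\<Prod>l\<le>m. 1 - q / (C * q ^ l)) * qp q (q ^ m * C) x"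
proof (induction x)
  case (Suc x)
  let ?V = "\<lambda>x. \<Prod>l\<le>m. 1 - q / (C * q ^ (l + x))"
  have "?V (Suc x) * (q ^ (Suc x * (m + 1)) * qp q (C / q) (Suc x))
      = (?V (Suc x) * (q ^ (m + 1) * (1 - C / q * q ^ x))) * (q ^ (x * (m + 1)) * qp q (C / q) x)"
  proof -
    have "q ^ (Suc x * (m + 1)) = q ^ (m + 1) * q ^ (x * (m + 1))" by (simp only: mult_Suc power_add)
    thus ?thesis unfolding qp_Suc by (simp only: mult_ac)
  qed
  also have "\<dots> = (?V x * (q ^ (x * (m + 1)) * qp q (C / q) x)) * (1 - q ^ m * C * q ^ x)"
    unfolding prod_one_minus_inverse_step[OF assms] by (simp only: mult_ac)
  also have "\<dots> = ?V 0 * qp q (q ^ m * C) (Suc x)"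
    unfolding Suc qp_Suc by (simp add: mult.assoc)
  finally show ?case by simp
qed simp

text \<open>Again a moving window: after extracting q from every factor, the product for x + 1
  differs from that for x only in the two end factors.\<close>

lemma prod_diff_powers:
  fixes q c d :: complex
  assumes "q \<noteq> 0" "d \<noteq> 0"
  shows "(\<Prod>l\<le>m. d * q ^ l - c * q ^ x) * qp q (c / (d * q ^ m)) x
       = (\<Prod>l\<le>m. d * q ^ l - c) * qp q (q * c / d) x"
proof (induction x)
  case (Suc x)
  let ?U = "\<lambda>x. \<Prod>l\<le>m. d * q ^ l - c * q ^ x"
  define f where "f l = d * q ^ l - c * q ^ Suc x" for l
  have "f 0 * (\<Prod>l\<le>m. f (Suc l)) = ?U (Suc x) * f (Suc m)"
    using prod_shift_atMost[of f m] by (simp add: f_def)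
  moreover have "f (Suc l) = q * (d * q ^ l - c * q ^ x)" for l by (simp add: f_def algebra_simps)
  hence "(\<Prod>l\<le>m. f (Suc l)) = q ^ (m + 1) * ?U x"
    by (simp add: prod.distrib)
  moreover have "f 0 = d * (1 - q * c / d * q ^ x)" using assms by (simp add: f_def field_simps)
  moreover have "f (Suc m) = d * q ^ (m + 1) * (1 - c / (d * q ^ m) * q ^ x)"
    using assms by (simp add: f_def field_simps)
  ultimately have "(d * q ^ (m + 1)) * (?U (Suc x) * (1 - c / (d * q ^ m) * q ^ x))
     = (d * q ^ (m + 1)) * (?U x * (1 - q * c / d * q ^ x))"
    by (simp only: mult_ac)
  hence step: "?U (Suc x) * (1 - c / (d * q ^ m) * q ^ x) = ?U x * (1 - q * c / d * q ^ x)"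
    using assms by simp
  have "?U (Suc x) * qp q (c / (d * q ^ m)) (Suc x)
      = (?U (Suc x) * (1 - c / (d * q ^ m) * q ^ x)) * qp q (c / (d * q ^ m)) x"
    unfolding qp_Suc by (simp only: mult_ac)
  also have "\<dots> = (?U x * qp q (c / (d * q ^ m)) x) * (1 - q * c / d * q ^ x)"
    unfolding step by (simp only: mult_ac)
  finally show ?case unfolding Suc qp_Suc by (simp only: mult.assoc)
qed simp

text \<open>The quotient \<open>rowprod\<close> at 0 over \<open>rowprod\<close> at x is the factor
  of the finite sum belonging to a pair of indices, times q^(x(m+1)).\<close>

lemma rowprod_ratio:
  assumes s: "s \<noteq> 0" "s\<^sup>2 = q" and cd: "c \<noteq> 0" "d \<noteq> 0"
  shows "rowprod q s d m c x * (q ^ (x * (m + 1)) * qp q (c / (d * q ^ m)) x * qp q (c * d / q) x)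
       = rowprod q s d m c 0 * (qp q (q * c / d) x * qp q (q ^ m * c * d) x)"
proof -
  have q: "q \<noteq> 0" using s by auto
  have r: "rowprod q s d m c x = (\<Prod>l\<le>m. d * q ^ l - c * q ^ x) * (\<Prod>l\<le>m. 1 - q / (c * d * q ^ (l + x))) * (1 / s) ^ (m + 1)" for x
    unfolding rowprod_def eps_diff_half[OF s cd] by (simp add: prod.distrib prod_dividef power_one_over)
  have 1: "(\<Prod>l\<le>m. d * q ^ l - c * q ^ x) * qp q (c / (d * q ^ m)) x = (\<Prod>l\<le>m. d * q ^ l - c * q ^ 0) * qp q (q * c / d) x"
    using prod_diff_powers[OF q cd(2), where m = m and c = c and x = x] by simp
  have 2: "(\<Prod>l\<le>m. 1 - q / (c * d * q ^ (l + x))) * (q ^ (x * (m + 1)) * qp q (c * d / q) x)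
      = (\<Prod>l\<le>m. 1 - q / (c * d * q ^ (l + 0))) * qp q (q ^ m * c * d) x"
    using prod_one_minus_inverse[OF q, where C = "c * d" and m = m and x = x] cd by (simp add: mult.assoc)
  have "rowprod q s d m c x * (q ^ (x * (m + 1)) * qp q (c / (d * q ^ m)) x * qp q (c * d / q) x)
     = ((\<Prod>l\<le>m. d * q ^ l - c * q ^ x) * qp q (c / (d * q ^ m)) x)
      * ((\<Prod>l\<le>m. 1 - q / (c * d * q ^ (l + x))) * (q ^ (x * (m + 1)) * qp q (c * d / q) x)) * (1 / s) ^ (m + 1)"
    unfolding r by (simp only: mult_ac)
  also have "\<dots> = rowprod q s d m c 0 * (qp q (q * c / d) x * qp q (q ^ m * c * d) x)"
    unfolding 1 2 r by (simp only: mult_ac)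
  finally show ?thesis .
qed

text \<open>The counterpart of \<open>rowprod\<close> for d = c, where the zero difference of the
  node with itself is left out.\<close>

definition starprod :: "complex \<Rightarrow> complex \<Rightarrow> nat \<Rightarrow> complex \<Rightarrow> nat \<Rightarrow> complex" where
  "starprod q s m c x = (\<Prod>i\<in>{..m} - {x}. eps (c * q ^ i / s) - eps (c * q ^ x / s))"

text \<open>Taking out i = 0 for x + 1 and i = m for x leaves the same product up to a power of q,
  by i -> i - 1.\<close>

lemma prod_diff_powers_punctured:
  fixes q :: complex
  assumes q: "q \<noteq> 0" and x: "x \<le> m"
  shows "(\<Prod>i\<in>{..m} - {x}. q ^ i - q ^ x) * (q ^ x * qp q (1 / q ^ m) x)
       = (\<Prod>i\<in>{..m} - {0}. q ^ i - q ^ 0) * qp q q x"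
  using x
proof (induction x)
  case (Suc x)
  let ?U = "\<lambda>x. \<Prod>i\<in>{..m} - {x}. q ^ i - q ^ x"
  obtain m' where m: "m = Suc m'" using Suc.prems by (cases m) auto
  have xm: "x \<le> m'" using Suc.prems m by simp
  let ?P = "\<Prod>i\<in>{..m'} - {x}. q ^ i - q ^ x"
  have "?U (Suc x) = (1 - q ^ Suc x) * (\<Prod>i\<in>{1..Suc m'} - {Suc x}. q ^ i - q ^ Suc x)"
  proof -
    have "{..m} - {Suc x} = insert 0 ({1..Suc m'} - {Suc x})" unfolding m by auto
    thus ?thesis by simp
  qed
  also have "(\<Prod>i\<in>{1..Suc m'} - {Suc x}. q ^ i - q ^ Suc x) = (\<Prod>i\<in>{..m'} - {x}. q * (q ^ i - q ^ x))"
    by (rule prod.reindex_bij_witness[of _ Suc "\<lambda>i. i - 1"])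
      (auto simp: right_diff_distrib simp flip: power_Suc)
  also have "\<dots> = q ^ m' * ?P" using xm by (simp add: prod.distrib)
  finally have 1: "?U (Suc x) = (1 - q ^ Suc x) * (q ^ m' * ?P)" .
  have 2: "?U x = (q ^ m - q ^ x) * ?P"
  proof -
    have "{..m} - {x} = insert (Suc m') ({..m'} - {x})" using xm unfolding m by auto
    thus ?thesis by (simp add: m)
  qed
  have 3: "q ^ m - q ^ x = q ^ m * (1 - 1 / q ^ m * q ^ x)" using q by (simp add: field_simps)
  have H: "?U (Suc x) * (q * (1 - 1 / q ^ m * q ^ x)) = ?U x * (1 - q * q ^ x)"
    unfolding 1 2 3 unfolding m by (simp add: mult_ac)
  have "?U (Suc x) * (q ^ Suc x * qp q (1 / q ^ m) (Suc x)) = ?U x * (q ^ x * qp q (1 / q ^ m) x) * (1 - q * q ^ x)"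
  proof -
    have "?U (Suc x) * (q ^ Suc x * qp q (1 / q ^ m) (Suc x))
        = (?U (Suc x) * (q * (1 - 1 / q ^ m * q ^ x))) * (q ^ x * qp q (1 / q ^ m) x)"
      unfolding qp_Suc power_Suc by (simp only: mult_ac)
    also have "\<dots> = (?U x * (1 - q * q ^ x)) * (q ^ x * qp q (1 / q ^ m) x)"
      by (simp only: H)
    finally show ?thesis by (simp only: mult_ac)
  qed
  also have "\<dots> = ?U 0 * qp q q (Suc x)"
    using Suc unfolding qp_Suc by (simp add: mult.assoc)
  finally show ?case .
qed simp

text \<open>Relative to the complete window the factor i = x, that is 1 - q/(c^2 q^(2x)), is absent.
  This accounts for the diagonal factor (1 - c^2 q^(2x-1)) / (1 - c^2/q) of
  \<open>W\<close>.\<close>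

lemma starprod_ratio:
  assumes s: "s \<noteq> 0" "s\<^sup>2 = q" and c: "c \<noteq> 0" and x: "x \<le> m"
    and nz: "1 - c * c / q \<noteq> 0"
  shows "starprod q s m c x * (q ^ (x * m) * qp q (1 / q ^ m) x * qp q (c * c / q) x * (1 - c * c / q * q ^ (2 * x)))
       = starprod q s m c 0 * (qp q q x * qp q (q ^ m * c * c) x * (1 - c * c / q))"
proof -
  have q: "q \<noteq> 0" using s by auto
  let ?V = "\<lambda>x. \<Prod>i\<le>m. 1 - q / (c * c * q ^ (i + x))"
  let ?V' = "\<lambda>x. \<Prod>i\<in>{..m} - {x}. 1 - q / (c * c * q ^ (i + x))"
  let ?U = "\<lambda>x. \<Prod>i\<in>{..m} - {x}. q ^ i - q ^ x"
  let ?t = "\<lambda>x. 1 - q / (c * c * q ^ (x + x))"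
  have st: "starprod q s m c x = ?U x * ?V' x * (c / s) ^ m" if "x \<le> m" for x
  proof -
    have e: "eps (c * q ^ i / s) - eps (c * q ^ x / s) = (q ^ i - q ^ x) * (1 - q / (c * c * q ^ (i + x))) * (c / s)" for i
      using eps_diff_half[OF s c c, of i x] unfolding right_diff_distrib[symmetric] by simp
    show ?thesis unfolding starprod_def e prod.distrib prod_constant using that by simp
  qed
  have V: "?V x = ?t x * ?V' x" if "x \<le> m" for x
    using that by (intro prod.remove) auto
  have t: "c * c * q ^ (2 * x) / q * ?t x = - (1 - c * c / q * q ^ (2 * x))" for x
    using q c by (simp add: field_simps mult_2[symmetric])
  have U: "?U x * (q ^ x * qp q (1 / q ^ m) x) = ?U 0 * qp q q x"
    by (rule prod_diff_powers_punctured[OF q x])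
  have V2: "?V x * (q ^ (x * (m + 1)) * qp q (c * c / q) x) = ?V 0 * qp q (q ^ m * c * c) x"
    using prod_one_minus_inverse[OF q, where C = "c * c" and m = m and x = x] c by (simp add: mult.assoc)
  have e1: "q ^ (x * m) * q ^ (2 * x) = q ^ x * q ^ (x * (m + 1))"
    by (simp add: power_add[symmetric] algebra_simps mult_2_right)
  have "starprod q s m c x * (q ^ (x * m) * qp q (1 / q ^ m) x * qp q (c * c / q) x * (1 - c * c / q * q ^ (2 * x)))
     = - (?U x * (q ^ x * qp q (1 / q ^ m) x)) * ((?t x * ?V' x) * (q ^ (x * (m + 1)) * qp q (c * c / q) x)) * (c * c / q) * (c / s) ^ m"
  proof -
    have "1 - c * c / q * q ^ (2 * x) = - (c * c * q ^ (2 * x) / q * ?t x)" unfolding t by simp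
    hence "starprod q s m c x * (q ^ (x * m) * qp q (1 / q ^ m) x * qp q (c * c / q) x * (1 - c * c / q * q ^ (2 * x)))
      = - (?U x * qp q (1 / q ^ m) x * (?t x * ?V' x) * qp q (c * c / q) x * (c * c / q) * (c / s) ^ m * (q ^ (x * m) * q ^ (2 * x)))"
      unfolding st[OF x] by (simp add: mult_ac)
    thus ?thesis unfolding e1 by (simp add: mult_ac)
  qed
  also have "\<dots> = - (?U 0 * qp q q x) * ((?t 0 * ?V' 0) * qp q (q ^ m * c * c) x) * (c * c / q) * (c / s) ^ m"
    unfolding U V[OF x, symmetric] V2 by (subst V) simp_all
  also have "\<dots> = (?U 0 * ?V' 0 * (c / s) ^ m) * (qp q q x * qp q (q ^ m * c * c) x * (- (c * c * q ^ (2 * 0) / q * ?t 0)))"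
    by (simp add: mult_ac)
  also have "- (c * c * q ^ (2 * 0) / q * ?t 0) = 1 - c * c / q" unfolding t by simp
  finally show ?thesis unfolding st[of 0, OF le0] .
qed

text \<open>The Vandermonde product of all nodes 0..m equals \<open>S x\<close> times the
  differences involving node x, so \<open>S x / S 0\<close> is an inverse ratio of
  \<open>starprod\<close>. The x nodes preceding the omitted one have the opposite orientation,
  whence (-1)^x.\<close>

lemma selfprod_ratio:
  assumes s: "s \<noteq> 0" "s\<^sup>2 = q" and c: "c \<noteq> 0" and x: "x \<le> m"
    and nz: "1 - c * c / q \<noteq> 0" "starprod q s m c 0 \<noteq> 0" "qp q q x \<noteq> 0" "qp q (q ^ m * c * c) x \<noteq> 0"
  defines "S \<equiv> \<lambda>x. ppair (\<lambda>i l. eps (c * q ^ i / s) - eps (c * q ^ l / s)) (missing m x)"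
  shows "S x = S 0 * ((- 1) ^ x * q ^ (x * m)
     * (qp q (c * c / q) x * qp q (1 / q ^ m) x / (qp q q x * qp q (q ^ m * c * c) x))
     * ((1 - c * c / q * q ^ (2 * x)) / (1 - c * c / q)))"
proof -
  let ?E = "\<lambda>i. eps (c * q ^ i / s)"
  let ?full = "ppair (\<lambda>i l. ?E i - ?E l) [0..<Suc m]"
  let ?N = "starprod q s m c"
  have S: "?full = S x * ((- 1) ^ x * ?N x)" if "x \<le> m" for x
  proof -
    have "(\<Prod>i<x. ?E x - ?E i) = (\<Prod>i<x. (- 1) * (?E i - ?E x))" by simp
    also have "\<dots> = (- 1) ^ x * (\<Prod>i<x. ?E i - ?E x)" unfolding prod.distrib by simp
    finally have "(\<Prod>i<x. ?E x - ?E i) * (\<Prod>i\<in>{x<..m}. ?E i - ?E x)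
        = (- 1) ^ x * ((\<Prod>i<x. ?E i - ?E x) * (\<Prod>i\<in>{x<..m}. ?E i - ?E x))" by simp
    also have "(\<Prod>i<x. ?E i - ?E x) * (\<Prod>i\<in>{x<..m}. ?E i - ?E x) = (\<Prod>i\<in>{..<x} \<union> {x<..m}. ?E i - ?E x)"
      by (rule prod.union_disjoint[symmetric]) auto
    also have "{..<x} \<union> {x<..m} = {..m} - {x}" using that by auto
    finally show ?thesis unfolding S_def starprod_def ppair_missing[OF that] by simp
  qed
  define a where "a = q ^ (x * m) * qp q (1 / q ^ m) x * qp q (c * c / q) x * (1 - c * c / q * q ^ (2 * x))"
  define d where "d = qp q q x * qp q (q ^ m * c * c) x * (1 - c * c / q)"
  have ad: "?N x * a = ?N 0 * d"
    unfolding a_def d_def by (rule starprod_ratio[OF s c x nz(1)])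
  have d0: "d \<noteq> 0" using nz by (simp add: d_def)
  have N: "?N x \<noteq> 0" using ad d0 nz(2) by (metis mult_eq_0_iff)
  have "S x * ((- 1) ^ x * ?N x) = S 0 * ?N 0" using S[OF x] S[of 0] by simp
  hence "S x * (- 1) ^ x * d * ?N x = S 0 * (?N 0 * d)" by (simp only: mult_ac)
  also have "\<dots> = S 0 * a * ?N x" unfolding ad[symmetric] by (simp only: mult_ac)
  finally have "S x * (- 1) ^ x * d = S 0 * a" using N by simp
  hence "S x * (- 1) ^ x = S 0 * (a / d)" using d0 by (simp add: field_simps)
  hence "(S x * (- 1) ^ x) * (- 1) ^ x = S 0 * (a / d) * (- 1) ^ x" by (simp only:)
  moreover have "(S x * (- 1) ^ x) * (- 1) ^ x = S x"
    unfolding mult.assoc by (simp flip: power_mult_distrib)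
  ultimately have "S x = S 0 * ((- 1) ^ x * (a / d))" by (simp only: mult_ac)
  thus ?thesis unfolding a_def d_def by (simp add: mult_ac)
qed

text \<open>Removing one row and one column from the full rectangle of differences counts their
  common corner twice: rectangle times corner equals \<open>Cr\<close> times row times column.
  Comparison with x = y = 0 leaves two ratios of \<open>rowprod\<close> and a quotient of corners,
  which goes into \<open>W\<close>.\<close>

lemma crossprod_ratio:
  assumes s: "s \<noteq> 0" "s\<^sup>2 = q" and cd: "c \<noteq> 0" "d \<noteq> 0" and xy: "x \<le> m" "y \<le> l"
    and nz: "rowprod q s d l c 0 \<noteq> 0" "rowprod q s c m d 0 \<noteq> 0"
      "qp q (q * c / d) x \<noteq> 0" "qp q (q ^ l * c * d) x \<noteq> 0" "qp q (q * d / c) y \<noteq> 0" "qp q (q ^ m * d * c) y \<noteq> 0"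
  defines "E \<equiv> \<lambda>c i. eps (c * q ^ i / s)"
  defines "Cr \<equiv> \<lambda>x y. \<Prod>k\<in>{..l} - {y}. \<Prod>i\<in>{..m} - {x}. E d k - E c i"
  shows "Cr x y = Cr 0 0 * ((E d y - E c x) / (E d 0 - E c 0))
     * (q ^ (x * (l + 1)) * (qp q (c * d / q) x * qp q (c / (d * q ^ l)) x / (qp q (q * c / d) x * qp q (q ^ l * c * d) x)))
     * (q ^ (y * (m + 1)) * (qp q (d * c / q) y * qp q (d / (c * q ^ m)) y / (qp q (q * d / c) y * qp q (q ^ m * d * c) y)))"
proof -
  let ?full = "\<Prod>k\<le>l. \<Prod>i\<le>m. E d k - E c i"
  let ?R = "rowprod q s d l c" and ?C = "rowprod q s c m d"
  have full: "?full * (E d y - E c x) = Cr x y * ?R x * ((- 1) ^ (m + 1) * ?C y)" if "x \<le> m" "y \<le> l" for x y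
  proof -
    have "?full = (\<Prod>k\<le>l. (E d k - E c x) * (\<Prod>i\<in>{..m} - {x}. E d k - E c i))"
      using that by (intro prod.cong refl prod.remove) auto
    also have "\<dots> = ?R x * (\<Prod>k\<le>l. \<Prod>i\<in>{..m} - {x}. E d k - E c i)"
      unfolding prod.distrib rowprod_def E_def ..
    also have "(\<Prod>k\<le>l. \<Prod>i\<in>{..m} - {x}. E d k - E c i) = (\<Prod>i\<in>{..m} - {x}. E d y - E c i) * Cr x y"
      unfolding Cr_def using that by (intro prod.remove) auto
    finally have 1: "?full = ?R x * ((\<Prod>i\<in>{..m} - {x}. E d y - E c i) * Cr x y)" .
    have "(\<Prod>i\<le>m. E d y - E c i) = (\<Prod>i\<le>m. (- 1) * (E c i - E d y))" by simp
    also have "\<dots> = (- 1) ^ (m + 1) * ?C y" unfolding prod.distrib rowprod_def E_def by simp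
    finally have "(- 1) ^ (m + 1) * ?C y = (\<Prod>i\<le>m. E d y - E c i)" ..
    also have "\<dots> = (E d y - E c x) * (\<Prod>i\<in>{..m} - {x}. E d y - E c i)"
      using that by (intro prod.remove) auto
    finally show ?thesis unfolding 1 by (simp only: mult_ac)
  qed
  define a where "a = q ^ (x * (l + 1)) * qp q (c / (d * q ^ l)) x * qp q (c * d / q) x"
  define b where "b = qp q (q * c / d) x * qp q (q ^ l * c * d) x"
  define a' where "a' = q ^ (y * (m + 1)) * qp q (d / (c * q ^ m)) y * qp q (d * c / q) y"
  define b' where "b' = qp q (q * d / c) y * qp q (q ^ m * d * c) y"
  have r1: "?R x * a = ?R 0 * b" unfolding a_def b_def by (rule rowprod_ratio[OF s cd])
  have r2: "?C y * a' = ?C 0 * b'" unfolding a'_def b'_def by (rule rowprod_ratio[OF s cd(2,1)])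
  have b0: "b \<noteq> 0" "b' \<noteq> 0" using nz by (auto simp: b_def b'_def)
  have R: "?R x \<noteq> 0" and C: "?C y \<noteq> 0" using r1 r2 b0 nz(1,2) by (metis mult_eq_0_iff)+
  have E0: "E d 0 - E c 0 \<noteq> 0"
  proof
    assume "E d 0 - E c 0 = 0"
    hence "rowprod q s d l c 0 = 0"
      unfolding rowprod_def E_def by (intro prod_zero bexI[of _ 0]) auto
    with nz(1) show False by simp
  qed
  have "(Cr x y * ?R x * ?C y) * (E d 0 - E c 0) * (- 1) ^ (m + 1) = ?full * (E d y - E c x) * (E d 0 - E c 0)"
    unfolding full[OF xy] by (simp only: mult_ac)
  also have "\<dots> = (?full * (E d 0 - E c 0)) * (E d y - E c x)" by (simp only: mult_ac)
  also have "\<dots> = Cr 0 0 * ?R 0 * ?C 0 * (E d y - E c x) * (- 1) ^ (m + 1)"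
    unfolding full[of 0 0, OF le0 le0] by (simp only: mult_ac)
  finally have "(Cr x y * ?R x * ?C y) * (E d 0 - E c 0) = Cr 0 0 * ?R 0 * ?C 0 * (E d y - E c x)"
    by simp
  hence "(Cr x y * ?R x * ?C y) * (E d 0 - E c 0) * (b * b') = Cr 0 0 * (?R 0 * b) * (?C 0 * b') * (E d y - E c x)"
    by (simp only: mult_ac)
  also have "\<dots> = (Cr 0 0 * (E d y - E c x) * (a * a')) * (?R x * ?C y)"
    unfolding r1[symmetric] r2[symmetric] by (simp only: mult_ac)
  finally have "(Cr x y * (E d 0 - E c 0) * (b * b')) * (?R x * ?C y) = (Cr 0 0 * (E d y - E c x) * (a * a')) * (?R x * ?C y)"
    by (simp only: mult_ac)
  hence "Cr x y * (E d 0 - E c 0) * (b * b') = Cr 0 0 * (E d y - E c x) * (a * a')"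
    using R C by simp
  hence "Cr x y = Cr 0 0 * ((E d y - E c x) / (E d 0 - E c 0)) * (a / b) * (a' / b')"
    using E0 b0 by (simp add: field_simps)
  thus ?thesis unfolding a_def b_def a'_def b'_def by (simp only: mult_ac times_divide_eq_right)
qed

lemma prod_square_split:
  fixes g :: "nat \<Rightarrow> nat \<Rightarrow> complex"
  shows "(\<Prod>j=1..p. \<Prod>k=1..p. g j k) = (\<Prod>j=1..p. g j j) * (\<Prod>k=1..p. \<Prod>j=1..<k. g j k * g k j)"
proof (induction p)
  case (Suc p)
  have "(\<Prod>j=1..Suc p. \<Prod>k=1..Suc p. g j k)
      = (\<Prod>j=1..p. (\<Prod>k=1..p. g j k) * g j (Suc p)) * ((\<Prod>k=1..p. g (Suc p) k) * g (Suc p) (Suc p))"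
    by simp
  also have "\<dots> = (\<Prod>j=1..p. \<Prod>k=1..p. g j k) * (g (Suc p) (Suc p) * (\<Prod>j=1..p. g j (Suc p) * g (Suc p) j))"
    by (simp only: prod.distrib mult_ac)
  also have "(\<Prod>j=1..p. g j (Suc p) * g (Suc p) j) = (\<Prod>j=1..<Suc p. g j (Suc p) * g (Suc p) j)"
    by (simp only: atLeastLessThanSuc_atLeastAtMost)
  finally show ?case unfolding Suc by (simp add: mult_ac)
qed simp

lemma W_eps:
  assumes "\<And>j. j \<in> {1..p} \<Longrightarrow> e j \<noteq> 0"
  shows "W p e = (\<Prod>j=1..p. 1 - e j * e j) * (\<Prod>k=1..p. \<Prod>j=1..<k. e j * e k * (eps (e k) - eps (e j)))"
proof -
  have 1: "(\<Prod>j=1..k. 1 - e j * e k) = (1 - e k * e k) * (\<Prod>j=1..<k. 1 - e j * e k)" if "k \<in> {1..p}" for k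
  proof -
    have "{1..k} = insert k {1..<k}" using that by auto
    thus ?thesis by simp
  qed
  have 2: "(1 - e j * e k) * (e j - e k) = e j * e k * (eps (e k) - eps (e j))" if "k \<in> {1..p}" "j \<in> {1..<k}" for j k
    using assms[of j] assms[of k] that by (simp add: eps_def field_simps)
  have "W p e = (\<Prod>k=1..p. (1 - e k * e k) * (\<Prod>j=1..<k. 1 - e j * e k)) * (\<Prod>k=1..p. \<Prod>j=1..<k. e j - e k)"
    unfolding W_def using 1 by simp
  also have "\<dots> = (\<Prod>k=1..p. 1 - e k * e k) * (\<Prod>k=1..p. \<Prod>j=1..<k. (1 - e j * e k) * (e j - e k))"
    unfolding prod.distrib by (simp only: mult.assoc)
  also have "(\<Prod>k=1..p. \<Prod>j=1..<k. (1 - e j * e k) * (e j - e k)) = (\<Prod>k=1..p. \<Prod>j=1..<k. e j * e k * (eps (e k) - eps (e j)))"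
    by (intro prod.cong refl 2)
  finally show ?thesis .
qed

lemma vdm_blocks:
  assumes "\<And>j. j \<in> {1..p} \<Longrightarrow> x j \<le> m j"
  shows "vdm (concat (map (\<lambda>j. map (E j) (missing (m j) (x j))) [1..<Suc p]))
    = (\<Prod>k=1..p. ppair (\<lambda>i l. E k i - E k l) (missing (m k) (x k)))
      * (\<Prod>k=1..p. \<Prod>j=1..<k. \<Prod>l\<in>{..m k} - {x k}. \<Prod>i\<in>{..m j} - {x j}. E k l - E j i)"
proof -
  have "(\<Prod>k=1..p. \<Prod>j=1..<k. \<Prod>y\<leftarrow>map (E k) (missing (m k) (x k)). \<Prod>z\<leftarrow>map (E j) (missing (m j) (x j)). y - z)
     = (\<Prod>k=1..p. \<Prod>j=1..<k. \<Prod>l\<in>{..m k} - {x k}. \<Prod>i\<in>{..m j} - {x j}. E k l - E j i)"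
    using assms by (intro prod.cong refl) (simp add: o_def prod_list_missing)
  thus ?thesis unfolding vdm_eq_ppair ppair_concat by (simp add: ppair_map)
qed

text \<open>The signs (-1)^(x_j) from the coefficients \<beta> and from the products within a block
  cancel. The powers q^(x_j m_k) combine to q^(|m||x|), and the remaining q^(x_j + x_k) of each pair
  of blocks, together with the quotient of corners, gives the off-diagonal part of
  \<open>W\<close>.\<close>

lemma expansion_term_ratio:
  fixes q s A :: complex and a c :: "nat \<Rightarrow> complex" and m x :: "nat \<Rightarrow> nat" and \<alpha> \<beta> :: "nat \<Rightarrow> nat \<Rightarrow> complex"
  assumes s: "s \<noteq> 0" "s\<^sup>2 = q" and c: "\<And>j. j \<in> {1..p} \<Longrightarrow> c j \<noteq> 0"
    and x: "\<And>j. j \<in> {1..p} \<Longrightarrow> x j \<le> m j"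
    and n1: "\<And>j. j \<in> {1..p} \<Longrightarrow> 1 - c j * c j / q \<noteq> 0"
    and n2: "\<And>j. j \<in> {1..p} \<Longrightarrow> starprod q s (m j) (c j) 0 \<noteq> 0"
    and n3: "\<And>j k. j \<in> {1..p} \<Longrightarrow> k \<in> {1..p} \<Longrightarrow> j \<noteq> k \<Longrightarrow> rowprod q s (c k) (m k) (c j) 0 \<noteq> 0"
    and n4: "\<And>j k. j \<in> {1..p} \<Longrightarrow> k \<in> {1..p} \<Longrightarrow> qp q (q * c j / c k) (x j) \<noteq> 0"
    and n5: "\<And>j k. j \<in> {1..p} \<Longrightarrow> k \<in> {1..p} \<Longrightarrow> qp q (q ^ m k * c j * c k) (x j) \<noteq> 0"
    and \<beta>: "\<And>j i. j \<in> {1..p} \<Longrightarrow> i < m j \<Longrightarrow>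
        - \<beta> j i = \<alpha> j i * (- A * (\<Prod>k\<in>K. (1 - c j / a k * q ^ i) / (1 - c j * a k * q ^ i)))"
  defines "T \<equiv> \<lambda>x. (\<Prod>j=1..p. (\<Prod>i<x j. - \<beta> j i) * (\<Prod>i\<in>{x j..<m j}. \<alpha> j i))
       * vdm (concat (map (\<lambda>j. map (\<lambda>i. eps (c j * q ^ i / s)) (missing (m j) (x j))) [1..<Suc p]))"
  shows "T x = T (\<lambda>_. 0) * (W p (\<lambda>j. c j * q ^ x j / s) / W p (\<lambda>j. c j / s)
       * (\<Prod>k\<in>K. \<Prod>j=1..p. qp q (c j / a k) (x j) / qp q (c j * a k) (x j))
       * (\<Prod>j=1..p. \<Prod>k=1..p. (qp q (c j * c k / q) (x j) * qp q (c j / (c k * q ^ m k)) (x j))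
            / (qp q (q * c j / c k) (x j) * qp q (q ^ m k * c j * c k) (x j)))
       * (A * q ^ (\<Sum>j=1..p. m j)) ^ (\<Sum>j=1..p. x j))"
proof -
  have q0: "q \<noteq> 0" using s by auto
  define E where "E j i = eps (c j * q ^ i / s)" for j i
  define S where "S j x = ppair (\<lambda>i l. E j i - E j l) (missing (m j) x)" for j x
  define Cr where "Cr j k x y = (\<Prod>l\<in>{..m k} - {y}. \<Prod>i\<in>{..m j} - {x}. E k l - E j i)" for j k x y
  define G where "G j k = (qp q (c j * c k / q) (x j) * qp q (c j / (c k * q ^ m k)) (x j))
            / (qp q (q * c j / c k) (x j) * qp q (q ^ m k * c j * c k) (x j))" for j k
  define P where "P j = (\<Prod>k\<in>K. qp q (c j / a k) (x j) / qp q (c j * a k) (x j))" for j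
  define w where "w j = (1 - c j * c j / q * q ^ (2 * x j)) / (1 - c j * c j / q)" for j
  define v where "v j k = (E k (x k) - E j (x j)) / (E k 0 - E j 0)" for j k
  define cf where "cf j x = (\<Prod>i<x. - \<beta> j i) * (\<Prod>i\<in>{x..<m j}. \<alpha> j i)" for j x
  have T: "T x = (\<Prod>j=1..p. cf j (x j)) * ((\<Prod>k=1..p. S k (x k)) * (\<Prod>k=1..p. \<Prod>j=1..<k. Cr j k (x j) (x k)))"
    if "\<And>j. j \<in> {1..p} \<Longrightarrow> x j \<le> m j" for x
    unfolding T_def cf_def S_def Cr_def E_def using vdm_blocks[OF that, where E = "\<lambda>j i. eps (c j * q ^ i / s)"]
    by simp
  have cf: "cf j (x j) = cf j 0 * ((- 1) ^ x j * A ^ x j * P j)" if j: "j \<in> {1..p}" for j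
  proof -
    have "(\<Prod>i<x j. - \<beta> j i) = (\<Prod>i<x j. \<alpha> j i * (- A * (\<Prod>k\<in>K. (1 - c j / a k * q ^ i) / (1 - c j * a k * q ^ i))))"
      using x[OF j] by (intro prod.cong refl \<beta>[OF j]) auto
    also have "\<dots> = (\<Prod>i<x j. \<alpha> j i) * ((- A) ^ x j * (\<Prod>k\<in>K. \<Prod>i<x j. (1 - c j / a k * q ^ i) / (1 - c j * a k * q ^ i)))"
      unfolding prod.distrib by (subst prod.swap) simp
    also have "(\<Prod>k\<in>K. \<Prod>i<x j. (1 - c j / a k * q ^ i) / (1 - c j * a k * q ^ i)) = P j"
      unfolding P_def qp_def prod_dividef ..
    also have "(- A) ^ x j = (- 1) ^ x j * A ^ x j" by (rule power_minus)
    finally have "cf j (x j) = ((\<Prod>i<x j. \<alpha> j i) * (\<Prod>i\<in>{x j..<m j}. \<alpha> j i)) * ((- 1) ^ x j * A ^ x j * P j)"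
      unfolding cf_def by (simp only: mult_ac)
    also have "(\<Prod>i<x j. \<alpha> j i) * (\<Prod>i\<in>{x j..<m j}. \<alpha> j i) = cf j 0"
      unfolding cf_def using prod.atLeastLessThan_concat[of 0 "x j" "m j" "\<alpha> j"] x[OF j]
      by (simp add: atLeast0LessThan)
    finally show ?thesis .
  qed
  have S: "S j (x j) = S j 0 * ((- 1) ^ x j * q ^ (x j * m j) * G j j * w j)" if j: "j \<in> {1..p}" for j
  proof -
    have a: "c j / (c j * q ^ m j) = 1 / q ^ m j" "q * c j / c j = q" using c[OF j] by simp_all
    have "qp q q (x j) \<noteq> 0" using n4[OF j j] unfolding a .
    from selfprod_ratio[OF s c[OF j] x[OF j] n1[OF j] n2[OF j] this n5[OF j j]]
    show ?thesis unfolding S_def E_def G_def w_def a .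
  qed
  have Cr: "Cr j k (x j) (x k) = Cr j k 0 0 * (v j k * (q ^ x j * q ^ x k) * (q ^ (x j * m k) * q ^ (x k * m j)) * (G j k * G k j))"
    if j: "j \<in> {1..p}" and k: "k \<in> {1..p}" and jk: "j \<noteq> k" for j k
  proof -
    have "Cr j k (x j) (x k) = Cr j k 0 0 * v j k * (q ^ (x j * (m k + 1)) * G j k) * (q ^ (x k * (m j + 1)) * G k j)"
      unfolding Cr_def v_def G_def E_def
      by (rule crossprod_ratio[OF s c[OF j] c[OF k] x[OF j] x[OF k] n3[OF j k jk] n3[OF k j jk[symmetric]]
          n4[OF j k] n5[OF j k] n4[OF k j] n5[OF k j]])
    moreover have "q ^ (x j * (m k + 1)) = q ^ (x j * m k) * q ^ x j" for j k by (simp add: power_add algebra_simps)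
    ultimately show ?thesis by (simp only: mult_ac)
  qed
  have Wr: "W p (\<lambda>j. c j * q ^ x j / s) / W p (\<lambda>j. c j / s) = (\<Prod>j=1..p. w j) * (\<Prod>k=1..p. \<Prod>j=1..<k. v j k * (q ^ x j * q ^ x k))"
  proof -
    have e: "c j * q ^ y / s * (c j * q ^ y / s) = c j * c j / q * q ^ (2 * y)" for j y
    proof -
      have "c j * q ^ y / s * (c j * q ^ y / s) = c j * c j * (q ^ y * q ^ y) / s\<^sup>2"
        by (simp add: power2_eq_square mult_ac)
      thus ?thesis unfolding s(2) mult_2 power_add by simp
    qed
    have W1: "W p (\<lambda>j. c j * q ^ y j / s) = (\<Prod>j=1..p. 1 - c j * c j / q * q ^ (2 * y j))
       * (\<Prod>k=1..p. \<Prod>j=1..<k. c j * q ^ y j / s * (c k * q ^ y k / s) * (E k (y k) - E j (y j)))" for y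
      unfolding E_def e[symmetric] by (rule W_eps) (use c q0 s in auto)
    have W0: "W p (\<lambda>j. c j / s) = (\<Prod>j=1..p. 1 - c j * c j / q)
       * (\<Prod>k=1..p. \<Prod>j=1..<k. c j / s * (c k / s) * (E k 0 - E j 0))"
      using W1[of "\<lambda>_. 0"] by simp
    have "W p (\<lambda>j. c j * q ^ x j / s) / W p (\<lambda>j. c j / s)
       = (\<Prod>j=1..p. w j) * (\<Prod>k=1..p. \<Prod>j=1..<k. (c j * q ^ x j / s * (c k * q ^ x k / s) * (E k (x k) - E j (x j)))
            / (c j / s * (c k / s) * (E k 0 - E j 0)))"
      unfolding W1 W0 w_def prod_dividef by simp
    also have "(\<Prod>k=1..p. \<Prod>j=1..<k. (c j * q ^ x j / s * (c k * q ^ x k / s) * (E k (x k) - E j (x j)))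
            / (c j / s * (c k / s) * (E k 0 - E j 0))) = (\<Prod>k=1..p. \<Prod>j=1..<k. v j k * (q ^ x j * q ^ x k))"
    proof (intro prod.cong refl)
      fix k j assume "k \<in> {1..p}" "j \<in> {1..<k}"
      hence "c j \<noteq> 0" "c k \<noteq> 0" using c by auto
      thus "(c j * q ^ x j / s * (c k * q ^ x k / s) * (E k (x k) - E j (x j)))
            / (c j / s * (c k / s) * (E k 0 - E j 0)) = v j k * (q ^ x j * q ^ x k)"
        unfolding v_def using s(1) by simp
    qed
    finally show ?thesis .
  qed
  have qM: "(\<Prod>j=1..p. q ^ (x j * m j)) * (\<Prod>k=1..p. \<Prod>j=1..<k. q ^ (x j * m k) * q ^ (x k * m j))
      = (q ^ (\<Sum>j=1..p. m j)) ^ (\<Sum>j=1..p. x j)"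
  proof -
    have "(\<Prod>j=1..p. \<Prod>k=1..p. q ^ (x j * m k)) = (\<Prod>j=1..p. (q ^ (\<Sum>k=1..p. m k)) ^ x j)"
      by (simp add: power_sum sum_distrib_left power_mult[symmetric] mult.commute flip: power_sum)
    also have "\<dots> = (q ^ (\<Sum>j=1..p. m j)) ^ (\<Sum>j=1..p. x j)" by (rule power_sum[symmetric])
    finally show ?thesis using prod_square_split[of "\<lambda>j k. q ^ (x j * m k)" p] by simp
  qed
  have TX: "T x = (\<Prod>j=1..p. cf j (x j)) * ((\<Prod>k=1..p. S k (x k)) * (\<Prod>k=1..p. \<Prod>j=1..<k. Cr j k (x j) (x k)))"
    by (rule T) (rule x)
  have "T x = (\<Prod>j=1..p. cf j 0 * ((- 1) ^ x j * A ^ x j * P j)) * ((\<Prod>j=1..p. S j 0 * ((- 1) ^ x j * q ^ (x j * m j) * G j j * w j))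
     * (\<Prod>k=1..p. \<Prod>j=1..<k. Cr j k 0 0 * (v j k * (q ^ x j * q ^ x k) * (q ^ (x j * m k) * q ^ (x k * m j)) * (G j k * G k j))))"
    unfolding TX
  proof (intro arg_cong2[of _ _ _ _ "(*)"] prod.cong refl cf S Cr)
  qed auto
  also have "\<dots> = ((\<Prod>j=1..p. cf j 0) * ((\<Prod>j=1..p. S j 0) * (\<Prod>k=1..p. \<Prod>j=1..<k. Cr j k 0 0)))
     * (((\<Prod>j=1..p. w j) * (\<Prod>k=1..p. \<Prod>j=1..<k. v j k * (q ^ x j * q ^ x k)))
       * (\<Prod>j=1..p. P j) * ((\<Prod>j=1..p. G j j) * (\<Prod>k=1..p. \<Prod>j=1..<k. G j k * G k j))
       * ((\<Prod>j=1..p. A ^ x j) * ((\<Prod>j=1..p. q ^ (x j * m j)) * (\<Prod>k=1..p. \<Prod>j=1..<k. q ^ (x j * m k) * q ^ (x k * m j)))))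
     * ((\<Prod>j=1..p. (- 1) ^ x j) * (\<Prod>j=1..p. (- 1) ^ x j))"
    unfolding prod.distrib by (simp only: mult_ac)
  also have "(\<Prod>j=1..p. (- 1) ^ x j) * (\<Prod>j=1..p. (- 1) ^ x j) = (1 :: complex)"
    unfolding prod.distrib[symmetric] by (simp flip: power_mult_distrib)
  also have "(\<Prod>j=1..p. cf j 0) * ((\<Prod>j=1..p. S j 0) * (\<Prod>k=1..p. \<Prod>j=1..<k. Cr j k 0 0)) = T (\<lambda>_. 0)"
    by (rule T[symmetric]) simp
  also have "(\<Prod>j=1..p. A ^ x j) = A ^ (\<Sum>j=1..p. x j)" by (rule power_sum[symmetric])
  also have "(\<Prod>j=1..p. P j) = (\<Prod>k\<in>K. \<Prod>j=1..p. qp q (c j / a k) (x j) / qp q (c j * a k) (x j))"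
    unfolding P_def by (rule prod.swap)
  finally show ?thesis
    unfolding qM Wr[symmetric] prod_square_split[of G, symmetric] power_mult_distrib[symmetric] mult_1_right
    unfolding G_def .
qed

section \<open>The expansion term with \<open>x = 0\<close>\<close>

lemma ppair_cong:
  assumes "\<And>a b. a \<in> set xs \<Longrightarrow> b \<in> set xs \<Longrightarrow> g a b = h a b"
  shows "ppair g xs = ppair h xs"
  unfolding ppair_def using assms by (intro prod.cong refl) auto

lemma ppair_mult: "ppair (\<lambda>a b. g a b * h a b) xs = ppair g xs * ppair h xs"
  by (simp add: ppair_def prod.distrib)

lemma ppair_const: "ppair (\<lambda>_ _. k) xs = (\<Prod>i<length xs. k ^ i)"
  by (simp add: ppair_def)

lemma ppair_upt: "ppair g [0..<m] = (\<Prod>l<m. \<Prod>i<l. g l i)"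
  unfolding ppair_def by (intro prod.cong) auto

lemma prod_list_upt: "(\<Prod>i\<leftarrow>[0..<m]. f i) = (\<Prod>i<m. f i :: complex)"
  by (induction m) (simp_all add: mult.commute)

text \<open>Compares nodes shifted by half a step with the insertion points themselves: for x = 0
  the surviving nodes c q^(i+1)/s are the points c q^i times \<open>s\<close>.\<close>

lemma eps_diff_shift:
  assumes "s \<noteq> 0" "s\<^sup>2 = q" "t \<noteq> 0" "u \<noteq> 0" "t * u \<noteq> 1"
  shows "eps (t * s) - eps (u * s) = 1 / s * ((1 - q * t * u) / (1 - t * u)) * (eps t - eps u)"
proof -
  have "eps (t * s) - eps (u * s) = (t * s - u * s) * (1 - 1 / (q * t * u))"
    using assms by (subst eps_diff) (auto simp: power2_eq_square mult_ac)
  also have "\<dots> = 1 / s * (- (1 - q * t * u) / (t * u)) * (t - u)"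
    using assms(1,3,4) unfolding assms(2)[symmetric] by (simp add: field_simps power2_eq_square)
  also have "- (1 - q * t * u) / (t * u) = (1 - q * t * u) / (1 - t * u) * (1 - 1 / (t * u))"
    using assms(3-5) by (simp add: divide_simps) (simp add: algebra_simps)
  finally show ?thesis using assms(3,4) by (simp add: eps_diff mult_ac)
qed

text \<open>The case l = 0 is separate because the assumption then says nothing about 1 - C.\<close>

lemma prod_quotient_telescope:
  fixes C q :: complex
  assumes "\<And>i. i < l \<Longrightarrow> 1 - C * q ^ i \<noteq> 0"
  shows "(\<Prod>i<l. (1 - C * q ^ Suc i) / (1 - C * q ^ i)) = (if l = 0 then 1 else (1 - C * q ^ l) / (1 - C))"
  using assms
proof (induction l)
  case (Suc l)
  have "1 - C * q ^ l \<noteq> 0" using Suc.prems[of l] by simp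
  moreover have "1 - C \<noteq> 0" using Suc.prems[of 0] by simp
  ultimately show ?case using Suc by (cases "l = 0") simp_all
qed simp

text \<open>By \<open>eps_diff_shift\<close> both Vandermonde products differ by quotients (1 - q t
  u)/(1 - t u), which telescope along each block. Within a block this leaves 1/(c_j^2)_(m_j), once
  the factors 1 - c_j^2 q^(2i) of the row coefficients are taken in; two different blocks leave the
  quotient with (c_j c_k)_(m_j + m_k).\<close>

lemma expansion_term_0:
  fixes q s :: complex and c :: "nat \<Rightarrow> complex" and m :: "nat \<Rightarrow> nat"
  assumes s: "s \<noteq> 0" "s\<^sup>2 = q" and c: "\<And>j. j \<in> {1..p} \<Longrightarrow> c j \<noteq> 0"
    and nz: "\<And>j k. j \<in> {1..p} \<Longrightarrow> k \<in> {1..p} \<Longrightarrow> qp q (c j * c k) (m j + m k) \<noteq> 0"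
  defines "ts \<equiv> concat (map (\<lambda>j. map (\<lambda>i. c j * q ^ i) [0..<m j]) [1..<Suc p])"
  shows "vdm (concat (map (\<lambda>j. map (\<lambda>i. eps (c j * q ^ i / s)) (missing (m j) 0)) [1..<Suc p]))
       * (\<Prod>j=1..p. \<Prod>i<m j. 1 / (1 - c j * c j * q ^ (2 * i)))
     = (\<Prod>i<length ts. (1 / s) ^ i) * vdm (map eps ts)
       * (\<Prod>j=1..p. 1 / qp q (c j * c j) (m j))
       * (\<Prod>k=1..p. \<Prod>j=1..<k. qp q (c j * c k) (m j + m k) / (qp q (c j * c k) (m j) * qp q (c j * c k) (m k)))"
proof -
  have q0: "q \<noteq> 0" using s by auto
  have ne: "c j * c k * q ^ i \<noteq> 1" if "j \<in> {1..p}" "k \<in> {1..p}" "i < m j + m k" for j k i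
    using nz[OF that(1,2)] that(3) unfolding qp_eq_0_iff by blast
  let ?pr = "\<lambda>t u. (1 - q * t * u) / (1 - t * u)"
  have ts: "\<exists>j\<in>{1..p}. \<exists>i<m j. t = c j * q ^ i" if "t \<in> set ts" for t
    using that unfolding ts_def by (fastforce simp: less_Suc_eq_le simp del: upt_Suc)
  have ts_nz: "t \<noteq> 0" if "t \<in> set ts" for t using ts[OF that] c q0 by auto
  have ts_ne: "t * u \<noteq> 1" if "t \<in> set ts" "u \<in> set ts" for t u
  proof -
    from ts[OF that(1)] obtain j i where 1: "j \<in> {1..p}" "i < m j" "t = c j * q ^ i" by blast
    from ts[OF that(2)] obtain k l where 2: "k \<in> {1..p}" "l < m k" "u = c k * q ^ l" by blast
    have "t * u = c j * c k * q ^ (i + l)" unfolding 1 2 by (simp add: power_add)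
    thus ?thesis using ne[OF 1(1) 2(1), of "i + l"] 1(2) 2(2) by simp
  qed
  have "c j * q ^ Suc i / s = c j * q ^ i * s" for j i
    using s unfolding s(2)[symmetric] by (simp add: power2_eq_square mult_ac)
  hence "map (\<lambda>i. eps (c j * q ^ i / s)) (missing (m j) 0) = map (\<lambda>t. eps (t * s)) (map (\<lambda>i. c j * q ^ i) [0..<m j])" for j
    unfolding missing_0 by (simp del: power_Suc)
  hence "vdm (concat (map (\<lambda>j. map (\<lambda>i. eps (c j * q ^ i / s)) (missing (m j) 0)) [1..<Suc p]))
      = vdm (map (\<lambda>t. eps (t * s)) ts)"
    unfolding ts_def map_concat by (simp add: o_def del: upt_Suc)
  also have "\<dots> = ppair (\<lambda>t u. eps (t * s) - eps (u * s)) ts"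
    unfolding vdm_eq_ppair ppair_map ..
  also have "\<dots> = ppair (\<lambda>t u. 1 / s * ?pr t u * (eps t - eps u)) ts"
    by (intro ppair_cong eps_diff_shift s ts_nz ts_ne)
  also have "\<dots> = (\<Prod>i<length ts. (1 / s) ^ i) * ppair ?pr ts * vdm (map eps ts)"
    unfolding ppair_mult ppair_const vdm_eq_ppair ppair_map ..
  finally have 1: "vdm (concat (map (\<lambda>j. map (\<lambda>i. eps (c j * q ^ i / s)) (missing (m j) 0)) [1..<Suc p]))
     = (\<Prod>i<length ts. (1 / s) ^ i) * ppair ?pr ts * vdm (map eps ts)" .
  have self: "ppair ?pr (map (\<lambda>i. c j * q ^ i) [0..<m j]) * (\<Prod>i<m j. 1 / (1 - c j * c j * q ^ (2 * i)))
     = 1 / qp q (c j * c j) (m j)" if j: "j \<in> {1..p}" for j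
  proof -
    have "(\<Prod>i<l. ?pr (c j * q ^ l) (c j * q ^ i)) = (1 - c j * c j * q ^ (2 * l)) / (1 - c j * c j * q ^ l)" if l: "l < m j" for l
    proof -
      have "(\<Prod>i<l. ?pr (c j * q ^ l) (c j * q ^ i)) = (\<Prod>i<l. (1 - c j * c j * q ^ l * q ^ Suc i) / (1 - c j * c j * q ^ l * q ^ i))"
        by (intro prod.cong refl) (simp add: mult_ac)
      also have "\<dots> = (if l = 0 then 1 else (1 - c j * c j * q ^ l * q ^ l) / (1 - c j * c j * q ^ l))"
      proof (rule prod_quotient_telescope)
        fix i assume "i < l"
        thus "1 - c j * c j * q ^ l * q ^ i \<noteq> 0"
          using ne[OF j j, of "l + i"] l by (simp add: power_add mult_ac)
      qed
      also have "\<dots> = (1 - c j * c j * q ^ (2 * l)) / (1 - c j * c j * q ^ l)"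
        unfolding mult_2 power_add using ne[OF j j, of 0] l by (auto simp: mult_ac)
      finally show ?thesis .
    qed
    hence "ppair ?pr (map (\<lambda>i. c j * q ^ i) [0..<m j]) = (\<Prod>l<m j. (1 - c j * c j * q ^ (2 * l)) / (1 - c j * c j * q ^ l))"
      unfolding ppair_map ppair_upt by (intro prod.cong refl) simp
    hence "ppair ?pr (map (\<lambda>i. c j * q ^ i) [0..<m j]) * (\<Prod>i<m j. 1 / (1 - c j * c j * q ^ (2 * i)))
       = (\<Prod>l<m j. (1 - c j * c j * q ^ (2 * l)) / (1 - c j * c j * q ^ l) * (1 / (1 - c j * c j * q ^ (2 * l))))"
      by (simp only: prod.distrib)
    also have "\<dots> = (\<Prod>l<m j. 1 / (1 - c j * c j * q ^ l))"
    proof (intro prod.cong refl)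
      fix l assume "l \<in> {..<m j}"
      thus "(1 - c j * c j * q ^ (2 * l)) / (1 - c j * c j * q ^ l) * (1 / (1 - c j * c j * q ^ (2 * l))) = 1 / (1 - c j * c j * q ^ l)"
        using ne[OF j j, of "2 * l"] by simp
    qed
    finally show ?thesis by (simp add: qp_def prod_dividef)
  qed
  have cross: "(\<Prod>y\<leftarrow>map (\<lambda>i. c k * q ^ i) [0..<m k]. \<Prod>x\<leftarrow>map (\<lambda>i. c j * q ^ i) [0..<m j]. ?pr y x)
     = qp q (c j * c k) (m j + m k) / (qp q (c j * c k) (m j) * qp q (c j * c k) (m k))" if j: "j \<in> {1..p}" and k: "k \<in> {1..p}" for j k
  proof -
    have "(\<Prod>y\<leftarrow>map (\<lambda>i. c k * q ^ i) [0..<m k]. \<Prod>x\<leftarrow>map (\<lambda>i. c j * q ^ i) [0..<m j]. ?pr y x)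
       = (\<Prod>l<m k. \<Prod>i<m j. ?pr (c k * q ^ l) (c j * q ^ i))"
      by (simp add: o_def prod_list_upt)
    also have "\<dots> = (\<Prod>l<m k. (1 - c j * c k * q ^ m j * q ^ l) / (1 - c j * c k * q ^ l))"
    proof (intro prod.cong refl)
      fix l assume l: "l \<in> {..<m k}"
      have "(\<Prod>i<m j. ?pr (c k * q ^ l) (c j * q ^ i)) = (\<Prod>i<m j. (1 - c j * c k * q ^ l * q ^ Suc i) / (1 - c j * c k * q ^ l * q ^ i))"
        by (intro prod.cong refl) (simp add: mult_ac)
      also have "\<dots> = (if m j = 0 then 1 else (1 - c j * c k * q ^ l * q ^ m j) / (1 - c j * c k * q ^ l))"
      proof (rule prod_quotient_telescope)
        fix i assume "i < m j"
        thus "1 - c j * c k * q ^ l * q ^ i \<noteq> 0"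
          using ne[OF j k, of "l + i"] l by (simp add: power_add mult_ac)
      qed
      also have "\<dots> = (1 - c j * c k * q ^ m j * q ^ l) / (1 - c j * c k * q ^ l)"
        using ne[OF j k, of l] l by (auto simp: mult_ac)
      finally show "(\<Prod>i<m j. ?pr (c k * q ^ l) (c j * q ^ i)) = (1 - c j * c k * q ^ m j * q ^ l) / (1 - c j * c k * q ^ l)" .
    qed
    also have "\<dots> = qp q (c j * c k * q ^ m j) (m k) / qp q (c j * c k) (m k)"
      unfolding qp_def prod_dividef ..
    also have "\<dots> = qp q (c j * c k) (m j + m k) / (qp q (c j * c k) (m j) * qp q (c j * c k) (m k))"
      using nz[OF j k] unfolding qp_add by simp
    finally show ?thesis .
  qed
  have "ppair ?pr ts * (\<Prod>j=1..p. \<Prod>i<m j. 1 / (1 - c j * c j * q ^ (2 * i)))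
     = (\<Prod>j=1..p. ppair ?pr (map (\<lambda>i. c j * q ^ i) [0..<m j]) * (\<Prod>i<m j. 1 / (1 - c j * c j * q ^ (2 * i))))
       * (\<Prod>k=1..p. \<Prod>j=1..<k. \<Prod>y\<leftarrow>map (\<lambda>i. c k * q ^ i) [0..<m k]. \<Prod>x\<leftarrow>map (\<lambda>i. c j * q ^ i) [0..<m j]. ?pr y x)"
    unfolding ts_def ppair_concat prod.distrib[of "\<lambda>j. ppair ?pr (map (\<lambda>i. c j * q ^ i) [0..<m j])"] by (simp only: mult_ac)
  also have "(\<Prod>j=1..p. ppair ?pr (map (\<lambda>i. c j * q ^ i) [0..<m j]) * (\<Prod>i<m j. 1 / (1 - c j * c j * q ^ (2 * i))))
     = (\<Prod>j=1..p. 1 / qp q (c j * c j) (m j))"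
    by (intro prod.cong refl self)
  also have "(\<Prod>k=1..p. \<Prod>j=1..<k. \<Prod>y\<leftarrow>map (\<lambda>i. c k * q ^ i) [0..<m k]. \<Prod>x\<leftarrow>map (\<lambda>i. c j * q ^ i) [0..<m j]. ?pr y x)
    = (\<Prod>k=1..p. \<Prod>j=1..<k. qp q (c j * c k) (m j + m k) / (qp q (c j * c k) (m j) * qp q (c j * c k) (m k)))"
    by (intro prod.cong refl cross) auto
  finally have 2: "ppair ?pr ts * (\<Prod>j=1..p. \<Prod>i<m j. 1 / (1 - c j * c j * q ^ (2 * i)))
     = (\<Prod>j=1..p. 1 / qp q (c j * c j) (m j))
      * (\<Prod>k=1..p. \<Prod>j=1..<k. qp q (c j * c k) (m j + m k) / (qp q (c j * c k) (m j) * qp q (c j * c k) (m k)))" .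
  have "vdm (concat (map (\<lambda>j. map (\<lambda>i. eps (c j * q ^ i / s)) (missing (m j) 0)) [1..<Suc p]))
       * (\<Prod>j=1..p. \<Prod>i<m j. 1 / (1 - c j * c j * q ^ (2 * i)))
     = (\<Prod>i<length ts. (1 / s) ^ i) * vdm (map eps ts) * (ppair ?pr ts * (\<Prod>j=1..p. \<Prod>i<m j. 1 / (1 - c j * c j * q ^ (2 * i))))"
    unfolding 1 by (simp only: mult_ac)
  thus ?thesis unfolding 2 by (simp only: mult.assoc)
qed

text \<open>\<open>eps t = eps u\<close> only if t = u or t u = 1. The second is excluded by
  \<open>nz\<close>, the first by \<open>ne\<close> after cancelling the smaller power of q, or by
  |q| < 1 within a block. The product is later divided out.\<close>

lemma vdm_eps_blocks_nonzero:
  fixes q :: complex and c :: "nat \<Rightarrow> complex" and m :: "nat \<Rightarrow> nat"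
  assumes q: "q \<noteq> 0" "norm q < 1" and c: "\<And>j. j \<in> {1..p} \<Longrightarrow> c j \<noteq> 0"
    and nz: "\<And>j k. j \<in> {1..p} \<Longrightarrow> k \<in> {1..p} \<Longrightarrow> qp q (c j * c k) (m j + m k) \<noteq> 0"
    and ne: "\<And>j k l. j \<in> {1..p} \<Longrightarrow> k \<in> {1..p} \<Longrightarrow> j \<noteq> k \<Longrightarrow> l \<le> m k \<Longrightarrow> c k * q ^ l \<noteq> c j"
  shows "vdm (map eps (concat (map (\<lambda>j. map (\<lambda>i. c j * q ^ i) [0..<m j]) [1..<Suc p]))) \<noteq> 0"
proof -
  have inj: "q ^ l \<noteq> q ^ i" if "i < l" for i l
  proof
    assume "q ^ l = q ^ i"
    hence "norm q ^ l = norm q ^ i" by (metis norm_power)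
    moreover have "norm q ^ l < norm q ^ i" using that q by (intro power_strict_decreasing) auto
    ultimately show False by simp
  qed
  have d: "eps (c k * q ^ l) - eps (c j * q ^ i) \<noteq> 0"
    if jk: "j \<in> {1..p}" "k \<in> {1..p}" and il: "i < m j" "l < m k" and neq: "c k * q ^ l \<noteq> c j * q ^ i" for j k i l
  proof -
    have "c j * c k * q ^ (i + l) \<noteq> 1" using nz[OF jk] il unfolding qp_eq_0_iff by auto
    hence "c k * q ^ l * (c j * q ^ i) \<noteq> 1" by (simp add: power_add mult_ac)
    thus ?thesis using neq c[OF jk(1)] c[OF jk(2)] q by (subst eps_diff) auto
  qed
  have n1: "c j * q ^ l \<noteq> c j * q ^ i" if "j \<in> {1..p}" "i < l" for j i l using inj[OF that(2)] c[OF that(1)] by simp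
  have n2: "c k * q ^ l \<noteq> c j * q ^ i" if jk: "j \<in> {1..p}" "k \<in> {1..p}" "j \<noteq> k" and il: "i < m j" "l < m k" for j k i l
  proof (cases "i \<le> l")
    case True
    have "c k * q ^ (l - i) \<noteq> c j" using ne[OF jk] il by simp
    moreover have "c k * q ^ l = c k * q ^ (l - i) * q ^ i" using True by (simp flip: power_add)
    ultimately show ?thesis using q by (metis mult_right_cancel power_not_zero)
  next
    case False
    have "c j * q ^ (i - l) \<noteq> c k" using ne[OF jk(2,1)] jk(3) il by auto
    moreover have "c j * q ^ i = c j * q ^ (i - l) * q ^ l" using False by (simp flip: power_add)
    ultimately show ?thesis using q by (metis mult_right_cancel power_not_zero)
  qed
  have "(\<Prod>k=1..p. \<Prod>l<m k. \<Prod>i<l. eps (c k * q ^ l) - eps (c k * q ^ i)) \<noteq> 0"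
    unfolding prod_zero_iff[OF finite_atLeastAtMost] prod_zero_iff[OF finite_lessThan]
    using d n1 by (metis atLeastAtMost_iff lessThan_iff less_trans)
  moreover have "(\<Prod>k=1..p. \<Prod>j=1..<k. \<Prod>l<m k. \<Prod>i<m j. eps (c k * q ^ l) - eps (c j * q ^ i)) \<noteq> 0"
    unfolding prod_zero_iff[OF finite_atLeastAtMost] prod_zero_iff[OF finite_atLeastLessThan] prod_zero_iff[OF finite_lessThan]
    using d n2 by (auto simp del: right_minus_eq)
  ultimately show ?thesis
    unfolding vdm_eq_ppair ppair_map ppair_concat ppair_upt
    by (simp add: o_def prod_list_upt)
qed

section \<open>Shifted factorials with integer index and one-variable factors\<close>

lemma qpoch_uminus_of_nat: "qpoch q x (- int N) = 1 / (\<Prod>i=1..N. 1 - x * q powi (- int i))"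
  by (cases "N = 0") (simp_all add: qpoch_def)

lemma qpoch_neg_nonzeroD:
  assumes "y < 0" "qpoch q x y \<noteq> 0"
  shows "1 - x * q powi y \<noteq> 0"
proof -
  define N where "N = nat (- y - 1)"
  have y: "y = - int (Suc N)" using assms(1) by (simp add: N_def)
  have "(\<Prod>i=1..Suc N. 1 - x * q powi (- int i)) \<noteq> 0"
    using assms(2) unfolding y qpoch_uminus_of_nat by auto
  thus ?thesis unfolding y by simp
qed

text \<open>For y < 0 the factor 1 - x q^y stands in the denominator of (x)_y and cancels only if it
  is non-zero; otherwise the right side is 0 by the convention on division.\<close>

lemma qpoch_step:
  assumes "0 \<le> y \<or> 1 - x * q powi y \<noteq> 0"
  shows "qpoch q x (y + 1) = qpoch q x y * (1 - x * q powi y)"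
proof (cases "0 \<le> y")
  case True
  then obtain N where y: "y = int N" by (metis nonneg_int_cases)
  have "y + 1 = int (Suc N)" using y by simp
  thus ?thesis unfolding y by (simp only: qpoch_of_nat qp_Suc power_int_of_nat)
next
  case False
  define N where "N = nat (- y - 1)"
  have y: "y = - int (Suc N)" using False by (simp add: N_def)
  have y1: "y + 1 = - int N" using y by simp
  have "(\<Prod>i=1..Suc N. 1 - x * q powi (- int i)) = (\<Prod>i=1..N. 1 - x * q powi (- int i)) * (1 - x * q powi y)"
    unfolding y by simp
  thus ?thesis using assms False unfolding y1 unfolding y qpoch_uminus_of_nat by simp
qed

section \<open>The multiple series\<close>

text \<open>The induction moves away from 0: upwards it divides by \<alpha>, downwards by \<beta>,
  so each has to be non-zero on its own side only.\<close>

lemma int_recurrence_unique: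
  fixes f g :: "int \<Rightarrow> complex"
  assumes f: "\<And>y. f (y + 1) * \<alpha> y = f y * \<beta> y" and g: "\<And>y. g (y + 1) * \<alpha> y = g y * \<beta> y"
    and \<alpha>: "\<And>y. 0 \<le> y \<Longrightarrow> \<alpha> y \<noteq> 0" and \<beta>: "\<And>y. y < 0 \<Longrightarrow> \<beta> y \<noteq> 0" and 0: "f 0 = g 0"
  shows "f y = g y"
proof (induction y rule: int_induct[of _ 0])
  case base
  show ?case by (rule 0)
next
  case (step1 i)
  thus ?case using f[of i] g[of i] \<alpha>[of i] by (metis mult_right_cancel)
next
  case (step2 i)
  thus ?case using f[of "i - 1"] g[of "i - 1"] \<beta>[of "i - 1"]
    by (metis diff_add_cancel less_le_trans mult_right_cancel zle_diff1_eq order.refl)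
qed

text \<open>Both sides satisfy one first-order recurrence in y, with coefficients 1 - q u/a and 1/a
  - u, and agree at y = 0. The infinite products at y = 0 are the normalisation between the two
  forms.\<close>

lemma qpoch_quotient_omega:
  fixes q a z :: complex
  assumes q: "q \<noteq> 0" "norm q < 1" and a: "a \<noteq> 0" and z: "z \<noteq> 0"
    and den: "\<And>y. qpoch q (q * z / a) y \<noteq> 0" and wd: "\<And>y. y < 0 \<Longrightarrow> qpoch q (a * z) y \<noteq> 0"
  shows "qpoch q (a * z) y / qpoch q (q * z / a) y * (1 / a) powi y
      * (qpoch_inf q (q * z / a) * qpoch_inf q (q / (a * z)))
    = (- z) powi y * q powi (y * (y - 1) div 2)
      * (qpoch_inf q (q * (1 / a) * (z * q powi y)) * qpoch_inf q (q * (1 / a) / (z * q powi y)))"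
proof (rule int_recurrence_unique[where \<alpha> = "\<lambda>y. 1 - q * z / a * q powi y" and \<beta> = "\<lambda>y. 1 / a - z * q powi y"
    and f = "\<lambda>y. qpoch q (a * z) y / qpoch q (q * z / a) y * (1 / a) powi y
      * (qpoch_inf q (q * z / a) * qpoch_inf q (q / (a * z)))"
    and g = "\<lambda>y. (- z) powi y * q powi (y * (y - 1) div 2)
      * (qpoch_inf q (q * (1 / a) * (z * q powi y)) * qpoch_inf q (q * (1 / a) / (z * q powi y)))"])
  have den': "1 - q * z / a * q powi y \<noteq> 0" for y
  proof (cases "0 \<le> y")
    case True
    thus ?thesis using qpoch_step[of y "q * z / a" q] den[of "y + 1"] by auto
  next
    case False
    show ?thesis by (rule qpoch_neg_nonzeroD[OF _ den]) (use False in simp)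
  qed
  have wd': "1 - a * z * q powi y \<noteq> 0" if "y < 0" for y
    using qpoch_neg_nonzeroD[OF that wd[OF that]] .
  have fac: "1 / a - z * q powi y = 1 / a * (1 - a * z * q powi y)" for y
    using a by (simp add: field_simps)
  show "1 - q * z / a * q powi y \<noteq> 0" for y by (rule den')
  show "1 / a - z * q powi y \<noteq> 0" if "y < 0" for y using wd'[OF that] a unfolding fac by simp
  fix y :: int
  have P: "qpoch q (a * z) (y + 1) = qpoch q (a * z) y * (1 - a * z * q powi y)"
    using wd'[of y] by (intro qpoch_step) linarith
  have Q: "qpoch q (q * z / a) (y + 1) = qpoch q (q * z / a) y * (1 - q * z / a * q powi y)"
    using den'[of y] by (intro qpoch_step) simp
  have b1: "(1 / a) powi (y + 1) = (1 / a) powi y * (1 / a)" using a by (subst power_int_add) auto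
  let ?K = "qpoch_inf q (q * z / a) * qpoch_inf q (q / (a * z))"
  show "qpoch q (a * z) (y + 1) / qpoch q (q * z / a) (y + 1) * (1 / a) powi (y + 1) * ?K * (1 - q * z / a * q powi y)
      = qpoch q (a * z) y / qpoch q (q * z / a) y * (1 / a) powi y * ?K * (1 / a - z * q powi y)"
  proof -
    have "p * r / (x * d) * (w * e) * K * d = p / x * w * K * (e * r)" if "d \<noteq> 0" for p r x d w e K :: complex
      using that by simp
    thus ?thesis unfolding P Q b1 fac using den'[of y] by blast
  qed
  let ?u = "z * q powi y"
  have u: "?u \<noteq> 0" using z q by simp
  have uS: "z * q powi (y + 1) = q * ?u" using q by (simp add: power_int_add)
  have 1: "qpoch_inf q (q * (1 / a) * ?u) = (1 - q * z / a * q powi y) * qpoch_inf q (q * (1 / a) * (q * ?u))"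
    by (subst qpoch_inf_rec[OF q(2)]) (simp add: mult_ac)
  have 2: "qpoch_inf q (q * (1 / a) / (q * ?u)) = (1 - 1 / a / ?u) * qpoch_inf q (q * (1 / a) / ?u)"
    using qpoch_inf_rec[OF q(2), of "1 / a / ?u"] q by simp
  have 3: "(- z) powi (y + 1) = (- z) powi y * (- z)" using z by (subst power_int_add) auto
  have 4: "q powi ((y + 1) * (y + 1 - 1) div 2) = q powi (y * (y - 1) div 2) * q powi y"
  proof -
    have "(y + 1) * (y + 1 - 1) = y * (y - 1) + 2 * y" by (simp add: algebra_simps)
    hence "(y + 1) * (y + 1 - 1) div 2 = y * (y - 1) div 2 + y" by simp
    thus ?thesis using q by (simp add: power_int_add)
  qed
  have 5: "1 / a - ?u = (- z) * q powi y * (1 - 1 / a / ?u)"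
    using u by (simp add: right_diff_distrib)
  show "(- z) powi (y + 1) * q powi ((y + 1) * (y + 1 - 1) div 2)
      * (qpoch_inf q (q * (1 / a) * (z * q powi (y + 1))) * qpoch_inf q (q * (1 / a) / (z * q powi (y + 1)))) * (1 - q * z / a * q powi y)
    = (- z) powi y * q powi (y * (y - 1) div 2)
      * (qpoch_inf q (q * (1 / a) * ?u) * qpoch_inf q (q * (1 / a) / ?u)) * (1 / a - ?u)"
    unfolding uS 1 2 3 4 5 by (simp only: mult_ac)
next
  show "qpoch q (a * z) 0 / qpoch q (q * z / a) 0 * (1 / a) powi 0 * (qpoch_inf q (q * z / a) * qpoch_inf q (q / (a * z)))
    = (- z) powi 0 * q powi (0 * (0 - 1) div 2) * (qpoch_inf q (q * (1 / a) * (z * q powi 0)) * qpoch_inf q (q * (1 / a) / (z * q powi 0)))"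
    by (simp add: qpoch_def mult_ac)
qed

lemma qp_shift: "qp q (x * q) m * (1 - x) = qp q x m * (1 - x * q ^ m)"
  using qp_add[of q x 1 m] qp_Suc[of q x m] by (simp add: qp_Suc[of q x 0] mult_ac)

text \<open>Same method: each factor with c and m becomes (c u)_m (c/u)_m, which is a product of
  differences of nodes. The power q^(m y) is compensated by q^(-|m||y|) in the argument of the
  series.\<close>

lemma qpoch_quotient_insertion:
  fixes q c z :: complex
  assumes q: "q \<noteq> 0" and c: "c \<noteq> 0" and z: "z \<noteq> 0"
    and den: "\<And>y. qpoch q (c * z) y \<noteq> 0" "\<And>y. qpoch q (q powi (1 - int m) * z / c) y \<noteq> 0"
    and wd: "\<And>y. y < 0 \<Longrightarrow> qpoch q (q ^ m * c * z) y \<noteq> 0" "\<And>y. y < 0 \<Longrightarrow> qpoch q (q * z / c) y \<noteq> 0"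
  shows "(qpoch q (q ^ m * c * z) y * qpoch q (q * z / c) y)
       / (qpoch q (c * z) y * qpoch q (q powi (1 - int m) * z / c) y) * (qp q (c * z) m * qp q (c / z) m)
     = (q ^ m) powi y * (qp q (c * (z * q powi y)) m * qp q (c / (z * q powi y)) m)"
proof (rule int_recurrence_unique[where
      \<alpha> = "\<lambda>y. (1 - c * z * q powi y) * (1 - q powi (1 - int m) * z / c * q powi y)"
    and \<beta> = "\<lambda>y. (1 - q ^ m * c * z * q powi y) * (1 - q * z / c * q powi y)"
    and f = "\<lambda>y. (qpoch q (q ^ m * c * z) y * qpoch q (q * z / c) y)
       / (qpoch q (c * z) y * qpoch q (q powi (1 - int m) * z / c) y) * (qp q (c * z) m * qp q (c / z) m)"
    and g = "\<lambda>y. (q ^ m) powi y * (qp q (c * (z * q powi y)) m * qp q (c / (z * q powi y)) m)"])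
  have nz: "1 - x * q powi y \<noteq> 0" if "\<And>y. qpoch q x y \<noteq> 0" for x y
  proof (cases "0 \<le> y")
    case True
    thus ?thesis using qpoch_step[of y x q] that[of "y + 1"] by auto
  next
    case False
    show ?thesis by (rule qpoch_neg_nonzeroD[OF _ that]) (use False in simp)
  qed
  have wd': "1 - q ^ m * c * z * q powi y \<noteq> 0" "1 - q * z / c * q powi y \<noteq> 0" if "y < 0" for y
    using qpoch_neg_nonzeroD[OF that wd(1)[OF that]] qpoch_neg_nonzeroD[OF that wd(2)[OF that]] .
  have den': "1 - c * z * q powi y \<noteq> 0" "1 - q powi (1 - int m) * z / c * q powi y \<noteq> 0" for y
    by (rule nz[OF den(1)], rule nz[OF den(2)])
  show "(1 - c * z * q powi y) * (1 - q powi (1 - int m) * z / c * q powi y) \<noteq> 0" for y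
    using den'[of y] by simp
  show "(1 - q ^ m * c * z * q powi y) * (1 - q * z / c * q powi y) \<noteq> 0" if "y < 0" for y
    using wd'[OF that] by simp
  fix y :: int
  have st: "qpoch q (q ^ m * c * z) (y + 1) = qpoch q (q ^ m * c * z) y * (1 - q ^ m * c * z * q powi y)"
    "qpoch q (q * z / c) (y + 1) = qpoch q (q * z / c) y * (1 - q * z / c * q powi y)"
    "qpoch q (c * z) (y + 1) = qpoch q (c * z) y * (1 - c * z * q powi y)"
    "qpoch q (q powi (1 - int m) * z / c) (y + 1) = qpoch q (q powi (1 - int m) * z / c) y * (1 - q powi (1 - int m) * z / c * q powi y)"
    using wd'[of y] den'[of y] by (intro qpoch_step; linarith?; simp)+
  let ?K = "qp q (c * z) m * qp q (c / z) m"
  have alg: "(p * r * (p' * r')) / (x * d * (x' * d')) * K * (d * d') = (p * p') / (x * x') * K * (r * r')"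
    if "d \<noteq> 0" "d' \<noteq> 0" for p r p' r' x d x' d' K :: complex
    using that by simp
  show "(qpoch q (q ^ m * c * z) (y + 1) * qpoch q (q * z / c) (y + 1))
       / (qpoch q (c * z) (y + 1) * qpoch q (q powi (1 - int m) * z / c) (y + 1)) * ?K
       * ((1 - c * z * q powi y) * (1 - q powi (1 - int m) * z / c * q powi y))
     = (qpoch q (q ^ m * c * z) y * qpoch q (q * z / c) y)
       / (qpoch q (c * z) y * qpoch q (q powi (1 - int m) * z / c) y) * ?K
       * ((1 - q ^ m * c * z * q powi y) * (1 - q * z / c * q powi y))"
    unfolding st by (rule alg[OF den'])
  let ?u = "z * q powi y"
  have u: "?u \<noteq> 0" using z q by simp
  have uS: "z * q powi (y + 1) = ?u * q" using q by (simp add: power_int_add)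
  have 1: "qp q (c * (?u * q)) m * (1 - c * z * q powi y) = qp q (c * ?u) m * (1 - q ^ m * c * z * q powi y)"
    using qp_shift[of q "c * ?u" m] by (simp add: mult_ac)
  \<comment> \<open>In terms of v the two coefficients become multiples of 1 - v and 1 - v q^m, the
    pair exchanged by \<open>qp_shift\<close>.\<close>
  define v where "v = c / (?u * q)"
  have v: "v \<noteq> 0" using c u q by (simp add: v_def)
  have vq: "c / ?u = v * q" using q by (simp add: v_def)
  have d1: "1 - q * z / c * q powi y = - (1 - v) / v"
    using c u q z by (simp add: v_def field_simps)
  have d2: "1 - q powi (1 - int m) * z / c * q powi y = - (1 - v * q ^ m) / (v * q ^ m)"
    using c u q z by (simp add: v_def power_int_diff field_simps)
  have 2: "qp q v m * (1 - q powi (1 - int m) * z / c * q powi y) * q ^ m = qp q (v * q) m * (1 - q * z / c * q powi y)"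
  proof -
    have "qp q v m * (- (1 - v * q ^ m) / (v * q ^ m)) * q ^ m = - (qp q v m * (1 - v * q ^ m)) / v"
      using q v by (simp add: field_simps)
    also have "\<dots> = qp q (v * q) m * (- (1 - v) / v)"
      unfolding qp_shift[symmetric] by (simp only: mult_minus_right times_divide_eq_right minus_divide_left)
    finally show ?thesis unfolding d1 d2 .
  qed
  have 3: "(q ^ m) powi (y + 1) = (q ^ m) powi y * q ^ m" using q by (subst power_int_add) auto
  have "(q ^ m) powi (y + 1) * (qp q (c * (?u * q)) m * qp q v m) * ((1 - c * z * q powi y) * (1 - q powi (1 - int m) * z / c * q powi y))
     = (q ^ m) powi y * (qp q (c * (?u * q)) m * (1 - c * z * q powi y))
       * (qp q v m * (1 - q powi (1 - int m) * z / c * q powi y) * q ^ m)"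
    unfolding 3 by (simp only: mult_ac)
  also have "\<dots> = (q ^ m) powi y * (qp q (c * ?u) m * qp q (v * q) m) * ((1 - q ^ m * c * z * q powi y) * (1 - q * z / c * q powi y))"
    unfolding 1 2 by (simp only: mult_ac)
  finally show "(q ^ m) powi (y + 1) * (qp q (c * (z * q powi (y + 1))) m * qp q (c / (z * q powi (y + 1))) m)
       * ((1 - c * z * q powi y) * (1 - q powi (1 - int m) * z / c * q powi y))
     = (q ^ m) powi y * (qp q (c * ?u) m * qp q (c / ?u) m) * ((1 - q ^ m * c * z * q powi y) * (1 - q * z / c * q powi y))"
    unfolding uS vq v_def[symmetric] .
next
  show "(qpoch q (q ^ m * c * z) 0 * qpoch q (q * z / c) 0)
       / (qpoch q (c * z) 0 * qpoch q (q powi (1 - int m) * z / c) 0) * (qp q (c * z) m * qp q (c / z) m)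
     = (q ^ m) powi 0 * (qp q (c * (z * q powi 0)) m * qp q (c / (z * q powi 0)) m)"
    by (simp add: qpoch_def)
qed

lemma power_int_sum:
  fixes x :: complex
  assumes "x \<noteq> 0"
  shows "x powi (\<Sum>k\<in>A. y k) = (\<Prod>k\<in>A. x powi (y k))"
  by (induction A rule: infinite_finite_induct) (use assms in \<open>simp_all add: power_int_add\<close>)

lemma power_int_prod:
  fixes f :: "'i \<Rightarrow> complex"
  shows "(\<Prod>j\<in>A. f j) powi y = (\<Prod>j\<in>A. f j powi y)"
  by (induction A rule: infinite_finite_induct) (simp_all add: power_int_mult_distrib)

lemma vdm_map_upt: "vdm (map f [1..<Suc n]) = (\<Prod>k=1..n. \<Prod>j=1..<k. f k - f j)"
proof (induction n)
  case (Suc n)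
  have "vdm (map f [1..<Suc (Suc n)]) = vdm (map f [1..<Suc n]) * (\<Prod>j\<leftarrow>[1..<Suc n]. f (Suc n) - f j)"
    unfolding vdm_eq_ppair using ppair_snoc[of "(-)" "map f [1..<Suc n]" "f (Suc n)"] by (simp add: o_def)
  also have "(\<Prod>j\<leftarrow>[1..<Suc n]. f (Suc n) - f j) = (\<Prod>j=1..<Suc n. f (Suc n) - f j)"
    by (subst prod.distinct_set_conv_list[symmetric]) (simp_all del: upt_Suc)
  finally show ?case unfolding Suc by simp
qed (simp add: vdm_def)

text \<open>Each e_k occurs n - 1 times in the factors e_j e_k of the pairs and once more from 1 -
  e_k^2 = e_k (1/e_k - e_k); hence the exponent n.\<close>

lemma W_vdm:
  assumes e: "\<And>k. k \<in> {1..n} \<Longrightarrow> e k \<noteq> 0"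
  shows "W n e = (\<Prod>k=1..n. e k ^ n * (1 / e k - e k)) * vdm (map (\<lambda>k. eps (e k)) [1..<Suc n])"
proof -
  have 1: "(\<Prod>k=1..n. \<Prod>j=1..<k. e j * e k) * (\<Prod>k=1..n. e k) = (\<Prod>k=1..n. e k ^ n)" for n
  proof (induction n)
    case (Suc n)
    have "(\<Prod>k=1..Suc n. \<Prod>j=1..<k. e j * e k) * (\<Prod>k=1..Suc n. e k)
       = ((\<Prod>k=1..n. \<Prod>j=1..<k. e j * e k) * (\<Prod>k=1..n. e k)) * ((\<Prod>j=1..n. e j) * (e (Suc n) ^ n * e (Suc n)))"
      by (simp add: prod.distrib atLeastLessThanSuc_atLeastAtMost mult_ac)
    also have "\<dots> = (\<Prod>k=1..Suc n. e k ^ Suc n)" unfolding Suc by (simp add: prod.distrib mult_ac)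
    finally show ?case .
  qed simp
  have "(\<Prod>k=1..n. e k ^ n * (1 / e k - e k)) = (\<Prod>k=1..n. \<Prod>j=1..<k. e j * e k) * (\<Prod>k=1..n. e k * (1 / e k - e k))"
    unfolding prod.distrib 1[symmetric] by (simp only: mult_ac)
  also have "(\<Prod>k=1..n. e k * (1 / e k - e k)) = (\<Prod>k=1..n. 1 - e k * e k)"
    using e by (intro prod.cong refl) (simp add: right_diff_distrib)
  finally have 2: "(\<Prod>k=1..n. e k ^ n * (1 / e k - e k)) = (\<Prod>k=1..n. \<Prod>j=1..<k. e j * e k) * (\<Prod>k=1..n. 1 - e k * e k)" .
  have "W n e = (\<Prod>j=1..n. 1 - e j * e j) * (\<Prod>k=1..n. \<Prod>j=1..<k. e j * e k * (eps (e k) - eps (e j)))"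
    by (rule W_eps) (rule e)
  also have "(\<Prod>k=1..n. \<Prod>j=1..<k. e j * e k * (eps (e k) - eps (e j)))
     = (\<Prod>k=1..n. \<Prod>j=1..<k. e j * e k) * vdm (map (\<lambda>k. eps (e k)) [1..<Suc n])"
    unfolding vdm_map_upt by (simp only: prod.distrib)
  finally show ?thesis unfolding 2 by (simp only: mult_ac)
qed

text \<open>The normalising products of \<open>qpoch_quotient_omega\<close> and
  \<open>qpoch_quotient_insertion\<close> and the factor W(z) are multiplied onto the summand, so
  that the right side has no y-dependent quotient apart from inverse powers of u.\<close>

lemma summand_eq:
  fixes q A :: complex and a c z :: "nat \<Rightarrow> complex" and m :: "nat \<Rightarrow> nat" and y :: "nat \<Rightarrow> int"
  assumes q: "q \<noteq> 0" "norm q < 1"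
    and a: "\<And>j. j \<in> {1..2*n+2} \<Longrightarrow> a j \<noteq> 0" and c: "\<And>j. j \<in> {1..p} \<Longrightarrow> c j \<noteq> 0" and z: "\<And>k. k \<in> {1..n} \<Longrightarrow> z k \<noteq> 0"
    and Wz: "W n z \<noteq> 0"
    and den_cz: "\<And>j k y. j \<in> {1..p} \<Longrightarrow> k \<in> {1..n} \<Longrightarrow>
          qpoch q (c j * z k) y \<noteq> 0 \<and> qpoch q (q powi (1 - int (m j)) * z k / c j) y \<noteq> 0"
    and den_az: "\<And>j k y. j \<in> {1..2*n+2} \<Longrightarrow> k \<in> {1..n} \<Longrightarrow> qpoch q (q * z k / a j) y \<noteq> 0"
    and wd_cz: "\<And>j k y. j \<in> {1..p} \<Longrightarrow> k \<in> {1..n} \<Longrightarrow> y < 0 \<Longrightarrow>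
          qpoch q (q ^ m j * c j * z k) y \<noteq> 0 \<and> qpoch q (q * z k / c j) y \<noteq> 0"
    and wd_az: "\<And>j k y. j \<in> {1..2*n+2} \<Longrightarrow> k \<in> {1..n} \<Longrightarrow> y < 0 \<Longrightarrow> qpoch q (a j * z k) y \<noteq> 0"
    and A: "A = (\<Prod>j=1..2*n+2. a j)" and M: "M = (\<Sum>j=1..p. m j)"
  shows "W n (\<lambda>k. z k * q powi (y k)) / W n z
         * (\<Prod>k=1..n. \<Prod>j=1..p.
              (qpoch q (q ^ m j * c j * z k) (y k) * qpoch q (q * z k / c j) (y k))
              / (qpoch q (c j * z k) (y k) * qpoch q (q powi (1 - int (m j)) * z k / c j) (y k)))
         * (\<Prod>k=1..n. \<Prod>j=1..2*n+2. qpoch q (a j * z k) (y k) / qpoch q (q * z k / a j) (y k))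
         * (q powi (1 - int M) / A) powi (\<Sum>k=1..n. y k)
         * (W n z * (\<Prod>k=1..n. \<Prod>j=1..2*n+2. qpoch_inf q (q * z k / a j) * qpoch_inf q (q / (a j * z k)))
             * (\<Prod>k=1..n. \<Prod>j=1..p. qp q (c j * z k) (m j) * qp q (c j / z k) (m j)))
      = (\<Prod>k=1..n. z k ^ n)
         * (\<Prod>k=1..n. omega q n (\<lambda>j. 1 / a j) (z k) (y k) * (1 / (z k * q powi y k) - z k * q powi y k))
         * vdm (map (\<lambda>k. eps (z k * q powi y k)) [1..<Suc n])
         * (\<Prod>k=1..n. \<Prod>j=1..p. qp q (c j * (z k * q powi y k)) (m j) * qp q (c j / (z k * q powi y k)) (m j))"
proof -
  let ?u = "\<lambda>k. z k * q powi y k"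
  let ?f1 = "\<lambda>k j. (qpoch q (q ^ m j * c j * z k) (y k) * qpoch q (q * z k / c j) (y k))
              / (qpoch q (c j * z k) (y k) * qpoch q (q powi (1 - int (m j)) * z k / c j) (y k))"
  let ?f2 = "\<lambda>k j. qpoch q (a j * z k) (y k) / qpoch q (q * z k / a j) (y k)"
  let ?g1 = "\<lambda>k j. qp q (c j * z k) (m j) * qp q (c j / z k) (m j)"
  let ?g2 = "\<lambda>k j. qpoch_inf q (q * z k / a j) * qpoch_inf q (q / (a j * z k))"
  let ?h1 = "\<lambda>k j. qp q (c j * ?u k) (m j) * qp q (c j / ?u k) (m j)"
  let ?h2 = "\<lambda>k j. qpoch_inf q (q * (1 / a j) * ?u k) * qpoch_inf q (q * (1 / a j) / ?u k)"
  have u: "?u k \<noteq> 0" if "k \<in> {1..n}" for k using z[OF that] q by simp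
  have x: "q powi (1 - int M) / A = q * (\<Prod>j=1..p. 1 / q ^ m j) * (\<Prod>j=1..2*n+2. 1 / a j)"
  proof -
    have "q powi (1 - int M) = q / q ^ M" using q by (simp add: power_int_diff)
    moreover have "q ^ M = (\<Prod>j=1..p. q ^ m j)" unfolding M by (rule power_sum)
    ultimately show ?thesis unfolding A by (simp add: prod_dividef del: prod.cl_ivl_Suc)
  qed
  have x0: "q powi (1 - int M) / A \<noteq> 0" using q a unfolding A by simp
  have pw: "(q powi (1 - int M) / A) powi (\<Sum>k=1..n. y k)
     = (\<Prod>k=1..n. q powi y k) * (\<Prod>k=1..n. \<Prod>j=1..p. (1 / q ^ m j) powi y k) * (\<Prod>k=1..n. \<Prod>j=1..2*n+2. (1 / a j) powi y k)"
    unfolding power_int_sum[OF x0] unfolding x power_int_mult_distrib power_int_prod prod.distrib ..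
  have 1: "?f1 k j * (1 / q ^ m j) powi y k * ?g1 k j = ?h1 k j" if j: "j \<in> {1..p}" and k: "k \<in> {1..n}" for j k
  proof -
    have "?f1 k j * ?g1 k j = (q ^ m j) powi y k * ?h1 k j"
      by (rule qpoch_quotient_insertion[OF q(1) c[OF j] z[OF k]]) (use den_cz[OF j k] wd_cz[OF j k] in auto)
    moreover have "(1 / q ^ m j) powi y k * (q ^ m j) powi y k = 1"
      using q by (simp flip: power_int_mult_distrib)
    moreover have "?f1 k j * (1 / q ^ m j) powi y k * ?g1 k j = (1 / q ^ m j) powi y k * (?f1 k j * ?g1 k j)"
      by (simp only: mult_ac)
    moreover have "(1 / q ^ m j) powi y k * ((q ^ m j) powi y k * ?h1 k j)
        = ((1 / q ^ m j) powi y k * (q ^ m j) powi y k) * ?h1 k j"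
      by (simp only: mult.assoc)
    ultimately show ?thesis by (simp only: mult_1_left)
  qed
  have 2: "?f2 k j * (1 / a j) powi y k * ?g2 k j = (- z k) powi y k * q powi (y k * (y k - 1) div 2) * ?h2 k j"
    if j: "j \<in> {1..2*n+2}" and k: "k \<in> {1..n}" for j k
    by (rule qpoch_quotient_omega[OF q a[OF j] z[OF k] den_az[OF j k] wd_az[OF j k]])
  have P1: "(\<Prod>k=1..n. \<Prod>j=1..p. ?f1 k j) * (\<Prod>k=1..n. \<Prod>j=1..p. (1 / q ^ m j) powi y k) * (\<Prod>k=1..n. \<Prod>j=1..p. ?g1 k j)
     = (\<Prod>k=1..n. \<Prod>j=1..p. ?h1 k j)"
    unfolding prod.distrib[symmetric] by (intro prod.cong refl 1)
  have P2: "(\<Prod>k=1..n. \<Prod>j=1..2*n+2. ?f2 k j) * (\<Prod>k=1..n. \<Prod>j=1..2*n+2. (1 / a j) powi y k) * (\<Prod>k=1..n. \<Prod>j=1..2*n+2. ?g2 k j)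
     = (\<Prod>k=1..n. (z k powi (2 * y k) * q powi (y k * (y k - 1))) ^ (n + 1) * (\<Prod>j=1..2*n+2. ?h2 k j))"
  proof -
    \<comment> \<open>The 2n + 2 parameters pair up: squaring removes the sign and the halved
      exponent.\<close>
    have sq: "((- z k) powi y k * q powi (y k * (y k - 1) div 2)) ^ (2 * n + 2) = (z k powi (2 * y k) * q powi (y k * (y k - 1))) ^ (n + 1)"
      if k: "k \<in> {1..n}" for k
    proof -
      have "((- z k) powi y k * q powi (y k * (y k - 1) div 2)) ^ (2 * n + 2)
         = (((- z k) powi y k * q powi (y k * (y k - 1) div 2)) ^ 2) ^ (n + 1)"
        by (simp only: power_mult[symmetric] distrib_left mult_1_right)
      also have "((- z k) powi y k * q powi (y k * (y k - 1) div 2)) ^ 2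
         = (- z k) powi (y k + y k) * q powi (y k * (y k - 1) div 2 + y k * (y k - 1) div 2)"
      proof -
        have "(- z k) powi (y k + y k) = (- z k) powi y k * (- z k) powi y k"
          using z[OF k] by (intro power_int_add) simp
        moreover have "q powi (e + e) = q powi e * q powi e" for e
          using q by (intro power_int_add) simp
        ultimately show ?thesis by (simp only: power2_eq_square mult_ac)
      qed
      also have "(- z k) powi (y k + y k) = z k powi (2 * y k)"
        unfolding mult_2[symmetric] by (simp add: power_int_minus_left)
      also have "y k * (y k - 1) div 2 + y k * (y k - 1) div 2 = y k * (y k - 1)"
      proof -
        have "even (y k * (y k - 1))" by simp
        then obtain r where "y k * (y k - 1) = 2 * r" by (rule evenE)
        thus ?thesis by simp
      qed
      finally show ?thesis .
    qed
    have "(\<Prod>k=1..n. \<Prod>j=1..2*n+2. ?f2 k j) * (\<Prod>k=1..n. \<Prod>j=1..2*n+2. (1 / a j) powi y k) * (\<Prod>k=1..n. \<Prod>j=1..2*n+2. ?g2 k j)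
      = (\<Prod>k=1..n. \<Prod>j=1..2*n+2. (- z k) powi y k * q powi (y k * (y k - 1) div 2) * ?h2 k j)"
      unfolding prod.distrib[symmetric] by (intro prod.cong refl 2)
    also have "\<dots> = (\<Prod>k=1..n. ((- z k) powi y k * q powi (y k * (y k - 1) div 2)) ^ (2 * n + 2) * (\<Prod>j=1..2*n+2. ?h2 k j))"
    proof (intro prod.cong refl)
      fix k
      have "(\<Prod>j=1..2*n+2. (- z k) powi y k * q powi (y k * (y k - 1) div 2)) = ((- z k) powi y k * q powi (y k * (y k - 1) div 2)) ^ (2 * n + 2)"
        unfolding prod_constant by simp
      thus "(\<Prod>j=1..2*n+2. (- z k) powi y k * q powi (y k * (y k - 1) div 2) * ?h2 k j)
         = ((- z k) powi y k * q powi (y k * (y k - 1) div 2)) ^ (2 * n + 2) * (\<Prod>j=1..2*n+2. ?h2 k j)"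
        by (simp only: prod.distrib[of _ "\<lambda>j. ?h2 k j"])
    qed
    also have "\<dots> = (\<Prod>k=1..n. (z k powi (2 * y k) * q powi (y k * (y k - 1))) ^ (n + 1) * (\<Prod>j=1..2*n+2. ?h2 k j))"
      by (intro prod.cong refl) (simp only: sq)
    finally show ?thesis .
  qed
  have Wu: "W n (\<lambda>k. ?u k) = (\<Prod>k=1..n. ?u k ^ n * (1 / ?u k - ?u k)) * vdm (map (\<lambda>k. eps (?u k)) [1..<Suc n])"
    by (rule W_vdm[OF u])
  \<comment> \<open>The n + 1 powers of q^y needed to turn y(y-1) into y*y are one from the argument
    of the series and n from u^n.\<close>
  have om: "q powi y k * ((z k powi (2 * y k) * q powi (y k * (y k - 1))) ^ (n + 1) * (\<Prod>j=1..2*n+2. ?h2 k j)) * (?u k ^ n * (1 / ?u k - ?u k))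
     = z k ^ n * (omega q n (\<lambda>j. 1 / a j) (z k) (y k) * (1 / ?u k - ?u k))" for k
  proof -
    have "y k * y k = y k * (y k - 1) + y k" by (simp add: algebra_simps)
    hence "q powi (y k * y k) = q powi (y k * (y k - 1)) * q powi y k"
      using q by (metis power_int_add)
    hence "(z k powi (2 * y k) * q powi (y k * y k)) ^ (n + 1)
       = (z k powi (2 * y k) * q powi (y k * (y k - 1))) ^ (n + 1) * (q powi y k * (q powi y k) ^ n)"
      by (simp add: power_mult_distrib mult_ac)
    hence "z k ^ n * (z k powi (2 * y k) * q powi (y k * y k)) ^ (n + 1)
       = q powi y k * (z k powi (2 * y k) * q powi (y k * (y k - 1))) ^ (n + 1) * ?u k ^ n"
      by (simp only: power_mult_distrib mult_ac)
    moreover have "qy * (b * H) * (un * X) = zn * (a * H * X)" if "zn * a = qy * b * un" for qy b H un X zn a :: complex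
    proof -
      have "qy * (b * H) * (un * X) = (qy * b * un) * (H * X)" by (simp only: mult_ac)
      thus ?thesis unfolding that[symmetric] by (simp only: mult_ac)
    qed
    ultimately show ?thesis unfolding omega_def by blast
  qed
  have "W n (\<lambda>k. ?u k) / W n z * (\<Prod>k=1..n. \<Prod>j=1..p. ?f1 k j) * (\<Prod>k=1..n. \<Prod>j=1..2*n+2. ?f2 k j)
      * (q powi (1 - int M) / A) powi (\<Sum>k=1..n. y k)
      * (W n z * (\<Prod>k=1..n. \<Prod>j=1..2*n+2. ?g2 k j) * (\<Prod>k=1..n. \<Prod>j=1..p. ?g1 k j))
    = W n (\<lambda>k. ?u k) * ((\<Prod>k=1..n. \<Prod>j=1..p. ?f1 k j) * (\<Prod>k=1..n. \<Prod>j=1..p. (1 / q ^ m j) powi y k) * (\<Prod>k=1..n. \<Prod>j=1..p. ?g1 k j))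
      * ((\<Prod>k=1..n. \<Prod>j=1..2*n+2. ?f2 k j) * (\<Prod>k=1..n. \<Prod>j=1..2*n+2. (1 / a j) powi y k) * (\<Prod>k=1..n. \<Prod>j=1..2*n+2. ?g2 k j))
      * (\<Prod>k=1..n. q powi y k)"
  proof -
    have "w / w0 * F1 * F2 * (Q * X1 * X2) * (w0 * G2 * G1) = w * (F1 * X1 * G1) * (F2 * X2 * G2) * Q"
      if "w0 \<noteq> 0" for w w0 F1 F2 Q X1 X2 G1 G2 :: complex
      using that by simp
    thus ?thesis unfolding pw using Wz by blast
  qed
  also have "\<dots> = (\<Prod>k=1..n. q powi y k * ((z k powi (2 * y k) * q powi (y k * (y k - 1))) ^ (n + 1) * (\<Prod>j=1..2*n+2. ?h2 k j)) * (?u k ^ n * (1 / ?u k - ?u k)))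
      * vdm (map (\<lambda>k. eps (?u k)) [1..<Suc n]) * (\<Prod>k=1..n. \<Prod>j=1..p. ?h1 k j)"
  proof -
    have "(\<Prod>k=1..n. f k * g k * h k) = (\<Prod>k=1..n. f k) * (\<Prod>k=1..n. g k) * (\<Prod>k=1..n. h k)" for f g h :: "nat \<Rightarrow> complex"
      by (simp only: prod.distrib)
    from this[of "\<lambda>k. q powi y k"
      "\<lambda>k. (z k powi (2 * y k) * q powi (y k * (y k - 1))) ^ (n + 1) * (\<Prod>j=1..2*n+2. ?h2 k j)"
      "\<lambda>k. ?u k ^ n * (1 / ?u k - ?u k)"]
    show ?thesis unfolding P1 P2 Wu by (simp only: mult_ac)
  qed
  also have "\<dots> = (\<Prod>k=1..n. z k ^ n) * (\<Prod>k=1..n. omega q n (\<lambda>j. 1 / a j) (z k) (y k) * (1 / ?u k - ?u k))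
      * vdm (map (\<lambda>k. eps (?u k)) [1..<Suc n]) * (\<Prod>k=1..n. \<Prod>j=1..p. ?h1 k j)"
    unfolding om prod.distrib[of "\<lambda>k. z k ^ n"] ..
  finally show ?thesis .
qed

lemma prod_one_minus_inverse_params:
  fixes a :: "nat \<Rightarrow> complex"
  assumes a: "\<And>j. j \<in> {1..2*n+2} \<Longrightarrow> a j \<noteq> 0" and t: "t \<noteq> 0"
  shows "(\<Prod>j=1..2*n+2. 1 - 1 / a j / t) = 1 / (\<Prod>j=1..2*n+2. a j) * (1 / t ^ (2*n+2)) * (\<Prod>j=1..2*n+2. 1 - a j * t)"
proof -
  have "(\<Prod>j=1..2*n+2. 1 - 1 / a j / t) = (\<Prod>j=1..2*n+2. (- 1) * (1 / a j) * (1 / t) * (1 - a j * t))"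
    using a t by (intro prod.cong refl) (simp add: field_simps)
  also have "\<dots> = (\<Prod>j=1..2*n+2. - 1) * (\<Prod>j=1..2*n+2. 1 / a j) * (\<Prod>j=1..2*n+2. 1 / t) * (\<Prod>j=1..2*n+2. 1 - a j * t)"
    by (simp only: prod.distrib)
  also have "(\<Prod>j=1..2*n+2. - 1) = (1 :: complex)" unfolding prod_constant by simp
  also have "(\<Prod>j=1..2*n+2. 1 / a j) = 1 / (\<Prod>j=1..2*n+2. a j)" unfolding prod_dividef by simp
  also have "(\<Prod>j=1..2*n+2. 1 / t) = 1 / t ^ (2*n+2)" unfolding prod_constant by (simp add: power_one_over)
  finally show ?thesis by (simp only: mult_1_left)
qed

text \<open>The closing cancellation stated for atomic symbols, which keeps the large products out
  of the field simplification. \<open>Sg\<close>, \<open>vT\<close> and \<open>Tn\<close> are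
  normalisations occurring on both sides.\<close>

lemma final_rearrangement:
  fixes G E R V P Ai Tn N1 Q v0 Sg vT K2 F Zn Pi Pq qA :: complex
  assumes G: "G * E = R * (V * P)" and v0: "v0 * Q = Sg * vT * K2"
    and nz: "E \<noteq> 0" "Ai \<noteq> 0" "Tn \<noteq> 0" "Sg \<noteq> 0" "vT \<noteq> 0" "Zn \<noteq> 0" "V \<noteq> 0" "Pi \<noteq> 0" "Pq \<noteq> 0" "qA \<noteq> 0"
  shows "(G * (Ai * (1 / Tn) * N1 * Q * v0 * F)) * (Zn * Tn / ((Zn * V) * Pi * Pq * vT * (Ai * qA * Sg)))
       = P / Pi * (R / E) * (N1 / Pq) * K2 * (1 / qA) * F"
proof -
  have g: "G = R * (V * P) / E" using G nz(1) by (simp add: eq_divide_eq)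
  have e: "Ai * (1 / Tn) * N1 * Q * v0 * F = Ai * (1 / Tn) * N1 * (Sg * vT * K2) * F"
    unfolding v0[symmetric] by (simp only: mult_ac)
  show ?thesis unfolding e unfolding g using nz by (simp add: field_simps)
qed

theorem theorem3p1:
  fixes q A :: complex
    and n p M :: nat
    and m :: "nat \<Rightarrow> nat"
    and a c z :: "nat \<Rightarrow> complex"
  assumes q: "0 < norm q" "norm q < 1"
    and np: "n \<ge> 1" "p \<ge> 1"
    and A: "A = (\<Prod>j=1..2*n+2. a j)"
    and M: "M = (\<Sum>j=1..p. m j)"
    and conv: "norm (q powi (1 - int M) / A) < 1"
    \<comment> \<open>parameters by which one divides\<close>
    and a_nz: "\<forall>j\<in>{1..2*n+2}. a j \<noteq> 0"
    and c_nz: "\<forall>j\<in>{1..p}. c j \<noteq> 0"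
    and z_nz: "\<forall>k\<in>{1..n}. z k \<noteq> 0"
    \<comment> \<open>left-hand side: denominators\<close>
    and Wz: "W n z \<noteq> 0"
    and den_cz: "\<forall>j\<in>{1..p}. \<forall>k\<in>{1..n}. \<forall>y::int.
          qpoch q (c j * z k) y \<noteq> 0 \<and> qpoch q (q powi (1 - int (m j)) * z k / c j) y \<noteq> 0"
    and den_az: "\<forall>j\<in>{1..2*n+2}. \<forall>k\<in>{1..n}. \<forall>y::int. qpoch q (q * z k / a j) y \<noteq> 0"
    \<comment> \<open>left-hand side: shifted factorials with negative index in the numerators are well defined\<close>
    and wd_cz: "\<forall>j\<in>{1..p}. \<forall>k\<in>{1..n}. \<forall>y<0.
          qpoch q (q ^ m j * c j * z k) y \<noteq> 0 \<and> qpoch q (q * z k / c j) y \<noteq> 0"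
    and wd_az: "\<forall>j\<in>{1..2*n+2}. \<forall>k\<in>{1..n}. \<forall>y<0. qpoch q (a j * z k) y \<noteq> 0"
    \<comment> \<open>right-hand side: denominators of the prefactor\<close>
    and den_inf: "\<forall>j\<in>{1..2*n+2}. \<forall>k\<in>{1..n}.
          qpoch_inf q (q * z k / a j) \<noteq> 0 \<and> qpoch_inf q (q / (a j * z k)) \<noteq> 0"
    and den_A_inf: "qpoch_inf q (q / A) \<noteq> 0"
    and den_cz_m: "\<forall>j\<in>{1..p}. \<forall>k\<in>{1..n}.
          qpoch q (c j * z k) (int (m j)) \<noteq> 0 \<and> qpoch q (c j / z k) (int (m j)) \<noteq> 0"
    and den_cc_m: "\<forall>j\<in>{1..p}. \<forall>k\<in>{1..p}. qpoch q (c j * c k) (int (m j)) \<noteq> 0"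
    and den_A: "qpoch q A (int M) \<noteq> 0"
    \<comment> \<open>right-hand side: denominators in the finite sum\<close>
    and Wc: "W p (\<lambda>j. c j / csqrt q) \<noteq> 0"
    and den_ca: "\<forall>j\<in>{1..p}. \<forall>k\<in>{1..2*n+2}. \<forall>x\<in>{0..m j}. qpoch q (c j * a k) (int x) \<noteq> 0"
    and den_cc: "\<forall>j\<in>{1..p}. \<forall>k\<in>{1..p}. \<forall>x\<in>{0..m j}.
          qpoch q (q * c j / c k) (int x) \<noteq> 0 \<and> qpoch q (q ^ m k * c j * c k) (int x) \<noteq> 0"
  shows
    "((\<lambda>y :: nat \<Rightarrow> int.
         W n (\<lambda>k. z k * q powi (y k)) / W n z
         * (\<Prod>k=1..n. \<Prod>j=1..p.
              (qpoch q (q ^ m j * c j * z k) (y k) * qpoch q (q * z k / c j) (y k))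
              / (qpoch q (c j * z k) (y k) * qpoch q (q powi (1 - int (m j)) * z k / c j) (y k)))
         * (\<Prod>k=1..n. \<Prod>j=1..2*n+2. qpoch q (a j * z k) (y k) / qpoch q (q * z k / a j) (y k))
         * (q powi (1 - int M) / A) powi (\<Sum>k=1..n. y k))
      has_sum
        ((\<Prod>k=1..n. \<Prod>j=1..k. qpoch_inf q (q * z j * z k) * qpoch_inf q (q / (z j * z k)))
         * (\<Prod>j=1..n. \<Prod>k=1..n. qpoch_inf q (q * z k / z j))
         / (\<Prod>k=1..n. \<Prod>j=1..2*n+2. qpoch_inf q (q * z k / a j) * qpoch_inf q (q / (a j * z k)))
         * ((\<Prod>k=1..2*n+2. \<Prod>j=1..<k. qpoch_inf q (q / (a j * a k))) / qpoch_inf q (q / A))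
         * ((\<Prod>k=1..2*n+2. \<Prod>j=1..p. qpoch q (c j * a k) (int (m j)))
            / (\<Prod>k=1..n. \<Prod>j=1..p. qpoch q (c j * z k) (int (m j)) * qpoch q (c j / z k) (int (m j))))
         * ((\<Prod>k=1..p. \<Prod>j=1..<k. qpoch q (c j * c k) (int (m j + m k)))
            / (\<Prod>j=1..p. \<Prod>k=1..p. qpoch q (c j * c k) (int (m j))))
         * (1 / qpoch q A (int M))
         * (\<Sum>x \<in> (\<Pi>\<^sub>E j\<in>{1..p}. {0..m j}).
              W p (\<lambda>j. c j * q ^ x j / csqrt q) / W p (\<lambda>j. c j / csqrt q)
              * (\<Prod>k=1..2*n+2. \<Prod>j=1..p.
                   qpoch q (c j / a k) (int (x j)) / qpoch q (c j * a k) (int (x j)))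
              * (\<Prod>j=1..p. \<Prod>k=1..p.
                   (qpoch q (c j * c k / q) (int (x j)) * qpoch q (q powi (- int (m k)) * c j / c k) (int (x j)))
                   / (qpoch q (q * c j / c k) (int (x j)) * qpoch q (q ^ m k * c j * c k) (int (x j))))
              * (A * q ^ M) ^ (\<Sum>j=1..p. x j))))
     ({1..n} \<rightarrow>\<^sub>E (UNIV :: int set))"
proof -
  define s where "s = csqrt q"
  have q0: "q \<noteq> 0" using q(1) by auto
  have q': "q \<noteq> 0" "norm q < 1" using q0 q(2) by auto
  have s: "s \<noteq> 0" "s\<^sup>2 = q" using q0 by (auto simp: s_def)
  have a0: "a j \<noteq> 0" if "j \<in> {1..2*n+2}" for j using a_nz that by blast
  have c0: "c j \<noteq> 0" if "j \<in> {1..p}" for j using c_nz that by blast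
  have z0: "z k \<noteq> 0" if "k \<in> {1..n}" for k using z_nz that by blast
  have A0: "A \<noteq> 0" unfolding A using a0 by simp
  define b where "b j = 1 / a j" for j
  have B: "(\<Prod>j=1..2*n+2. b j) = 1 / A" unfolding b_def A prod_dividef by simp
  \<comment> \<open>With B = 1/A this is \<open>conv\<close> rewritten, and exactly the condition
    for inserting M points.\<close>
  have conv1: "norm (\<Prod>j=1..2*n+2. b j) * norm q < norm q ^ M"
  proof -
    have "q powi (1 - int M) / A = q / q ^ M / A" using q0 by (simp add: power_int_diff)
    hence "norm q / norm q ^ M / norm A < 1" using conv by (simp add: norm_divide norm_mult norm_power)
    thus ?thesis unfolding B using q(1) A0 by (simp add: norm_divide field_simps)
  qed
  have conv0: "norm (q * (\<Prod>j=1..2*n+2. b j)) < 1"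
  proof -
    have "norm q ^ M \<le> 1" using q by (intro power_le_one) auto
    thus ?thesis using conv1 by (simp add: norm_mult mult.commute del: prod.cl_ivl_Suc)
  qed

  \<comment> \<open>This factorial stands in a numerator, so its non-vanishing is derived by
    splitting it after m_k factors into two denominators.\<close>
  have cc: "qp q (c j * c k) (m j + m k) \<noteq> 0" if jk: "j \<in> {1..p}" "k \<in> {1..p}" for j k
  proof -
    have "qp q (c k * c j) (m k) \<noteq> 0" using den_cc_m jk unfolding qpoch_of_nat by blast
    moreover have "qp q (q ^ m k * c j * c k) (m j) \<noteq> 0" using den_cc jk unfolding qpoch_of_nat by fastforce
    moreover have "qp q (c j * c k) (m k + m j) = qp q (c k * c j) (m k) * qp q (q ^ m k * c j * c k) (m j)"
      unfolding qp_add by (simp add: mult_ac)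
    ultimately show ?thesis by (simp add: add.commute)
  qed
  have Wc': "(\<Prod>j=1..p. 1 - c j / s * (c j / s)) * (\<Prod>k=1..p. \<Prod>j=1..<k. c j / s * (c k / s) * (eps (c k / s) - eps (c j / s))) \<noteq> 0"
    using Wc W_eps[of p "\<lambda>j. c j / s"] c0 s(1) unfolding s_def by auto
  have ss: "x / s * (y / s) = x * y / q" for x y using s by (simp add: power2_eq_square)
  have n1: "1 - c j * c j / q \<noteq> 0" if "j \<in> {1..p}" for j
    using Wc' that unfolding ss by auto
  have eps_ne: "eps (c k / s) - eps (c j / s) \<noteq> 0" if jk: "k \<in> {1..p}" "j \<in> {1..<k}" for j k
  proof
    assume "eps (c k / s) - eps (c j / s) = 0"
    hence "(\<Prod>k=1..p. \<Prod>j=1..<k. c j / s * (c k / s) * (eps (c k / s) - eps (c j / s))) = 0"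
      using jk by (intro prod_zero bexI[of _ k] bexI[of _ j]) auto
    with Wc' show False by simp
  qed
  have W2: "c k \<noteq> c j \<and> 1 - c j * c k / q \<noteq> 0" if jk: "j \<in> {1..p}" "k \<in> {1..p}" "j \<noteq> k" for j k
  proof -
    have *: "c k \<noteq> c j \<and> 1 - c j * c k / q \<noteq> 0" if "k \<in> {1..p}" "j \<in> {1..<k}" for j k
    proof -
      have "c j \<noteq> 0" "c k \<noteq> 0" using that c0 by auto
      hence "eps (c k / s) - eps (c j / s) = (c k / s - c j / s) * (1 - 1 / (c k * c j / q))"
        using s(1) by (subst eps_diff) (auto simp only: ss divide_eq_0_iff)
      with eps_ne[OF that] have "c k / s - c j / s \<noteq> 0" "1 - 1 / (c k * c j / q) \<noteq> 0" by auto
      thus ?thesis using q0 by (auto simp: mult.commute)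
    qed
    show ?thesis
    proof (cases "j < k")
      case True
      thus ?thesis using *[of k j] jk by auto
    next
      case False
      hence "k < j" using jk(3) by simp
      thus ?thesis using *[of j k] jk by (auto simp: mult.commute)
    qed
  qed
  \<comment> \<open>The case l = 0 comes from W(q^(-1/2) c), the others from \<open>cc\<close> with
    l - 1.\<close>
  have ccq: "c j * c k * q ^ l \<noteq> q" if jk: "j \<in> {1..p}" "k \<in> {1..p}" and l: "l \<le> m k" for j k l
  proof (cases l)
    case 0
    have "1 - c j * c k / q \<noteq> 0" using n1[OF jk(1)] W2[OF jk] by (cases "j = k") auto
    thus ?thesis using 0 q0 by auto
  next
    case (Suc l')
    have "c j * c k * q ^ l' \<noteq> 1" using cc[OF jk] l Suc unfolding qp_eq_0_iff by auto
    thus ?thesis using Suc q0 by (auto simp: field_simps)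
  qed
  have ne: "c k * q ^ l \<noteq> c j" if jk: "j \<in> {1..p}" "k \<in> {1..p}" "j \<noteq> k" and l: "l \<le> m k" for j k l
  proof (cases l)
    case 0
    thus ?thesis using W2[OF jk] by simp
  next
    case (Suc l')
    have "qp q (q * c k / c j) (m k) \<noteq> 0" using den_cc jk unfolding qpoch_of_nat by fastforce
    hence "q * c k / c j * q ^ l' \<noteq> 1" using Suc l unfolding qp_eq_0_iff by auto
    thus ?thesis using Suc c0[OF jk(1)] by (auto simp: field_simps)
  qed
  have qpow: "q ^ i \<noteq> 1" if "0 < i" for i
  proof
    assume "q ^ i = 1"
    hence "norm q ^ i = 1" by (metis norm_one norm_power)
    moreover have "norm q ^ i < 1" using q that by (simp add: power_less_one_iff)
    ultimately show False by simp
  qed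
  have n2: "starprod q s (m j) (c j) 0 \<noteq> 0" if j: "j \<in> {1..p}" for j
  proof -
    have "eps (c j * q ^ i / s) - eps (c j * q ^ 0 / s) \<noteq> 0" if i: "i \<in> {..m j} - {0}" for i
    proof -
      have "c j * q ^ i - c j * q ^ 0 \<noteq> 0" using qpow[of i] i c0[OF j] by simp
      moreover have "1 - q / (c j * c j * q ^ (i + 0)) \<noteq> 0" using ccq[OF j j, of i] i c0[OF j] q0 by auto
      ultimately show ?thesis unfolding eps_diff_half[OF s c0[OF j] c0[OF j]] using s(1) by simp
    qed
    thus ?thesis unfolding starprod_def by (simp only: prod_zero_iff finite_Diff finite_atMost) blast
  qed
  have n3: "rowprod q s (c k) (m k) (c j) 0 \<noteq> 0" if jk: "j \<in> {1..p}" "k \<in> {1..p}" "j \<noteq> k" for j k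
  proof -
    have "eps (c k * q ^ l / s) - eps (c j * q ^ 0 / s) \<noteq> 0" if l: "l \<in> {..m k}" for l
    proof -
      have "c k * q ^ l - c j * q ^ 0 \<noteq> 0" using ne[OF jk, of l] l by simp
      moreover have "1 - q / (c j * c k * q ^ (l + 0)) \<noteq> 0" using ccq[OF jk(1,2), of l] l c0 jk q0 by auto
      ultimately show ?thesis unfolding eps_diff_half[OF s c0[OF jk(1)] c0[OF jk(2)]] using s(1) by simp
    qed
    thus ?thesis unfolding rowprod_def by (simp only: prod_zero_iff finite_atMost) blast
  qed

  define ts where "ts = concat (map (\<lambda>j. map (\<lambda>i. c j * q ^ i) [0..<m j]) [1..<Suc p])"
  have len: "length (map eps ts) = M"
    unfolding ts_def M by (simp add: length_concat o_def interv_sum_list_conv_sum_set_nat atLeastLessThanSuc_atLeastAtMost del: upt_Suc)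
  have vT: "vdm (map eps ts) \<noteq> 0"
    unfolding ts_def by (rule vdm_eps_blocks_nonzero[OF q' c0 cc ne])

  have "\<forall>i. \<exists>h. degree h \<le> n + i \<and> coeff h (n + i) = ((\<Prod>j=1..2*n+2. b j) - q ^ i) / s ^ i
    \<and> (\<forall>u. u \<noteq> 0 \<longrightarrow> poly h (u + 1 / u) * (1 / u - u)
        = u ^ (n + 1) * (\<Prod>j=1..2*n+2. 1 - b j / u) * (u * s + 1 / (u * s)) ^ i
        - 1 / u ^ (n + 1) * (\<Prod>j=1..2*n+2. 1 - b j * u) * (u / s + s / u) ^ i)"
    by (intro allI lowering_poly[OF s])
  from choice[OF this] obtain h where h: "\<forall>i. degree (h i) \<le> n + i \<and> coeff (h i) (n + i) = ((\<Prod>j=1..2*n+2. b j) - q ^ i) / s ^ i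
    \<and> (\<forall>u. u \<noteq> 0 \<longrightarrow> poly (h i) (u + 1 / u) * (1 / u - u)
        = u ^ (n + 1) * (\<Prod>j=1..2*n+2. 1 - b j / u) * (u * s + 1 / (u * s)) ^ i
        - 1 / u ^ (n + 1) * (\<Prod>j=1..2*n+2. 1 - b j * u) * (u / s + s / u) ^ i)"
    ..
  have h1: "degree (h i) \<le> n + i" and h2: "coeff (h i) (n + i) = ((\<Prod>j=1..2*n+2. b j) - q ^ i) / s ^ i" for i
    using h by blast+
  have h3: "poly (h i) (u + 1 / u) * (1 / u - u)
        = u ^ (n + 1) * (\<Prod>j=1..2*n+2. 1 - b j / u) * (u * s + 1 / (u * s)) ^ i
        - 1 / u ^ (n + 1) * (\<Prod>j=1..2*n+2. 1 - b j * u) * (u / s + s / u) ^ i" if "u \<noteq> 0" for i u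
    using h that by blast

  define X where "X y k = eps (z k * q powi y k)" for y k
  define wt where "wt y k = omega q n b (z k) (y k) * (1 / (z k * q powi y k) - z k * q powi y k)" for y k
  \<comment> \<open>The top coefficient of \<open>h i\<close> is (1/A)(1 - A q^i)/s^i; the product
    over i < M is the origin of (A)_|m|.\<close>
  define \<Lambda> where "\<Lambda> = (1 / A) ^ M * qp q A M * (\<Prod>i<M. (1 / s) ^ i)"
  have \<Lambda>: "(\<Prod>i<M. coeff (h i) (n + i)) = \<Lambda>"
  proof -
    have "coeff (h i) (n + i) = 1 / A * (1 - A * q ^ i) * (1 / s) ^ i" for i
      unfolding h2 B using A0 by (simp add: power_one_over field_simps)
    thus ?thesis unfolding \<Lambda>_def qp_def by (simp only: prod.distrib prod_constant card_lessThan)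
  qed
  have HS: "((\<lambda>y. (\<Prod>k=1..n. wt y k) * vdm (map (X y) [1..<Suc n] @ map eps ts) * \<Lambda>)
      has_sum (gsum q n b z * rdet (map (\<lambda>x i. poly (h i) x) (map eps ts)))) ({1..n} \<rightarrow>\<^sub>E UNIV)"
    unfolding \<Lambda>[symmetric] len[symmetric] wt_def X_def eps_def[of "z _ * q powi _"]
    by (rule has_sum_omega_vdm[OF q' s]) (use z0 conv1 len h1 h3 in auto)

  define PA where "PA t = (\<Prod>j=1..2*n+2. 1 - a j * t)" for t
  define PB where "PB t = (\<Prod>j=1..2*n+2. 1 - b j * t)" for t
  \<comment> \<open>\<open>al\<close> and \<open>be\<close> are the two coefficients in the formula
    for \<open>h l\<close> at t, divided by 1/t - t. They do not depend on \<open>l\<close>. The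
    first is rewritten from 1 - b_j/t to 1 - a_j t, so that the factorials (c_j a_k) appear.\<close>
  define al where "al t = t ^ (n + 1) * (1 / A * (1 / t ^ (2*n+2)) * PA t) / (1 / t - t)" for t
  define be where "be t = 1 / t ^ (n + 1) * PB t / (1 / t - t)" for t
  define \<alpha> where "\<alpha> j i = al (c j * q ^ i)" for j i
  define \<beta> where "\<beta> j i = be (c j * q ^ i)" for j i
  define e where "e j i = (\<lambda>l. eps (c j * q ^ i / s) ^ l)" for j i and l :: nat
  have tt: "c j * q ^ i \<noteq> 0" "c j * q ^ i * (c j * q ^ i) \<noteq> 1" if "j \<in> {1..p}" "i < m j" for j i
  proof -
    show "c j * q ^ i \<noteq> 0" using c0[OF that(1)] q0 by simp
    have "c j * c j * q ^ (i + i) \<noteq> 1" using cc[OF that(1,1)] that(2) unfolding qp_eq_0_iff by auto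
    thus "c j * q ^ i * (c j * q ^ i) \<noteq> 1" by (simp add: power_add mult_ac)
  qed
  \<comment> \<open>For t = c_j q^i the shifted point t s is c_j q^(i+1)/s, which is also the lower
    node of the next point; this produces the chains of \<open>rdet_blocks\<close>.\<close>
  have poly_h: "poly (h l) (eps (c j * q ^ i)) = \<alpha> j i * e j (Suc i) l - \<beta> j i * e j i l"
    if ji: "j \<in> {1..p}" "i < m j" for j i l
  proof -
    let ?t = "c j * q ^ i"
    have d: "1 / ?t - ?t \<noteq> 0" using tt[OF ji] by (simp add: field_simps)
    have e1: "?t * s + 1 / (?t * s) = eps (c j * q ^ Suc i / s)"
    proof -
      have "c j * q ^ Suc i / s = ?t * s" using s(1) unfolding s(2)[symmetric] by (simp add: power2_eq_square)
      thus ?thesis unfolding eps_def by (simp only:)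
    qed
    have e2: "?t / s + s / ?t = eps (?t / s)" unfolding eps_def by simp
    have "(\<Prod>j=1..2*n+2. 1 - b j / ?t) = 1 / A * (1 / ?t ^ (2*n+2)) * PA ?t"
      unfolding b_def PA_def A by (rule prod_one_minus_inverse_params[OF a0 tt(1)[OF ji]])
    hence "poly (h l) (eps ?t) * (1 / ?t - ?t)
        = ?t ^ (n + 1) * (1 / A * (1 / ?t ^ (2*n+2)) * PA ?t) * eps (c j * q ^ Suc i / s) ^ l
        - 1 / ?t ^ (n + 1) * PB ?t * eps (?t / s) ^ l"
      using h3[OF tt(1)[OF ji], of l] unfolding e1 e2 PB_def eps_def[of ?t] by (simp only:)
    hence "poly (h l) (eps ?t) = (?t ^ (n + 1) * (1 / A * (1 / ?t ^ (2*n+2)) * PA ?t) * eps (c j * q ^ Suc i / s) ^ l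
        - 1 / ?t ^ (n + 1) * PB ?t * eps (?t / s) ^ l) / (1 / ?t - ?t)"
      unfolding eq_divide_eq using d by simp
    thus ?thesis unfolding \<alpha>_def \<beta>_def al_def be_def e_def by (simp only: diff_divide_distrib times_divide_eq_left)
  qed
  have rows: "map (\<lambda>x i. poly (h i) x) (map eps ts)
     = concat (map (\<lambda>j. map (\<lambda>i l. \<alpha> j i * e j (Suc i) l - \<beta> j i * e j i l) [0..<m j]) [1..<Suc p])"
  proof -
    have "map (\<lambda>x i. poly (h i) x) (map eps ts)
       = concat (map (\<lambda>j. map (\<lambda>i l. poly (h l) (eps (c j * q ^ i))) [0..<m j]) [1..<Suc p])"
      unfolding ts_def map_concat by (simp add: o_def del: upt_Suc)
    also have "\<dots> = concat (map (\<lambda>j. map (\<lambda>i l. \<alpha> j i * e j (Suc i) l - \<beta> j i * e j i l) [0..<m j]) [1..<Suc p])"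
      by (intro arg_cong[of _ _ concat] map_cong refl ext) (auto intro!: poly_h simp del: upt_Suc)
    finally show ?thesis .
  qed
  define T where "T x = (\<Prod>j=1..p. (\<Prod>i<x j. - \<beta> j i) * (\<Prod>i\<in>{x j..<m j}. \<alpha> j i))
       * vdm (concat (map (\<lambda>j. map (\<lambda>i. eps (c j * q ^ i / s)) (missing (m j) (x j))) [1..<Suc p]))" for x
  have rdet_T: "rdet (map (\<lambda>x i. poly (h i) x) (map eps ts)) = (\<Sum>x\<in>(\<Pi>\<^sub>E j\<in>{1..p}. {0..m j}). T x)"
  proof -
    have "concat (map (\<lambda>j. map (e j) (missing (m j) (x j))) [1..<Suc p])
       = map (\<lambda>x i. x ^ i) (concat (map (\<lambda>j. map (\<lambda>i. eps (c j * q ^ i / s)) (missing (m j) (x j))) [1..<Suc p]))" for x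
      unfolding map_concat e_def by (simp add: o_def del: upt_Suc)
    hence "rdet (concat (map (\<lambda>j. map (e j) (missing (m j) (x j))) [1..<Suc p]))
       = vdm (concat (map (\<lambda>j. map (\<lambda>i. eps (c j * q ^ i / s)) (missing (m j) (x j))) [1..<Suc p]))" for x
      by (simp only: rdet_Vandermonde)
    thus ?thesis unfolding rows T_def
      using rdet_blocks[of \<alpha> e \<beta> m p "[]"] by (simp only: append_Nil2)
  qed
  have PA0: "1 - c j * a k * q ^ i \<noteq> 0" if "j \<in> {1..p}" "k \<in> {1..2*n+2}" "i < m j" for j k i
  proof -
    have "qp q (c j * a k) (m j) \<noteq> 0" using den_ca that(1,2) unfolding qpoch_of_nat by fastforce
    thus ?thesis using that(3) unfolding qp_eq_0_iff by auto
  qed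
  \<comment> \<open>Each unit of x_j exchanges one \<alpha> for one -\<beta>; their ratio yields
    A^|x| and the quotients of (c_j/a_k) by (c_j a_k).\<close>
  have \<beta>: "- \<beta> j i = \<alpha> j i * (- A * (\<Prod>k\<in>{1..2*n+2}. (1 - c j / a k * q ^ i) / (1 - c j * a k * q ^ i)))"
    if ji: "j \<in> {1..p}" "i < m j" for j i
  proof -
    let ?t = "c j * q ^ i"
    have PA: "PA ?t = (\<Prod>k=1..2*n+2. 1 - c j * a k * q ^ i)" unfolding PA_def by (intro prod.cong refl) (simp add: mult_ac)
    have PB: "PB ?t = (\<Prod>k=1..2*n+2. 1 - c j / a k * q ^ i)" unfolding PB_def b_def by (intro prod.cong refl) simp
    have 1: "PA ?t \<noteq> 0" unfolding PA using PA0[OF ji(1) _ ji(2)] by (simp del: prod.cl_ivl_Suc)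
    have 2: "?t ^ (2*n+2) = ?t ^ (n + 1) * ?t ^ (n + 1)" by (simp flip: power_add add: mult_2)
    have alg: "- (1 / w * P' / d) = w * (1 / A * (1 / (w * w)) * P) / d * (- A * (P' / P))" if "w \<noteq> 0" "P \<noteq> 0" for w P P' d :: complex
      using that A0 by simp
    show ?thesis
      unfolding \<alpha>_def \<beta>_def al_def be_def prod_dividef PA[symmetric] PB[symmetric] 2
      by (rule alg) (use tt(1)[OF ji] 1 in auto)
  qed
  define F where "F x = W p (\<lambda>j. c j * q ^ x j / s) / W p (\<lambda>j. c j / s)
       * (\<Prod>k\<in>{1..2*n+2}. \<Prod>j=1..p. qp q (c j / a k) (x j) / qp q (c j * a k) (x j))
       * (\<Prod>j=1..p. \<Prod>k=1..p. (qp q (c j * c k / q) (x j) * qp q (c j / (c k * q ^ m k)) (x j))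
            / (qp q (q * c j / c k) (x j) * qp q (q ^ m k * c j * c k) (x j)))
       * (A * q ^ (\<Sum>j=1..p. m j)) ^ (\<Sum>j=1..p. x j)" for x :: "nat \<Rightarrow> nat"
  have T_F: "T x = T (\<lambda>_. 0) * F x" if x: "x \<in> (\<Pi>\<^sub>E j\<in>{1..p}. {0..m j})" for x
  proof -
    have xm: "x j \<le> m j" if "j \<in> {1..p}" for j using x that by (auto simp: PiE_iff)
    have n45: "qp q (q * c j / c k) (x j) \<noteq> 0" "qp q (q ^ m k * c j * c k) (x j) \<noteq> 0" if "j \<in> {1..p}" "k \<in> {1..p}" for j k
      using den_cc that xm[OF that(1)] unfolding qpoch_of_nat by fastforce+
    show ?thesis unfolding T_def F_def
      by (rule expansion_term_ratio[OF s c0 xm n1 n2 n3 n45 \<beta>])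
  qed
  have rdet_F: "rdet (map (\<lambda>x i. poly (h i) x) (map eps ts)) = T (\<lambda>_. 0) * (\<Sum>x\<in>(\<Pi>\<^sub>E j\<in>{1..p}. {0..m j}). F x)"
    unfolding rdet_T sum_distrib_left by (rule sum.cong[OF refl T_F])

  \<comment> \<open>From (1 - t u)(1 - t/u) = t (eps t - eps u), once for each point t and each of
    the n variables.\<close>
  define Tn where "Tn = (\<Prod>j=1..p. \<Prod>i<m j. c j * q ^ i) ^ n"
  define N1 where "N1 = (\<Prod>k=1..2*n+2. \<Prod>j=1..p. qp q (c j * a k) (m j))"
  define Q where "Q = (\<Prod>j=1..p. \<Prod>i<m j. 1 / (1 - c j * c j * q ^ (2 * i)))"
  define v0 where "v0 = vdm (concat (map (\<lambda>j. map (\<lambda>i. eps (c j * q ^ i / s)) (missing (m j) 0)) [1..<Suc p]))"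
  have T0: "T (\<lambda>_. 0) = (1 / A) ^ M * (1 / Tn) * N1 * Q * v0"
  proof -
    have al: "\<alpha> j i = 1 / A * (1 / (c j * q ^ i) ^ n) * (\<Prod>k=1..2*n+2. 1 - c j * a k * q ^ i) * (1 / (1 - c j * c j * q ^ (2 * i)))"
      if ji: "j \<in> {1..p}" "i < m j" for j i
    proof -
      let ?t = "c j * q ^ i"
      have PA: "PA ?t = (\<Prod>k=1..2*n+2. 1 - c j * a k * q ^ i)" unfolding PA_def by (intro prod.cong refl) (simp add: mult_ac)
      have 2: "?t ^ (2*n+2) = ?t ^ n * ?t * (?t ^ n * ?t)" by (simp flip: power_Suc2 power_add add: mult_2)
      have 3: "?t * ?t = c j * c j * q ^ (2 * i)" unfolding mult_2 power_add by (simp only: mult_ac)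
      have alg: "w * t * (1 / A * (1 / (w * t * (w * t))) * P) / (1 / t - t) = 1 / A * (1 / w) * P * (1 / (1 - t * t))"
        if "w \<noteq> 0" "t \<noteq> 0" "t * t \<noteq> 1" for w t P :: complex
      proof -
        have "1 / t - t = (1 - t * t) / t" using that by (simp add: field_simps)
        thus ?thesis using that A0 by simp
      qed
      have 4: "?t ^ (n + 1) = ?t ^ n * ?t" by simp
      show ?thesis unfolding \<alpha>_def al_def PA 4 2 3[symmetric]
        by (rule alg) (use tt[OF ji] in auto)
    qed
    have "(\<Prod>j=1..p. \<Prod>i<m j. \<alpha> j i) = (\<Prod>j=1..p. \<Prod>i<m j. 1 / A * (1 / (c j * q ^ i) ^ n) * (\<Prod>k=1..2*n+2. 1 - c j * a k * q ^ i) * (1 / (1 - c j * c j * q ^ (2 * i))))"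
      by (intro prod.cong refl al) auto
    also have "\<dots> = (\<Prod>j=1..p. \<Prod>i<m j. 1 / A) * (\<Prod>j=1..p. \<Prod>i<m j. 1 / (c j * q ^ i) ^ n)
        * (\<Prod>j=1..p. \<Prod>i<m j. \<Prod>k=1..2*n+2. 1 - c j * a k * q ^ i) * Q"
      unfolding Q_def by (simp only: prod.distrib)
    also have "(\<Prod>j=1..p. \<Prod>i<m j. 1 / A) = (1 / A) ^ M"
      unfolding M by (simp add: power_sum)
    also have "(\<Prod>j=1..p. \<Prod>i<m j. 1 / (c j * q ^ i) ^ n) = 1 / Tn"
      unfolding Tn_def by (simp only: prod_dividef prod_power_distrib prod.neutral_const)
    also have "(\<Prod>j=1..p. \<Prod>i<m j. \<Prod>k=1..2*n+2. 1 - c j * a k * q ^ i) = N1"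
    proof -
      have "(\<Prod>j=1..p. \<Prod>i<m j. \<Prod>k=1..2*n+2. 1 - c j * a k * q ^ i) = (\<Prod>j=1..p. \<Prod>k=1..2*n+2. qp q (c j * a k) (m j))"
        unfolding qp_def by (intro prod.cong refl prod.swap)
      also have "\<dots> = N1" unfolding N1_def by (rule prod.swap)
      finally show ?thesis .
    qed
    finally show ?thesis unfolding T_def v0_def by (simp add: atLeast0LessThan)
  qed
  define K2 where "K2 = (\<Prod>j=1..p. 1 / qp q (c j * c j) (m j))
       * (\<Prod>k=1..p. \<Prod>j=1..<k. qp q (c j * c k) (m j + m k) / (qp q (c j * c k) (m j) * qp q (c j * c k) (m k)))"
  \<comment> \<open>The powers of \<open>s\<close> and the Vandermonde product of the insertion
    points will cancel against \<Lambda> and \<kappa>, so no square root of q survives in the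
    prefactor.\<close>
  have v0Q: "v0 * Q = (\<Prod>i<M. (1 / s) ^ i) * vdm (map eps ts) * K2"
  proof -
    have "v0 * Q = (\<Prod>i<length ts. (1 / s) ^ i) * vdm (map eps ts) * (\<Prod>j=1..p. 1 / qp q (c j * c j) (m j))
       * (\<Prod>k=1..p. \<Prod>j=1..<k. qp q (c j * c k) (m j + m k) / (qp q (c j * c k) (m j) * qp q (c j * c k) (m k)))"
      unfolding v0_def Q_def ts_def by (rule expansion_term_0[OF s c0 cc])
    thus ?thesis using len unfolding K2_def by (simp only: length_map mult.assoc)
  qed

  define Pi where "Pi = (\<Prod>k=1..n. \<Prod>j=1..2*n+2. qpoch_inf q (q * z k / a j) * qpoch_inf q (q / (a j * z k)))"
  define Pq where "Pq = (\<Prod>k=1..n. \<Prod>j=1..p. qp q (c j * z k) (m j) * qp q (c j / z k) (m j))"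
  define Zn where "Zn = (\<Prod>k=1..n. z k ^ n)"
  define V where "V = (\<Prod>k=1..n. 1 / z k - z k) * vdm (map (\<lambda>k. z k + 1 / z k) [1..<Suc n])"
  have WV: "W n z = Zn * V"
  proof -
    have "W n z = (\<Prod>k=1..n. z k ^ n * (1 / z k - z k)) * vdm (map (\<lambda>k. eps (z k)) [1..<Suc n])"
      by (rule W_vdm) (rule z0)
    thus ?thesis unfolding Zn_def V_def eps_def by (simp only: prod.distrib mult.assoc)
  qed
  have nz: "Zn \<noteq> 0" "V \<noteq> 0" "Pi \<noteq> 0" "Pq \<noteq> 0" "Tn \<noteq> 0" "qp q A M \<noteq> 0" "(\<Prod>i<M. (1 / s) ^ i) \<noteq> 0" "(1 / A) ^ M \<noteq> 0"
  proof -
    show "Zn \<noteq> 0" "V \<noteq> 0" using Wz unfolding WV by auto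
    show "Pi \<noteq> 0" unfolding Pi_def using den_inf by (simp del: prod.cl_ivl_Suc)
    show "Pq \<noteq> 0" unfolding Pq_def using den_cz_m unfolding qpoch_of_nat by (simp del: prod.cl_ivl_Suc)
    show "Tn \<noteq> 0" unfolding Tn_def using tt(1) by auto
    show "qp q A M \<noteq> 0" using den_A unfolding qpoch_of_nat .
  qed (use s A0 in auto)
  have \<Lambda>0: "\<Lambda> \<noteq> 0" unfolding \<Lambda>_def using nz by simp
  \<comment> \<open>The y-independent ratio between the summand of the theorem and that of
    \<open>HS\<close>: \<open>summand_eq\<close> supplies W(z), \<open>Pi\<close>, \<open>Pq\<close>
    and \<open>Zn\<close>, rewriting insertions as node differences supplies \<open>Tn\<close>, and
    \<open>HS\<close> carries the Vandermonde product of the points and \<Lambda>.\<close>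
  define \<kappa> where "\<kappa> = Zn * Tn / ((Zn * V) * Pi * Pq * vdm (map eps ts) * \<Lambda>)"
  let ?L = "\<lambda>y :: nat \<Rightarrow> int.
         W n (\<lambda>k. z k * q powi (y k)) / W n z
         * (\<Prod>k=1..n. \<Prod>j=1..p.
              (qpoch q (q ^ m j * c j * z k) (y k) * qpoch q (q * z k / c j) (y k))
              / (qpoch q (c j * z k) (y k) * qpoch q (q powi (1 - int (m j)) * z k / c j) (y k)))
         * (\<Prod>k=1..n. \<Prod>j=1..2*n+2. qpoch q (a j * z k) (y k) / qpoch q (q * z k / a j) (y k))
         * (q powi (1 - int M) / A) powi (\<Sum>k=1..n. y k)"
  have L: "?L y = (\<Prod>k=1..n. wt y k) * vdm (map (X y) [1..<Suc n] @ map eps ts) * \<Lambda> * \<kappa>" for y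
  proof -
    define R where "R = (\<Prod>j=1..p. \<Prod>i<m j. \<Prod>k=1..n. eps (c j * q ^ i) - X y k)"
    have L1: "?L y * (W n z * Pi * Pq) = Zn * (\<Prod>k=1..n. wt y k) * vdm (map (X y) [1..<Suc n])
         * (\<Prod>k=1..n. \<Prod>j=1..p. qp q (c j * (z k * q powi y k)) (m j) * qp q (c j / (z k * q powi y k)) (m j))"
      unfolding Pi_def Pq_def Zn_def wt_def X_def b_def
      by (rule summand_eq[OF q' a0 c0 z0 Wz _ _ _ _ A M]) (use den_cz den_az wd_cz wd_az in blast)+
    have "(\<Prod>k=1..n. \<Prod>j=1..p. qp q (c j * (z k * q powi y k)) (m j) * qp q (c j / (z k * q powi y k)) (m j))
        = (\<Prod>k=1..n. \<Prod>j=1..p. \<Prod>i<m j. c j * q ^ i * (eps (c j * q ^ i) - X y k))"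
    proof (intro prod.cong refl)
      fix k j assume k: "k \<in> {1..n}" and j: "j \<in> {1..p}"
      let ?u = "z k * q powi y k"
      have u: "?u \<noteq> 0" using z0[OF k] q0 by simp
      have "(1 - c j * ?u * q ^ i) * (1 - c j / ?u * q ^ i) = c j * q ^ i * (eps (c j * q ^ i) - X y k)" for i
        unfolding X_def eps_def using u c0[OF j] q0 by (simp add: field_simps)
      thus "qp q (c j * ?u) (m j) * qp q (c j / ?u) (m j) = (\<Prod>i<m j. c j * q ^ i * (eps (c j * q ^ i) - X y k))"
        unfolding qp_def prod.distrib[symmetric] by simp
    qed
    also have "\<dots> = (\<Prod>k=1..n. (\<Prod>j=1..p. \<Prod>i<m j. c j * q ^ i)) * (\<Prod>k=1..n. \<Prod>j=1..p. \<Prod>i<m j. eps (c j * q ^ i) - X y k)"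
      by (simp only: prod.distrib)
    also have "(\<Prod>k=1..n. (\<Prod>j=1..p. \<Prod>i<m j. c j * q ^ i)) = Tn" unfolding Tn_def by simp
    also have "(\<Prod>k=1..n. \<Prod>j=1..p. \<Prod>i<m j. eps (c j * q ^ i) - X y k) = R"
      unfolding R_def by (subst prod.swap) (intro prod.cong refl prod.swap)
    finally have L2: "?L y * (W n z * Pi * Pq) = Zn * (\<Prod>k=1..n. wt y k) * vdm (map (X y) [1..<Suc n]) * (Tn * R)"
      using L1 by (simp only:)
    have "(\<Prod>t\<leftarrow>map eps ts. \<Prod>x\<leftarrow>map (X y) [1..<Suc n]. t - x) = R"
    proof -
      have "(\<Prod>x\<leftarrow>map (X y) [1..<Suc n]. t - x) = (\<Prod>k=1..n. t - X y k)" for t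
      proof -
        have "(\<Prod>x\<leftarrow>map (X y) [1..<Suc n]. t - x) = (\<Prod>k\<leftarrow>[1..<Suc n]. t - X y k)" by (simp add: o_def del: upt_Suc)
        also have "\<dots> = (\<Prod>k=1..n. t - X y k)"
          by (subst prod.distinct_set_conv_list[symmetric]) (simp_all add: atLeastLessThanSuc_atLeastAtMost del: upt_Suc)
        finally show ?thesis .
      qed
      hence "(\<Prod>t\<leftarrow>map eps ts. \<Prod>x\<leftarrow>map (X y) [1..<Suc n]. t - x) = (\<Prod>t\<leftarrow>ts. \<Prod>k=1..n. eps t - X y k)"
        by (simp add: o_def del: upt_Suc)
      also have "\<dots> = R" unfolding ts_def prod_list_concat_upt R_def by (simp add: o_def prod_list_upt)
      finally show ?thesis .
    qed
    hence vA: "vdm (map (X y) [1..<Suc n] @ map eps ts) = vdm (map (X y) [1..<Suc n]) * vdm (map eps ts) * R"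
      unfolding vdm_append by (simp only:)
    have alg: "x = w * (v * vT * R) * L * (Zn * Tn / (W' * Pi * Pq * vT * L))"
      if "x * (W' * Pi * Pq) = Zn * w * v * (Tn * R)" "W' \<noteq> 0" "vT \<noteq> 0" "L \<noteq> 0" for x w v vT R L W' :: complex
    proof -
      have "x = Zn * w * v * (Tn * R) / (W' * Pi * Pq)" using that(1,2) nz(3,4) by (simp add: eq_divide_eq)
      thus ?thesis using that(2-) nz by (simp add: field_simps)
    qed
    show ?thesis unfolding vA \<kappa>_def WV[symmetric]
      by (rule alg[OF L2 Wz vT \<Lambda>0])
  qed
  have sum: "(?L has_sum (gsum q n b z * (T (\<lambda>_. 0) * (\<Sum>x\<in>(\<Pi>\<^sub>E j\<in>{1..p}. {0..m j}). F x)) * \<kappa>)) ({1..n} \<rightarrow>\<^sub>E UNIV)"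
    unfolding L using has_sum_cmult_left[OF HS, of \<kappa>] unfolding rdet_F .
  define P where "P = (\<Prod>k=1..n. \<Prod>j=1..k. qpoch_inf q (q * z j * z k) * qpoch_inf q (q / (z j * z k)))
         * (\<Prod>j=1..n. \<Prod>k=1..n. qpoch_inf q (q * z k / z j))"
  have G: "gsum q n b z * qpoch_inf q (q / A) = pairs_inf q (2*n+2) b * (V * P)"
    using gsum_eval[OF q' z0 conv0] unfolding B V_def P_def by simp
  have "gsum q n b z * (T (\<lambda>_. 0) * (\<Sum>x\<in>(\<Pi>\<^sub>E j\<in>{1..p}. {0..m j}). F x)) * \<kappa>
     = P / Pi * (pairs_inf q (2*n+2) b / qpoch_inf q (q / A)) * (N1 / Pq) * K2 * (1 / qp q A M) * (\<Sum>x\<in>(\<Pi>\<^sub>E j\<in>{1..p}. {0..m j}). F x)"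
    unfolding T0 \<kappa>_def \<Lambda>_def
    by (rule final_rearrangement[OF G v0Q den_A_inf nz(8) nz(5) nz(7) vT nz(1-4) nz(6)])
  \<comment> \<open>The full square over (j,k) is the diagonal times, for each pair j < k, the
    factorials of lengths m_j and m_k.\<close>
  also have "K2 = (\<Prod>k=1..p. \<Prod>j=1..<k. qp q (c j * c k) (m j + m k)) / (\<Prod>j=1..p. \<Prod>k=1..p. qp q (c j * c k) (m j))"
  proof -
    have "(\<Prod>j=1..p. \<Prod>k=1..p. qp q (c j * c k) (m j))
        = (\<Prod>j=1..p. qp q (c j * c j) (m j)) * (\<Prod>k=1..p. \<Prod>j=1..<k. qp q (c j * c k) (m j) * qp q (c j * c k) (m k))"
      unfolding prod_square_split by (simp only: mult.commute[of "c _" "c _"])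
    thus ?thesis unfolding K2_def prod_dividef by simp
  qed
  also have "pairs_inf q (2*n+2) b = (\<Prod>k=1..2*n+2. \<Prod>j=1..<k. qpoch_inf q (q / (a j * a k)))"
    unfolding pairs_inf_def b_def by (intro prod.cong refl) (simp add: mult_ac)
  also have Feq: "F = (\<lambda>x. W p (\<lambda>j. c j * q ^ x j / csqrt q) / W p (\<lambda>j. c j / csqrt q)
              * (\<Prod>k=1..2*n+2. \<Prod>j=1..p.
                   qpoch q (c j / a k) (int (x j)) / qpoch q (c j * a k) (int (x j)))
              * (\<Prod>j=1..p. \<Prod>k=1..p.
                   (qpoch q (c j * c k / q) (int (x j)) * qpoch q (q powi (- int (m k)) * c j / c k) (int (x j)))
                   / (qpoch q (q * c j / c k) (int (x j)) * qpoch q (q ^ m k * c j * c k) (int (x j))))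
              * (A * q ^ M) ^ (\<Sum>j=1..p. x j))"
  proof
    fix x
    have "q powi (- int (m k)) * c j / c k = c j / (c k * q ^ m k)" for j k
      by (simp add: power_int_minus field_simps)
    thus "F x = W p (\<lambda>j. c j * q ^ x j / csqrt q) / W p (\<lambda>j. c j / csqrt q)
              * (\<Prod>k=1..2*n+2. \<Prod>j=1..p.
                   qpoch q (c j / a k) (int (x j)) / qpoch q (c j * a k) (int (x j)))
              * (\<Prod>j=1..p. \<Prod>k=1..p.
                   (qpoch q (c j * c k / q) (int (x j)) * qpoch q (q powi (- int (m k)) * c j / c k) (int (x j)))
                   / (qpoch q (q * c j / c k) (int (x j)) * qpoch q (q ^ m k * c j * c k) (int (x j))))
              * (A * q ^ M) ^ (\<Sum>j=1..p. x j)"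
      unfolding F_def qpoch_of_nat s_def M by (simp only:)
  qed
  finally show ?thesis
    using sum unfolding Feq P_def Pi_def N1_def Pq_def qpoch_of_nat by (simp only:)
qed

end
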